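(* Let $k$ be a field of characteristic zero. Any left Bousfield localization of the category $\mathrm{Ch}_{\ge0}(k)$ of non-negatively graded chain complexes over $k$ preserves $P$-algebras for any colored operad $P$ in $\mathrm{Ch}_{\ge0}(k)$. Any left Bousfield localization of the category of unbounded chain complexes over $k$ that is stable (i.e. commutes with suspension) preserves $P$-algebras for any colored operad $P$ in unbounded chain complexes over $k$.
   Context: Let $\mathcal{M}$ be $\mathrm{Ch}_{\ge0}(k)$ or unbounded chain complexes over $k$, with the projective (equivalently, injective) model structure and the usual tensor product with unit $I=k$. Colored operads: let $\mathfrak C$ be a non-empty set. A $\mathfrak C$-profile is a finite, possibly empty, sequence $\underline c=(c_1,\dots,c_m)$ in $\mathfrak C$; $\Sigma_{\mathfrak C}$ is the groupoid of profiles with permutations as morphisms. A $\mathfrak C$-colored operad (symmetric multicategory enriched in $\mathcal{M}$ with object set $\mathfrak C$) is a functor $P:\Sigma_{\mathfrak C}^{\mathrm{op}}\times\mathfrak C\to\mathcal{M}$, with values $P\binom{d}{\underline c}$, with units $I\to P\binom{c}{c}$ and compositions $P\binom{d}{\underline c}\otimes\bigotimes_{i}P\binom{c_i}{\underline b_i}\to P\binom{d}{(\underline b_1,\dots,\underline b_m)}$ satisfying the usual associativity, unity and equivariance axioms. A $P$-algebra is $A=\{A_c\}\in\mathcal{M}^{\mathfrak C}$ with associative, unital, equivariant structure maps $P\binom{d}{\underline c}\otimes A_{c_1}\otimes\cdots\otimes A_{c_m}\to A_d$. Bousfield localization: it is with respect to a set $\mathcal{C}$ of morphisms of $\mathcal{M}$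 (taken to be cofibrations between cofibrant objects), and $L_{\mathcal{C}}(\mathcal{M})$ is assumed to exist and be cofibrantly generated. $L_{\mathcal{C}}(\mathcal{M})$ is the model structure on $\mathcal{M}$ with the same cofibrations and with weak equivalences the $\mathcal{C}$-local equivalences. An object $N$ is $\mathcal{C}$-local if it is fibrant in $\mathcal{M}$ and $\mathrm{map}(g,N)$ is a weak equivalence of simplicial sets for all $g\in\mathcal{C}$; $f$ is a $\mathcal{C}$-local equivalence if $\mathrm{map}(f,N)$ is a weak equivalence for all $\mathcal{C}$-local $N$ ($\mathrm{map}$ is the homotopy mapping space). $L_{\mathcal{C}}(E)$ denotes the image of $E$ under the composite of derived functors of the identity $\mathrm{Ho}(\mathcal{M})\to\mathrm{Ho}(L_{\mathcal{C}}(\mathcal{M}))\to\mathrm{Ho}(\mathcal{M})$, with localization map $E\to L_{\mathcal{C}}(E)$ the adjunction unit; on $\mathcal{M}^{\mathfrak C}$ it is applied entrywise. Stable means that $L_{\mathcal{C}}$ commutes with the suspension (shift) functor on $\mathrm{Ho}(\mathcal{M})$. $L_{\mathcal{C}}$ preserves $P$-algebras if: (1) for every $P$-algebra $E$ there is a $P$-algebra $\tilde E$ weakly equivalent in $\mathcal{M}^{\mathfrak C}$ to $L_{\mathcal{C}}(E)$; and (2) when $E$ is a cofibrant $P$-algebra, there is a natural choice of $\tilde E$ and a lift of the localization map $E\to L_{\mathcal{C}}(E)$ (a map in the homotopy category) to a $P$-algebra homomorphism $E\to\tilde E$. Here $E$ is cofibrant if the map from the initial $P$-algebra to $E$ has the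 left lifting property against all $P$-algebra maps whose underlying maps are entrywise trivial fibrations in $\mathcal{M}$. *)

theory Defs
  imports
    "HOL-Algebra.Module"
    "HOL-Algebra.Coset"
    "HOL-Combinatorics.Permutations"
    "HOL-Library.FuncSet"
begin

section \<open>Categories, functors and lifting properties\<close>

text \<open>An arrow is a triple (domain, codomain, morphism).  In \<^term>\<open>Cmp C X Y Z g f\<close> the morphism
  \<^term>\<open>f\<close> goes from \<^term>\<open>X\<close> to \<^term>\<open>Y\<close> and \<^term>\<open>g\<close> from \<^term>\<open>Y\<close> to \<^term>\<open>Z\<close>; morphisms below are
  extensional functions, so composition has to know its source.\<close>

record ('o, 'm) cat =
  Ob :: "'o set"
  Hom :: "'o \<Rightarrow> 'o \<Rightarrow> 'm set"
  Idn :: "'o \<Rightarrow> 'm"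
  Cmp :: "'o \<Rightarrow> 'o \<Rightarrow> 'o \<Rightarrow> 'm \<Rightarrow> 'm \<Rightarrow> 'm"

type_synonym ('o, 'm) arr = "'o \<times> 'o \<times> 'm"

definition Arr :: "('o, 'm) cat \<Rightarrow> ('o, 'm) arr set" where
  "Arr C = {(X, Y, f). X \<in> Ob C \<and> Y \<in> Ob C \<and> f \<in> Hom C X Y}"

definition full_subcat :: "('o, 'm) cat \<Rightarrow> 'o set \<Rightarrow> ('o, 'm) cat" where
  "full_subcat C S = C\<lparr>Ob := S\<rparr>"

definition power_cat :: "('o, 'm) cat \<Rightarrow> ('c \<Rightarrow> 'o, 'c \<Rightarrow> 'm) cat" where
  "power_cat C = \<lparr>
     Ob = {X. \<forall>c. X c \<in> Ob C},
     Hom = (\<lambda>X Y. {f. \<forall>c. f c \<in> Hom C (X c) (Y c)}),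
     Idn = (\<lambda>X c. Idn C (X c)),
     Cmp = (\<lambda>X Y Z g f c. Cmp C (X c) (Y c) (Z c) (g c) (f c))\<rparr>"

definition power_arr :: "('o, 'm) arr set \<Rightarrow> ('c \<Rightarrow> 'o, 'c \<Rightarrow> 'm) arr set" where
  "power_arr S = {(X, Y, f). \<forall>c. (X c, Y c, f c) \<in> S}"

definition has_lift :: "('o, 'm) cat \<Rightarrow> ('o, 'm) arr \<Rightarrow> ('o, 'm) arr \<Rightarrow> bool" where
  "has_lift C i p \<longleftrightarrow> (case (i, p) of ((A, B, i), (X, Y, p)) \<Rightarrow>
     \<forall>u \<in> Hom C A X. \<forall>v \<in> Hom C B Y. Cmp C A X Y p u = Cmp C A B Y v i \<longrightarrow>
       (\<exists>h \<in> Hom C B X. Cmp C A B X h i = u \<and> Cmp C B X Y p h = v))"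

definition llp :: "('o, 'm) cat \<Rightarrow> ('o, 'm) arr set \<Rightarrow> ('o, 'm) arr set" where
  "llp C S = {i \<in> Arr C. \<forall>p \<in> S. has_lift C i p}"

definition rlp :: "('o, 'm) cat \<Rightarrow> ('o, 'm) arr set \<Rightarrow> ('o, 'm) arr set" where
  "rlp C S = {p \<in> Arr C. \<forall>i \<in> S. has_lift C i p}"

definition initial_ob :: "('o, 'm) cat \<Rightarrow> 'o \<Rightarrow> bool" where
  "initial_ob C I \<longleftrightarrow> I \<in> Ob C \<and> (\<forall>X \<in> Ob C. \<exists>!f. f \<in> Hom C I X)"

definition terminal_ob :: "('o, 'm) cat \<Rightarrow> 'o \<Rightarrow> bool" where
  "terminal_ob C T \<longleftrightarrow> T \<in> Ob C \<and> (\<forall>X \<in> Ob C. \<exists>!f. f \<in> Hom C X T)"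

record ('o, 'm, 'p, 'n) func =
  FOb :: "'o \<Rightarrow> 'p"
  FMap :: "'o \<Rightarrow> 'o \<Rightarrow> 'm \<Rightarrow> 'n"

definition is_functor ::
  "('o, 'm) cat \<Rightarrow> ('p, 'n) cat \<Rightarrow> ('o, 'm, 'p, 'n) func \<Rightarrow> bool" where
  "is_functor C D F \<longleftrightarrow>
     (\<forall>X \<in> Ob C. FOb F X \<in> Ob D \<and> FMap F X X (Idn C X) = Idn D (FOb F X)) \<and>
     (\<forall>X \<in> Ob C. \<forall>Y \<in> Ob C. \<forall>f \<in> Hom C X Y. FMap F X Y f \<in> Hom D (FOb F X) (FOb F Y)) \<and>
     (\<forall>X \<in> Ob C. \<forall>Y \<in> Ob C. \<forall>Z \<in> Ob C. \<forall>f \<in> Hom C X Y. \<forall>g \<in> Hom C Y Z.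
        FMap F X Z (Cmp C X Y Z g f) =
        Cmp D (FOb F X) (FOb F Y) (FOb F Z) (FMap F Y Z g) (FMap F X Y f))"

definition is_nat_trans :: "('o, 'm) cat \<Rightarrow> ('p, 'n) cat \<Rightarrow> ('o, 'm, 'p, 'n) func \<Rightarrow>
    ('o, 'm, 'p, 'n) func \<Rightarrow> ('o \<Rightarrow> 'n) \<Rightarrow> bool" where
  "is_nat_trans C D F G t \<longleftrightarrow>
     (\<forall>X \<in> Ob C. t X \<in> Hom D (FOb F X) (FOb G X)) \<and>
     (\<forall>X \<in> Ob C. \<forall>Y \<in> Ob C. \<forall>f \<in> Hom C X Y.
        Cmp D (FOb F X) (FOb F Y) (FOb G Y) (t Y) (FMap F X Y f) =
        Cmp D (FOb F X) (FOb G X) (FOb G Y) (FMap G X Y f) (t X))"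

definition id_func :: "('o, 'm, 'o, 'm) func" where
  "id_func = \<lparr>FOb = (\<lambda>X. X), FMap = (\<lambda>X Y f. f)\<rparr>"

definition comp_func ::
  "('p, 'n, 'q, 'l) func \<Rightarrow> ('o, 'm, 'p, 'n) func \<Rightarrow> ('o, 'm, 'q, 'l) func" where
  "comp_func G F = \<lparr>FOb = (\<lambda>X. FOb G (FOb F X)),
     FMap = (\<lambda>X Y f. FMap G (FOb F X) (FOb F Y) (FMap F X Y f))\<rparr>"


section \<open>The localization of a category at a class of arrows\<close>

text \<open>A morphism of the homotopy category is represented by a zigzag; \<^term>\<open>Bwd X Y w\<close> is a weak
  equivalence from \<^term>\<open>X\<close> to \<^term>\<open>Y\<close> traversed from \<^term>\<open>Y\<close> to \<^term>\<open>X\<close>.  Zigzags are composed by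
  appending, in diagrammatic order, and equality of morphisms is the relation \<open>ho_eq\<close>.\<close>

datatype ('o, 'm) step = Fwd 'o 'o 'm | Bwd 'o 'o 'm

inductive zigzag ::
  "('o, 'm) cat \<Rightarrow> ('o, 'm) arr set \<Rightarrow> 'o \<Rightarrow> 'o \<Rightarrow> ('o, 'm) step list \<Rightarrow> bool"
  for C :: "('o, 'm) cat" and W :: "('o, 'm) arr set" where
  zz_nil: "X \<in> Ob C \<Longrightarrow> zigzag C W X X []"
| zz_fwd: "(X, Y, f) \<in> Arr C \<Longrightarrow> zigzag C W Y Z p \<Longrightarrow> zigzag C W X Z (Fwd X Y f # p)"
| zz_bwd: "(Y, X, w) \<in> W \<inter> Arr C \<Longrightarrow> zigzag C W Y Z p \<Longrightarrow> zigzag C W X Z (Bwd Y X w # p)"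

inductive ho_eq ::
  "('o, 'm) cat \<Rightarrow> ('o, 'm) arr set \<Rightarrow> 'o \<Rightarrow> 'o \<Rightarrow> ('o, 'm) step list \<Rightarrow> ('o, 'm) step list \<Rightarrow> bool"
  for C :: "('o, 'm) cat" and W :: "('o, 'm) arr set" where
  ho_refl: "zigzag C W X Y p \<Longrightarrow> ho_eq C W X Y p p"
| ho_sym: "ho_eq C W X Y p q \<Longrightarrow> ho_eq C W X Y q p"
| ho_trans: "ho_eq C W X Y p q \<Longrightarrow> ho_eq C W X Y q r \<Longrightarrow> ho_eq C W X Y p r"
| ho_ctxt: "zigzag C W X' X a \<Longrightarrow> ho_eq C W X Y p q \<Longrightarrow> zigzag C W Y Y' b \<Longrightarrow>
    ho_eq C W X' Y' (a @ p @ b) (a @ q @ b)"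
| ho_id: "X \<in> Ob C \<Longrightarrow> ho_eq C W X X [Fwd X X (Idn C X)] []"
| ho_comp: "(X, Y, f) \<in> Arr C \<Longrightarrow> (Y, Z, g) \<in> Arr C \<Longrightarrow>
    ho_eq C W X Z [Fwd X Y f, Fwd Y Z g] [Fwd X Z (Cmp C X Y Z g f)]"
| ho_inv1: "(X, Y, w) \<in> W \<inter> Arr C \<Longrightarrow> ho_eq C W X X [Fwd X Y w, Bwd X Y w] []"
| ho_inv2: "(X, Y, w) \<in> W \<inter> Arr C \<Longrightarrow> ho_eq C W Y Y [Bwd X Y w, Fwd X Y w] []"

definition ho_iso ::
  "('o, 'm) cat \<Rightarrow> ('o, 'm) arr set \<Rightarrow> 'o \<Rightarrow> 'o \<Rightarrow> ('o, 'm) step list \<Rightarrow> bool" where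
  "ho_iso C W X Y p \<longleftrightarrow> zigzag C W X Y p \<and>
     (\<exists>p'. zigzag C W Y X p' \<and> ho_eq C W X X (p @ p') [] \<and> ho_eq C W Y Y (p' @ p) [])"

definition weakly_equivalent ::
  "('o, 'm) cat \<Rightarrow> ('o, 'm) arr set \<Rightarrow> 'o \<Rightarrow> 'o \<Rightarrow> bool" where
  "weakly_equivalent C W = equivclp (\<lambda>X Y. \<exists>w. (X, Y, w) \<in> W \<inter> Arr C)"


section \<open>Model structures\<close>

record ('o, 'm) model =
  Cof :: "('o, 'm) arr set"
  Fib :: "('o, 'm) arr set"
  Weq :: "('o, 'm) arr set"

definition cofibrant :: "('o, 'm) cat \<Rightarrow> ('o, 'm) model \<Rightarrow> 'o \<Rightarrow> bool" where
  "cofibrant C M X \<longleftrightarrow> X \<in> Ob C \<and> (\<exists>I. initial_ob C I \<and> (\<forall>f \<in> Hom C I X. (I, X, f) \<in> Cof M))"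

definition fibrant :: "('o, 'm) cat \<Rightarrow> ('o, 'm) model \<Rightarrow> 'o \<Rightarrow> bool" where
  "fibrant C M X \<longleftrightarrow> X \<in> Ob C \<and> (\<exists>T. terminal_ob C T \<and> (\<forall>f \<in> Hom C X T. (X, T, f) \<in> Fib M))"

definition retract_closed :: "('o, 'm) cat \<Rightarrow> ('o, 'm) arr set \<Rightarrow> bool" where
  "retract_closed C S \<longleftrightarrow>
     (\<forall>A B f X Y g. \<forall>a \<in> Hom C A X. \<forall>a' \<in> Hom C X A. \<forall>b \<in> Hom C B Y. \<forall>b' \<in> Hom C Y B.
        (A, B, f) \<in> Arr C \<and> (X, Y, g) \<in> S \<and>
        Cmp C A X A a' a = Idn C A \<and> Cmp C B Y B b' b = Idn C B \<and>
        Cmp C A X Y g a = Cmp C A B Y b f \<and> Cmp C X A B f a' = Cmp C X Y B b' g \<longrightarrow>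
        (A, B, f) \<in> S)"

definition two_of_three :: "('o, 'm) cat \<Rightarrow> ('o, 'm) arr set \<Rightarrow> bool" where
  "two_of_three C S \<longleftrightarrow>
     (\<forall>X Y Z f g. (X, Y, f) \<in> Arr C \<and> (Y, Z, g) \<in> Arr C \<longrightarrow>
        (let a = (X, Y, f) \<in> S; b = (Y, Z, g) \<in> S; c = (X, Z, Cmp C X Y Z g f) \<in> S in
         (a \<and> b \<longrightarrow> c) \<and> (a \<and> c \<longrightarrow> b) \<and> (b \<and> c \<longrightarrow> a)))"

definition factorizes ::
  "('o, 'm) cat \<Rightarrow> ('o, 'm) arr set \<Rightarrow> ('o, 'm) arr set \<Rightarrow> bool" where
  "factorizes C S T \<longleftrightarrow>
     (\<forall>(X, Y, f) \<in> Arr C. \<exists>Z i p. (X, Z, i) \<in> S \<and> (Z, Y, p) \<in> T \<and> Cmp C X Z Y p i = f)"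

definition model_structure :: "('o, 'm) cat \<Rightarrow> ('o, 'm) model \<Rightarrow> bool" where
  "model_structure C M \<longleftrightarrow>
     Cof M \<subseteq> Arr C \<and> Fib M \<subseteq> Arr C \<and> Weq M \<subseteq> Arr C \<and>
     two_of_three C (Weq M) \<and>
     retract_closed C (Cof M) \<and> retract_closed C (Fib M) \<and> retract_closed C (Weq M) \<and>
     (\<forall>i \<in> Cof M. \<forall>p \<in> Fib M \<inter> Weq M. has_lift C i p) \<and>
     (\<forall>i \<in> Cof M \<inter> Weq M. \<forall>p \<in> Fib M. has_lift C i p) \<and>
     factorizes C (Cof M) (Fib M \<inter> Weq M) \<and>
     factorizes C (Cof M \<inter> Weq M) (Fib M)"


subsection \<open>Cofibrant generation\<close>

text \<open>Ordinals are represented by well-orders on subsets of the type of objects.  A diagram indexed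
  by \<^term>\<open>r\<close> is given by objects \<^term>\<open>X i\<close> and maps \<^term>\<open>t i j\<close> for \<^term>\<open>(i, j) \<in> r\<close>.\<close>

definition cocone ::
  "('o, 'm) cat \<Rightarrow> 'i rel \<Rightarrow> ('i \<Rightarrow> 'o) \<Rightarrow> ('i \<Rightarrow> 'i \<Rightarrow> 'm) \<Rightarrow> 'i set \<Rightarrow> 'o \<Rightarrow> ('i \<Rightarrow> 'm) \<Rightarrow> bool" where
  "cocone C r X t S Z c \<longleftrightarrow> Z \<in> Ob C \<and> (\<forall>i \<in> S. c i \<in> Hom C (X i) Z) \<and>
     (\<forall>i \<in> S. \<forall>j \<in> S. (i, j) \<in> r \<longrightarrow> Cmp C (X i) (X j) Z (c j) (t i j) = c i)"

definition colimit_cocone ::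
  "('o, 'm) cat \<Rightarrow> 'i rel \<Rightarrow> ('i \<Rightarrow> 'o) \<Rightarrow> ('i \<Rightarrow> 'i \<Rightarrow> 'm) \<Rightarrow> 'i set \<Rightarrow> 'o \<Rightarrow> ('i \<Rightarrow> 'm) \<Rightarrow> bool" where
  "colimit_cocone C r X t S Z c \<longleftrightarrow> cocone C r X t S Z c \<and>
     (\<forall>Z' c'. cocone C r X t S Z' c' \<longrightarrow>
        (\<exists>!h. h \<in> Hom C Z Z' \<and> (\<forall>i \<in> S. Cmp C (X i) Z Z' h (c i) = c' i)))"

definition least_in :: "'i rel \<Rightarrow> 'i \<Rightarrow> bool" where
  "least_in r i \<longleftrightarrow> i \<in> Field r \<and> underS r i = {}"

definition succ_in :: "'i rel \<Rightarrow> 'i \<Rightarrow> 'i \<Rightarrow> bool" where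
  "succ_in r i j \<longleftrightarrow> i \<in> underS r j \<and> underS r j = under r i"

definition limit_in :: "'i rel \<Rightarrow> 'i \<Rightarrow> bool" where
  "limit_in r j \<longleftrightarrow> j \<in> Field r \<and> \<not> least_in r j \<and> \<not> (\<exists>i. succ_in r i j)"

definition transfinite_sequence :: "('o, 'm) cat \<Rightarrow> ('o, 'm) arr set \<Rightarrow>
    'i rel \<Rightarrow> ('i \<Rightarrow> 'o) \<Rightarrow> ('i \<Rightarrow> 'i \<Rightarrow> 'm) \<Rightarrow> bool" where
  "transfinite_sequence C D r X t \<longleftrightarrow> Well_order r \<and> Field r \<noteq> {} \<and>
     (\<forall>i \<in> Field r. X i \<in> Ob C \<and> t i i = Idn C (X i)) \<and>
     (\<forall>i j. (i, j) \<in> r \<longrightarrow> t i j \<in> Hom C (X i) (X j)) \<and>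
     (\<forall>i j k. (i, j) \<in> r \<and> (j, k) \<in> r \<longrightarrow> t i k = Cmp C (X i) (X j) (X k) (t j k) (t i j)) \<and>
     (\<forall>i j. succ_in r i j \<longrightarrow> (X i, X j, t i j) \<in> D) \<and>
     (\<forall>j. limit_in r j \<longrightarrow> colimit_cocone C r X t (underS r j) (X j) (\<lambda>i. t i j))"

definition transfinite_composites ::
  "('o, 'm) cat \<Rightarrow> ('o, 'm) arr set \<Rightarrow> ('o, 'm) arr set" where
  "transfinite_composites C D = {(X i, Z, c i) | (r :: 'o rel) X t Z c i.
     transfinite_sequence C D r X t \<and> colimit_cocone C r X t (Field r) Z c \<and> least_in r i}"

definition pushout_square ::
  "('o, 'm) cat \<Rightarrow> ('o, 'm) arr \<Rightarrow> ('o, 'm) arr \<Rightarrow> 'm \<Rightarrow> 'm \<Rightarrow> bool" where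
  "pushout_square C i j u v \<longleftrightarrow> (case (i, j) of ((A, B, i), (X, Y, j)) \<Rightarrow>
     u \<in> Hom C A X \<and> v \<in> Hom C B Y \<and> Cmp C A X Y j u = Cmp C A B Y v i \<and>
     (\<forall>Z \<in> Ob C. \<forall>x \<in> Hom C X Z. \<forall>b \<in> Hom C B Z. Cmp C A X Z x u = Cmp C A B Z b i \<longrightarrow>
        (\<exists>!h. h \<in> Hom C Y Z \<and> Cmp C X Y Z h j = x \<and> Cmp C B Y Z h v = b)))"

definition pushouts :: "('o, 'm) cat \<Rightarrow> ('o, 'm) arr set \<Rightarrow> ('o, 'm) arr set" where
  "pushouts C S = {j \<in> Arr C. \<exists>i \<in> S. \<exists>u v. pushout_square C i j u v}"

definition cell :: "('o, 'm) cat \<Rightarrow> ('o, 'm) arr set \<Rightarrow> ('o, 'm) arr set" where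
  "cell C S = transfinite_composites C (pushouts C S)"

text \<open>The well-order \<^term>\<open>r\<close> is \<open>\<kappa>\<close>-filtered, where \<open>\<kappa>\<close> is the cardinality of \<^term>\<open>K\<close>.\<close>

definition filtered_for :: "'j set \<Rightarrow> 'i rel \<Rightarrow> bool" where
  "filtered_for K r \<longleftrightarrow> (\<forall>A h. A \<subseteq> Field r \<and> inj_on h A \<and> h ` A \<subseteq> K \<longrightarrow>
     (\<exists>b \<in> Field r. A \<subseteq> underS r b))"

text \<open>\<^term>\<open>A\<close> is small relative to \<^term>\<open>D\<close>: the functor of maps out of \<^term>\<open>A\<close> commutes with colimits
  of sufficiently filtered transfinite sequences in \<^term>\<open>D\<close>.\<close>

definition small_relative :: "('o, 'm) cat \<Rightarrow> ('o, 'm) arr set \<Rightarrow> 'o \<Rightarrow> bool" where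
  "small_relative C D A \<longleftrightarrow> (\<exists>K :: 'o set. K \<noteq> {} \<and>
     (\<forall>(r :: 'o rel) X t Z c. transfinite_sequence C D r X t \<and> filtered_for K r \<and>
        colimit_cocone C r X t (Field r) Z c \<longrightarrow>
        (\<forall>g \<in> Hom C A Z. \<exists>i \<in> Field r. \<exists>h \<in> Hom C A (X i). Cmp C A (X i) Z (c i) h = g) \<and>
        (\<forall>i \<in> Field r. \<forall>h \<in> Hom C A (X i). \<forall>h' \<in> Hom C A (X i).
           Cmp C A (X i) Z (c i) h = Cmp C A (X i) Z (c i) h' \<longrightarrow>
           (\<exists>j. (i, j) \<in> r \<and>
              Cmp C A (X i) (X j) (t i j) h = Cmp C A (X i) (X j) (t i j) h'))))"

definition cofibrantly_generated :: "('o, 'm) cat \<Rightarrow> ('o, 'm) model \<Rightarrow> bool" where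
  "cofibrantly_generated C M \<longleftrightarrow> (\<exists>I J. I \<subseteq> Arr C \<and> J \<subseteq> Arr C \<and>
     (\<forall>(A, B, i) \<in> I. small_relative C (cell C I) A) \<and>
     (\<forall>(A, B, j) \<in> J. small_relative C (cell C J) A) \<and>
     Fib M = rlp C J \<and> Fib M \<inter> Weq M = rlp C I)"

subsection \<open>Functorial replacements\<close>

definition cofibrant_replacement :: "('o, 'm) cat \<Rightarrow> ('o, 'm) model \<Rightarrow>
    ('o, 'm, 'o, 'm) func \<Rightarrow> ('o \<Rightarrow> 'm) \<Rightarrow> bool" where
  "cofibrant_replacement C M Q q \<longleftrightarrow> is_functor C C Q \<and> is_nat_trans C C Q id_func q \<and>
     (\<forall>X \<in> Ob C. cofibrant C M (FOb Q X) \<and> (FOb Q X, X, q X) \<in> Fib M \<inter> Weq M)"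

definition fibrant_replacement :: "('o, 'm) cat \<Rightarrow> ('o, 'm) model \<Rightarrow>
    ('o, 'm, 'o, 'm) func \<Rightarrow> ('o \<Rightarrow> 'm) \<Rightarrow> bool" where
  "fibrant_replacement C M R r \<longleftrightarrow> is_functor C C R \<and> is_nat_trans C C id_func R r \<and>
     (\<forall>X \<in> Ob C. fibrant C M (FOb R X) \<and> (X, FOb R X, r X) \<in> Cof M \<inter> Weq M)"


section \<open>Weak equivalences of simplicial sets\<close>

text \<open>\<^term>\<open>Op X m n \<theta>\<close> is the map from \<open>n\<close>-simplices to \<open>m\<close>-simplices induced by a monotone map
  \<^term>\<open>\<theta>\<close> from \<open>{0..m}\<close> to \<open>{0..n}\<close>.\<close>

record 'x sset =
  Simp :: "nat \<Rightarrow> 'x set"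
  Op :: "nat \<Rightarrow> nat \<Rightarrow> (nat \<Rightarrow> nat) \<Rightarrow> 'x \<Rightarrow> 'x"

definition face :: "'x sset \<Rightarrow> nat \<Rightarrow> nat \<Rightarrow> 'x \<Rightarrow> 'x" where
  "face X n i = Op X (n - 1) n (\<lambda>j. if j < i then j else Suc j)"

definition const_simplex :: "'x sset \<Rightarrow> nat \<Rightarrow> 'x \<Rightarrow> 'x" where
  "const_simplex X n v = Op X n 0 (\<lambda>_. 0) v"

text \<open>Simplicial homotopy groups (sets, for \<open>n = 0\<close>) of a Kan complex \<^term>\<open>X\<close> at a vertex \<^term>\<open>v\<close>.  For
  \<open>n = 0\<close> the vertex plays no role.\<close>

definition spheres :: "'x sset \<Rightarrow> nat \<Rightarrow> 'x \<Rightarrow> 'x set" where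
  "spheres X n v = {x \<in> Simp X n. n > 0 \<longrightarrow> (\<forall>i \<le> n. face X n i x = const_simplex X (n - 1) v)}"

definition sphere_homotopy :: "'x sset \<Rightarrow> nat \<Rightarrow> 'x \<Rightarrow> 'x rel" where
  "sphere_homotopy X n v = {(x, x'). x \<in> spheres X n v \<and> x' \<in> spheres X n v \<and>
     (\<exists>y \<in> Simp X (Suc n). (\<forall>i < n. face X (Suc n) i y = const_simplex X n v) \<and>
        face X (Suc n) n y = x \<and> face X (Suc n) (Suc n) y = x')}"

definition homotopy_set :: "'x sset \<Rightarrow> nat \<Rightarrow> 'x \<Rightarrow> 'x set set" where
  "homotopy_set X n v = spheres X n v // sphere_homotopy X n v"

text \<open>Weak equivalences between Kan complexes.  This is only applied to mapping spaces below, which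
  underlie simplicial abelian groups and are therefore Kan complexes.\<close>

definition kan_weak_equivalence ::
  "'x sset \<Rightarrow> 'y sset \<Rightarrow> (nat \<Rightarrow> 'x \<Rightarrow> 'y) \<Rightarrow> bool" where
  "kan_weak_equivalence X Y f \<longleftrightarrow>
     (\<forall>v \<in> Simp X 0. \<forall>n > 0.
        bij_betw (\<lambda>c. sphere_homotopy Y n (f 0 v) `` (f n ` c))
          (homotopy_set X n v) (homotopy_set Y n (f 0 v))) \<and>
     bij_betw (\<lambda>c. sphere_homotopy Y 0 undefined `` (f 0 ` c))
       (homotopy_set X 0 undefined) (homotopy_set Y 0 undefined)"


section \<open>Chain complexes\<close>

record ('k, 'a) cx =
  Md :: "int \<Rightarrow> ('k, 'a) module"
  Df :: "int \<Rightarrow> 'a \<Rightarrow> 'a"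

definition linmaps ::
  "'k ring \<Rightarrow> ('k, 'a) module \<Rightarrow> ('k, 'b) module \<Rightarrow> ('a \<Rightarrow> 'b) set" where
  "linmaps K M N = {f \<in> carrier M \<rightarrow>\<^sub>E carrier N.
     (\<forall>x \<in> carrier M. \<forall>y \<in> carrier M. f (x \<oplus>\<^bsub>M\<^esub> y) = f x \<oplus>\<^bsub>N\<^esub> f y) \<and>
     (\<forall>a \<in> carrier K. \<forall>x \<in> carrier M. f (a \<odot>\<^bsub>M\<^esub> x) = a \<odot>\<^bsub>N\<^esub> f x)}"

definition chain_complex :: "'k ring \<Rightarrow> ('k, 'a) cx \<Rightarrow> bool" where
  "chain_complex K X \<longleftrightarrow>
     (\<forall>n. module K (Md X n) \<and> Df X n \<in> linmaps K (Md X n) (Md X (n - 1)) \<and>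
        (\<forall>x \<in> carrier (Md X n). Df X (n - 1) (Df X n x) = \<zero>\<^bsub>Md X (n - 2)\<^esub>))"

definition chain_maps ::
  "'k ring \<Rightarrow> ('k, 'a) cx \<Rightarrow> ('k, 'b) cx \<Rightarrow> (int \<Rightarrow> 'a \<Rightarrow> 'b) set" where
  "chain_maps K X Y = {f. \<forall>n. f n \<in> linmaps K (Md X n) (Md Y n) \<and>
     (\<forall>x \<in> carrier (Md X n). f (n - 1) (Df X n x) = Df Y n (f n x))}"

datatype grading = NonNeg | Unbounded

text \<open>The modules of a complex are carried by arbitrary subsets of one type \<^typ>\<open>'a\<close>, which serves as
  the universe of the category.  \<^term>\<open>Ch K NonNeg\<close> is the full subcategory of complexes vanishing in negative degrees.\<close>

definition Ch :: "'k ring \<Rightarrow> grading \<Rightarrow> (('k, 'a) cx, int \<Rightarrow> 'a \<Rightarrow> 'a) cat" where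
  "Ch K g = \<lparr>
     Ob = {X. chain_complex K X \<and> (g = NonNeg \<longrightarrow> (\<forall>n < 0. carrier (Md X n) = {\<zero>\<^bsub>Md X n\<^esub>}))},
     Hom = chain_maps K,
     Idn = (\<lambda>X n. \<lambda>x \<in> carrier (Md X n). x),
     Cmp = (\<lambda>X Y Z g f n. \<lambda>x \<in> carrier (Md X n). g n (f n x))\<rparr>"

definition cycles :: "('k, 'a) cx \<Rightarrow> int \<Rightarrow> 'a set" where
  "cycles X n = {x \<in> carrier (Md X n). Df X n x = \<zero>\<^bsub>Md X (n - 1)\<^esub>}"

definition boundaries :: "('k, 'a) cx \<Rightarrow> int \<Rightarrow> 'a set" where
  "boundaries X n = Df X (n + 1) ` carrier (Md X (n + 1))"

definition homology :: "('k, 'a) cx \<Rightarrow> int \<Rightarrow> 'a set monoid" where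
  "homology X n = (add_monoid (Md X n))\<lparr>carrier := cycles X n\<rparr> Mod boundaries X n"

definition homology_map ::
  "('k, 'b) cx \<Rightarrow> (int \<Rightarrow> 'a \<Rightarrow> 'b) \<Rightarrow> int \<Rightarrow> 'a set \<Rightarrow> 'b set" where
  "homology_map Y f n c = boundaries Y n <#>\<^bsub>add_monoid (Md Y n)\<^esub> (f n ` c)"

definition quasi_isos ::
  "'k ring \<Rightarrow> grading \<Rightarrow> (('k, 'a) cx, int \<Rightarrow> 'a \<Rightarrow> 'a) arr set" where
  "quasi_isos K g = {(X, Y, f) \<in> Arr (Ch K g).
     \<forall>n. homology_map Y f n \<in> iso (homology X n) (homology Y n)}"

definition ch_fibrations ::
  "'k ring \<Rightarrow> grading \<Rightarrow> (('k, 'a) cx, int \<Rightarrow> 'a \<Rightarrow> 'a) arr set" where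
  "ch_fibrations K g = {(X, Y, f) \<in> Arr (Ch K g).
     \<forall>n. (g = NonNeg \<longrightarrow> n > 0) \<longrightarrow> f n ` carrier (Md X n) = carrier (Md Y n)}"

definition Ch_model ::
  "'k ring \<Rightarrow> grading \<Rightarrow> (('k, 'a) cx, int \<Rightarrow> 'a \<Rightarrow> 'a) model" where
  "Ch_model K g = \<lparr>
     Cof = llp (Ch K g) (ch_fibrations K g \<inter> quasi_isos K g),
     Fib = ch_fibrations K g,
     Weq = quasi_isos K g\<rparr>"

text \<open>\<open>(\<Sigma>X)\<^sub>n = X\<^sub>n\<^sub>-\<^sub>1\<close> with differential \<open>-d\<close>.\<close>

definition suspension :: "(('k, 'a) cx, int \<Rightarrow> 'a \<Rightarrow> 'a, ('k, 'a) cx, int \<Rightarrow> 'a \<Rightarrow> 'a) func" where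
  "suspension = \<lparr>
     FOb = (\<lambda>X. \<lparr>Md = (\<lambda>n. Md X (n - 1)),
       Df = (\<lambda>n. \<lambda>x \<in> carrier (Md X (n - 1)). \<ominus>\<^bsub>Md X (n - 2)\<^esub> Df X (n - 1) x)\<rparr>),
     FMap = (\<lambda>X Y f n. f (n - 1))\<rparr>"

text \<open>\<open>(-1)\<^sup>e x\<close>\<close>

definition signed :: "('k, 'a) module \<Rightarrow> int \<Rightarrow> 'a \<Rightarrow> 'a" where
  "signed M e x = (if even e then x else \<ominus>\<^bsub>M\<^esub> x)"


subsection \<open>Homotopy mapping spaces\<close>

text \<open>Every complex over a field is cofibrant and fibrant, and the complexes \<open>X \<otimes> N\<^sub>*(\<Delta>\<^sup>p)\<close> form a
  cosimplicial frame on \<open>X\<close>, where \<open>N\<^sub>*(\<Delta>\<^sup>p)\<close> denotes normalized chains with basis the elements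
  \<open>e\<^sub>S\<close> of degree \<open>card S - 1\<close>, for \<open>S\<close> a nonempty subset of \<open>{0..p}\<close>.  So a \<open>p\<close>-simplex of \<open>map(X,N)\<close> is
  a chain map \<open>X \<otimes> N\<^sub>*(\<Delta>\<^sup>p) \<rightarrow> N\<close>; below it is written as the family \<open>\<phi> S n x = \<phi>(x \<otimes> e\<^sub>S)\<close>, and
  \<open>d(x \<otimes> e\<^sub>S) = dx \<otimes> e\<^sub>S + (-1)\<^sup>n x \<otimes> \<partial>e\<^sub>S\<close> where
  \<open>\<partial>e\<^sub>S\<close> is the alternating sum of the \<open>e\<^bsub>S - {s}\<^esub>\<close> with \<open>S - {s}\<close> nonempty.\<close>

definition std_simplices :: "nat \<Rightarrow> nat set set" where
  "std_simplices p = {S. S \<subseteq> {..p} \<and> S \<noteq> {}}"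

definition map_simplices :: "'k ring \<Rightarrow> ('k, 'a) cx \<Rightarrow> ('k, 'b) cx \<Rightarrow> nat \<Rightarrow>
    (nat set \<Rightarrow> int \<Rightarrow> 'a \<Rightarrow> 'b) set" where
  "map_simplices K X N p = {\<phi>.
     (\<forall>S. S \<notin> std_simplices p \<longrightarrow> \<phi> S = undefined) \<and>
     (\<forall>S \<in> std_simplices p. \<forall>n.
        \<phi> S n \<in> linmaps K (Md X n) (Md N (n + int (card S) - 1)) \<and>
        (\<forall>x \<in> carrier (Md X n).
           Df N (n + int (card S) - 1) (\<phi> S n x) =
           \<phi> S (n - 1) (Df X n x) \<oplus>\<^bsub>Md N (n + int (card S) - 2)\<^esub>
           signed (Md N (n + int (card S) - 2)) n
             (finsum (Md N (n + int (card S) - 2))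
                (\<lambda>s. signed (Md N (n + int (card S) - 2)) (int (card {u \<in> S. u < s}))
                       (\<phi> (S - {s}) n x))
                {s \<in> S. S - {s} \<noteq> {}})))}"

definition map_space ::
  "'k ring \<Rightarrow> ('k, 'a) cx \<Rightarrow> ('k, 'b) cx \<Rightarrow> (nat set \<Rightarrow> int \<Rightarrow> 'a \<Rightarrow> 'b) sset" where
  "map_space K X N = \<lparr>
     Simp = map_simplices K X N,
     Op = (\<lambda>m p \<theta> \<phi> S. if S \<in> std_simplices m
       then (\<lambda>n. if inj_on \<theta> S then \<phi> (\<theta> ` S) n
                 else (\<lambda>x \<in> carrier (Md X n). \<zero>\<^bsub>Md N (n + int (card S) - 1)\<^esub>))
       else undefined)\<rparr>"

text \<open>\<open>map(g, N) : map(Y, N) \<rightarrow> map(X, N)\<close> for \<open>g : X \<rightarrow> Y\<close>\<close>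

definition map_space_precomp :: "('k, 'a) cx \<Rightarrow> (int \<Rightarrow> 'a \<Rightarrow> 'c) \<Rightarrow> nat \<Rightarrow>
    (nat set \<Rightarrow> int \<Rightarrow> 'c \<Rightarrow> 'b) \<Rightarrow> (nat set \<Rightarrow> int \<Rightarrow> 'a \<Rightarrow> 'b)" where
  "map_space_precomp X g p \<phi> S =
     (if S \<in> std_simplices p then (\<lambda>n. \<lambda>x \<in> carrier (Md X n). \<phi> S n (g n x)) else undefined)"

definition map_space_equivalence :: "'k ring \<Rightarrow> (('k, 'a) cx, int \<Rightarrow> 'a \<Rightarrow> 'a) arr \<Rightarrow> ('k, 'a) cx \<Rightarrow> bool" where
  "map_space_equivalence K h N \<longleftrightarrow> (case h of (X, Y, f) \<Rightarrow>
     kan_weak_equivalence (map_space K Y N) (map_space K X N) (map_space_precomp X f))"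


section \<open>Left Bousfield localization\<close>

definition local_objects ::
  "'k ring \<Rightarrow> grading \<Rightarrow> (('k, 'a) cx, int \<Rightarrow> 'a \<Rightarrow> 'a) arr set \<Rightarrow> ('k, 'a) cx set" where
  "local_objects K g S = {N. fibrant (Ch K g) (Ch_model K g) N \<and> (\<forall>h \<in> S. map_space_equivalence K h N)}"

definition local_equivalences :: "'k ring \<Rightarrow> grading \<Rightarrow> (('k, 'a) cx, int \<Rightarrow> 'a \<Rightarrow> 'a) arr set \<Rightarrow>
    (('k, 'a) cx, int \<Rightarrow> 'a \<Rightarrow> 'a) arr set" where
  "local_equivalences K g S = {h \<in> Arr (Ch K g). \<forall>N \<in> local_objects K g S. map_space_equivalence K h N}"

definition Loc_model :: "'k ring \<Rightarrow> grading \<Rightarrow> (('k, 'a) cx, int \<Rightarrow> 'a \<Rightarrow> 'a) arr set \<Rightarrow>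
    (('k, 'a) cx, int \<Rightarrow> 'a \<Rightarrow> 'a) model" where
  "Loc_model K g S = \<lparr>
     Cof = Cof (Ch_model K g),
     Fib = rlp (Ch K g) (Cof (Ch_model K g) \<inter> local_equivalences K g S),
     Weq = local_equivalences K g S\<rparr>"

text \<open>The last two conjuncts choose functorial replacements: \<^term>\<open>Q\<close> computes the left derived functor
  of the identity from the original to the localized model structure and \<^term>\<open>R\<close> the right derived
  functor of the identity back.\<close>

definition left_bousfield_localization :: "'k ring \<Rightarrow> grading \<Rightarrow>
    (('k, 'a) cx, int \<Rightarrow> 'a \<Rightarrow> 'a) arr set \<Rightarrow>
    (('k, 'a) cx, int \<Rightarrow> 'a \<Rightarrow> 'a, ('k, 'a) cx, int \<Rightarrow> 'a \<Rightarrow> 'a) func \<Rightarrow>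
    (('k, 'a) cx \<Rightarrow> int \<Rightarrow> 'a \<Rightarrow> 'a) \<Rightarrow>
    (('k, 'a) cx, int \<Rightarrow> 'a \<Rightarrow> 'a, ('k, 'a) cx, int \<Rightarrow> 'a \<Rightarrow> 'a) func \<Rightarrow>
    (('k, 'a) cx \<Rightarrow> int \<Rightarrow> 'a \<Rightarrow> 'a) \<Rightarrow> bool" where
  "left_bousfield_localization K g S Q q R r \<longleftrightarrow>
     S \<subseteq> Cof (Ch_model K g) \<and>
     (\<forall>(X, Y, f) \<in> S. cofibrant (Ch K g) (Ch_model K g) X \<and>
        cofibrant (Ch K g) (Ch_model K g) Y) \<and>
     model_structure (Ch K g) (Loc_model K g S) \<and>
     cofibrantly_generated (Ch K g) (Loc_model K g S) \<and>
     cofibrant_replacement (Ch K g) (Ch_model K g) Q q \<and>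
     fibrant_replacement (Ch K g) (Loc_model K g S) R r"

text \<open>\<^term>\<open>comp_func R Q\<close> induces \<open>L\<^sub>C\<close> on the homotopy category.  It commutes with suspension if the two
  composites are naturally isomorphic there; naturality is required for morphisms coming from chain
  maps, which together with inverses of weak equivalences generate the homotopy category.\<close>

definition stable_localization :: "'k ring \<Rightarrow>
    (('k, 'a) cx, int \<Rightarrow> 'a \<Rightarrow> 'a, ('k, 'a) cx, int \<Rightarrow> 'a \<Rightarrow> 'a) func \<Rightarrow>
    (('k, 'a) cx, int \<Rightarrow> 'a \<Rightarrow> 'a, ('k, 'a) cx, int \<Rightarrow> 'a \<Rightarrow> 'a) func \<Rightarrow> bool" where
  "stable_localization K Q R \<longleftrightarrow>
     (let M = Ch K Unbounded; W = quasi_isos K Unbounded; L = comp_func R Q;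
          F = comp_func L suspension; G = comp_func suspension L in
      \<exists>\<theta>. (\<forall>X \<in> Ob M. ho_iso M W (FOb F X) (FOb G X) (\<theta> X)) \<and>
          (\<forall>X \<in> Ob M. \<forall>Y \<in> Ob M. \<forall>f \<in> Hom M X Y.
             ho_eq M W (FOb F X) (FOb G Y)
               (Fwd (FOb F X) (FOb F Y) (FMap F X Y f) # \<theta> Y)
               (\<theta> X @ [Fwd (FOb G X) (FOb G Y) (FMap G X Y f)])))"


section \<open>Colored operads and their algebras\<close>

subsection \<open>Chain maps out of tensor products\<close>

text \<open>Homogeneous elements are pairs (degree, element).  A chain map \<open>X\<^sub>1 \<otimes> \<dots> \<otimes> X\<^sub>m \<rightarrow> Y\<close> is given by a
  multilinear map \<^term>\<open>f\<close> on lists of homogeneous elements that adds degrees and satisfies the graded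
  Leibniz rule.  The empty tensor product is the unit complex \<open>k\<close>.\<close>

definition helems :: "('k, 'a) cx \<Rightarrow> (int \<times> 'a) set" where
  "helems X = {(n, x). x \<in> carrier (Md X n)}"

definition tensors :: "('k, 'a) cx list \<Rightarrow> (int \<times> 'a) list set" where
  "tensors Xs = {us. list_all2 (\<lambda>u X. u \<in> helems X) us Xs}"

definition deg :: "(int \<times> 'a) list \<Rightarrow> int" where
  "deg us = sum_list (map fst us)"

definition multi_chain_map ::
  "'k ring \<Rightarrow> ('k, 'a) cx list \<Rightarrow> ('k, 'a) cx \<Rightarrow> ((int \<times> 'a) list \<Rightarrow> 'a) \<Rightarrow> bool" where
  "multi_chain_map K Xs Y f \<longleftrightarrow> (\<forall>us \<in> tensors Xs.
     f us \<in> carrier (Md Y (deg us)) \<and>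
     (\<forall>i < length us. \<forall>y \<in> carrier (Md (Xs ! i) (fst (us ! i))).
        f (us[i := (fst (us ! i), snd (us ! i) \<oplus>\<^bsub>Md (Xs ! i) (fst (us ! i))\<^esub> y)]) =
        f us \<oplus>\<^bsub>Md Y (deg us)\<^esub> f (us[i := (fst (us ! i), y)])) \<and>
     (\<forall>i < length us. \<forall>a \<in> carrier K.
        f (us[i := (fst (us ! i), a \<odot>\<^bsub>Md (Xs ! i) (fst (us ! i))\<^esub> snd (us ! i))]) =
        a \<odot>\<^bsub>Md Y (deg us)\<^esub> f us) \<and>
     Df Y (deg us) (f us) =
       finsum (Md Y (deg us - 1))
         (\<lambda>i. signed (Md Y (deg us - 1)) (deg (take i us))
            (f (us[i := (fst (us ! i) - 1, Df (Xs ! i) (fst (us ! i)) (snd (us ! i)))])))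
         {..<length us})"

definition hval :: "((int \<times> 'a) list \<Rightarrow> 'a) \<Rightarrow> (int \<times> 'a) list \<Rightarrow> int \<times> 'a" where
  "hval f us = (deg us, f us)"

subsection \<open>Koszul signs and block permutations\<close>

text \<open>Exponent of the sign of \<open>u\<^sub>0 \<otimes> \<dots> \<otimes> u\<^sub>m \<mapsto> u\<^bsub>\<sigma> 0\<^esub> \<otimes> \<dots> \<otimes> u\<^bsub>\<sigma> m\<^esub>\<close>\<close>

definition perm_sign :: "(nat \<Rightarrow> nat) \<Rightarrow> (int \<times> 'a) list \<Rightarrow> int" where
  "perm_sign \<sigma> us =
     (\<Sum>(i, j) \<in> {(i, j). i < j \<and> j < length us \<and> \<sigma> j < \<sigma> i}. fst (us ! \<sigma> i) * fst (us ! \<sigma> j))"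

text \<open>Exponent of the sign of \<open>u\<^sub>0 \<otimes> \<dots> \<otimes> u\<^sub>m \<otimes> w\<^sub>0 \<otimes> \<dots> \<otimes> w\<^sub>m \<mapsto> u\<^sub>0 \<otimes> w\<^sub>0 \<otimes> \<dots> \<otimes> u\<^sub>m \<otimes> w\<^sub>m\<close>, where each
  \<open>w\<^sub>i\<close> is itself a list of factors\<close>

definition shuffle_sign :: "(int \<times> 'a) list \<Rightarrow> (int \<times> 'a) list list \<Rightarrow> int" where
  "shuffle_sign us ws =
     (\<Sum>(i, j) \<in> {(i, j). i < j \<and> j < length us}. deg (ws ! i) * fst (us ! j))"

text \<open>The positions in a concatenation of blocks of lengths \<^term>\<open>ks\<close>, block by block\<close>

definition block_positions :: "nat list \<Rightarrow> nat list list" where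
  "block_positions ks = map (\<lambda>i. [sum_list (take i ks)..<sum_list (take (Suc i) ks)]) [0..<length ks]"

definition perm_of_list :: "nat list \<Rightarrow> nat \<Rightarrow> nat" where
  "perm_of_list ts t = (if t < length ts then ts ! t else t)"

text \<open>The block permutation permuting blocks of lengths \<^term>\<open>ks\<close> by \<^term>\<open>\<sigma>\<close>, and the direct sum of
  permutations \<^term>\<open>\<tau> i\<close> of the blocks.  For lists \<^term>\<open>xss\<close> with \<^term>\<open>map length xss = ks\<close>,
  \<^term>\<open>permute_list (block_perm \<sigma> ks) (concat xss)\<close> is \<^term>\<open>concat (permute_list \<sigma> xss)\<close>.\<close>

definition block_perm :: "(nat \<Rightarrow> nat) \<Rightarrow> nat list \<Rightarrow> nat \<Rightarrow> nat" where
  "block_perm \<sigma> ks = perm_of_list (concat (permute_list \<sigma> (block_positions ks)))"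

definition sum_perm :: "(nat \<Rightarrow> nat \<Rightarrow> nat) \<Rightarrow> nat list \<Rightarrow> nat \<Rightarrow> nat" where
  "sum_perm \<tau> ks = perm_of_list
     (concat (map (\<lambda>i. permute_list (\<tau> i) (block_positions ks ! i)) [0..<length ks]))"

subsection \<open>Operads\<close>

text \<open>The type \<^typ>\<open>'c\<close> is the (nonempty) set of colors.  \<^term>\<open>PO P d cs\<close> is the complex of operations
  with inputs \<^term>\<open>cs\<close> and output \<^term>\<open>d\<close>; \<^term>\<open>PUnit P c\<close> is the image of \<open>1 \<in> k\<close> under the unit;
  \<^term>\<open>PComp P d cs bss\<close> is applied to a list \<open>p # qs\<close> with \<open>qs ! i\<close> of profile \<open>bss ! i\<close>, and
  \<^term>\<open>PAct P d cs \<sigma>\<close> is the right action of \<^term>\<open>\<sigma>\<close>, from profile \<^term>\<open>cs\<close> to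
  \<^term>\<open>permute_list \<sigma> cs\<close>.\<close>

record ('c, 'k, 'a) operad =
  PO :: "'c \<Rightarrow> 'c list \<Rightarrow> ('k, 'a) cx"
  PUnit :: "'c \<Rightarrow> 'a"
  PComp :: "'c \<Rightarrow> 'c list \<Rightarrow> 'c list list \<Rightarrow> (int \<times> 'a) list \<Rightarrow> 'a"
  PAct :: "'c \<Rightarrow> 'c list \<Rightarrow> (nat \<Rightarrow> nat) \<Rightarrow> int \<Rightarrow> 'a \<Rightarrow> 'a"

definition perms :: "'b list \<Rightarrow> (nat \<Rightarrow> nat) set" where
  "perms xs = {\<sigma>. \<sigma> permutes {..<length xs}}"

abbreviation hact :: "('c, 'k, 'a) operad \<Rightarrow> 'c \<Rightarrow> 'c list \<Rightarrow> (nat \<Rightarrow> nat) \<Rightarrow> int \<times> 'a \<Rightarrow> int \<times> 'a" where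
  "hact P d cs \<sigma> u \<equiv> (fst u, PAct P d cs \<sigma> (fst u) (snd u))"

definition operad_typed :: "'k ring \<Rightarrow> grading \<Rightarrow> ('c, 'k, 'a) operad \<Rightarrow> bool" where
  "operad_typed K g P \<longleftrightarrow>
     (\<forall>d cs. PO P d cs \<in> Ob (Ch K g)) \<and>
     (\<forall>c. multi_chain_map K [] (PO P c [c]) (\<lambda>_. PUnit P c)) \<and>
     (\<forall>d cs bss. length bss = length cs \<longrightarrow>
        multi_chain_map K (PO P d cs # map2 (PO P) cs bss) (PO P d (concat bss))
          (PComp P d cs bss)) \<and>
     (\<forall>d cs. \<forall>\<sigma> \<in> perms cs.
        PAct P d cs \<sigma> \<in> Hom (Ch K g) (PO P d cs) (PO P d (permute_list \<sigma> cs)))"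

definition operad_functorial :: "'k ring \<Rightarrow> grading \<Rightarrow> ('c, 'k, 'a) operad \<Rightarrow> bool" where
  "operad_functorial K g P \<longleftrightarrow>
     (\<forall>d cs. PAct P d cs id = Idn (Ch K g) (PO P d cs)) \<and>
     (\<forall>d cs. \<forall>\<sigma> \<in> perms cs. \<forall>\<tau> \<in> perms cs.
        Cmp (Ch K g) (PO P d cs) (PO P d (permute_list \<sigma> cs)) (PO P d (permute_list (\<sigma> \<circ> \<tau>) cs))
          (PAct P d (permute_list \<sigma> cs) \<tau>) (PAct P d cs \<sigma>) =
        PAct P d cs (\<sigma> \<circ> \<tau>))"

definition operad_unital :: "('c, 'k, 'a) operad \<Rightarrow> bool" where
  "operad_unital P \<longleftrightarrow>
     (\<forall>d cs. \<forall>p \<in> helems (PO P d cs).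
        PComp P d [d] [cs] [(0, PUnit P d), p] = snd p \<and>
        PComp P d cs (map (\<lambda>c. [c]) cs) (p # map (\<lambda>c. (0, PUnit P c)) cs) = snd p)"

text \<open>In \<open>operad_assoc\<close>, \<^term>\<open>asss ! i ! j\<close> is the profile of the operation \<^term>\<open>rss ! i ! j\<close>, which is
  plugged into the \<open>j\<close>-th input of \<^term>\<open>qs ! i\<close>.\<close>

definition operad_assoc :: "('c, 'k, 'a) operad \<Rightarrow> bool" where
  "operad_assoc P \<longleftrightarrow>
     (\<forall>d cs bss asss p qs rss.
        length bss = length cs \<and> list_all2 (\<lambda>ass bs. length ass = length bs) asss bss \<and>
        p \<in> helems (PO P d cs) \<and> qs \<in> tensors (map2 (PO P) cs bss) \<and>
        list_all2 (\<lambda>rs (bs, ass). rs \<in> tensors (map2 (PO P) bs ass)) rss (zip bss asss) \<longrightarrow>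
        PComp P d (concat bss) (concat asss) (hval (PComp P d cs bss) (p # qs) # concat rss) =
        signed (Md (PO P d (concat (concat asss))) (deg (p # qs @ concat rss)))
          (shuffle_sign qs rss)
          (PComp P d cs (map concat asss)
             (p # map (\<lambda>i. hval (PComp P (cs ! i) (bss ! i) (asss ! i)) (qs ! i # rss ! i))
                    [0..<length cs])))"

definition operad_equivariant :: "('c, 'k, 'a) operad \<Rightarrow> bool" where
  "operad_equivariant P \<longleftrightarrow>
     (\<forall>d cs bss p qs. length bss = length cs \<and>
        p \<in> helems (PO P d cs) \<and> qs \<in> tensors (map2 (PO P) cs bss) \<longrightarrow>
        (\<forall>\<sigma> \<in> perms cs.
           PComp P d (permute_list \<sigma> cs) (permute_list \<sigma> bss)
             (hact P d cs \<sigma> p # permute_list \<sigma> qs) =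
           signed (Md (PO P d (concat (permute_list \<sigma> bss))) (deg (p # qs))) (perm_sign \<sigma> qs)
             (PAct P d (concat bss) (block_perm \<sigma> (map length bss)) (deg (p # qs))
                (PComp P d cs bss (p # qs)))) \<and>
        (\<forall>\<tau>. (\<forall>i < length cs. \<tau> i \<in> perms (bss ! i)) \<longrightarrow>
           PComp P d cs (map (\<lambda>i. permute_list (\<tau> i) (bss ! i)) [0..<length cs])
             (p # map (\<lambda>i. hact P (cs ! i) (bss ! i) (\<tau> i) (qs ! i)) [0..<length cs]) =
           PAct P d (concat bss) (sum_perm \<tau> (map length bss)) (deg (p # qs))
             (PComp P d cs bss (p # qs))))"

definition colored_operad :: "'k ring \<Rightarrow> grading \<Rightarrow> ('c, 'k, 'a) operad \<Rightarrow> bool" where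
  "colored_operad K g P \<longleftrightarrow> operad_typed K g P \<and> operad_functorial K g P \<and>
     operad_unital P \<and> operad_assoc P \<and> operad_equivariant P"

subsection \<open>Algebras\<close>

type_synonym ('c, 'k, 'a) alg =
  "('c \<Rightarrow> ('k, 'a) cx) \<times> ('c \<Rightarrow> 'c list \<Rightarrow> (int \<times> 'a) list \<Rightarrow> 'a)"

definition operad_algebra ::
  "'k ring \<Rightarrow> grading \<Rightarrow> ('c, 'k, 'a) operad \<Rightarrow> ('c, 'k, 'a) alg \<Rightarrow> bool" where
  "operad_algebra K g P E \<longleftrightarrow> (case E of (A, \<alpha>) \<Rightarrow>
     (\<forall>c. A c \<in> Ob (Ch K g)) \<and>
     (\<forall>d cs. multi_chain_map K (PO P d cs # map A cs) (A d) (\<alpha> d cs)) \<and>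
     (\<forall>c. \<forall>a \<in> helems (A c). \<alpha> c [c] [(0, PUnit P c), a] = snd a) \<and>
     (\<forall>d cs bss p qs ass. length bss = length cs \<and>
        p \<in> helems (PO P d cs) \<and> qs \<in> tensors (map2 (PO P) cs bss) \<and>
        list_all2 (\<lambda>as bs. as \<in> tensors (map A bs)) ass bss \<longrightarrow>
        \<alpha> d (concat bss) (hval (PComp P d cs bss) (p # qs) # concat ass) =
        signed (Md (A d) (deg (p # qs @ concat ass))) (shuffle_sign qs ass)
          (\<alpha> d cs (p # map (\<lambda>i. hval (\<alpha> (cs ! i) (bss ! i)) (qs ! i # ass ! i)) [0..<length cs]))) \<and>
     (\<forall>d cs p as. \<forall>\<sigma> \<in> perms cs. p \<in> helems (PO P d cs) \<and> as \<in> tensors (map A cs) \<longrightarrow>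
        \<alpha> d (permute_list \<sigma> cs) (hact P d cs \<sigma> p # permute_list \<sigma> as) =
        signed (Md (A d) (deg (p # as))) (perm_sign \<sigma> as) (\<alpha> d cs (p # as))))"

definition algebra_homs :: "'k ring \<Rightarrow> grading \<Rightarrow> ('c, 'k, 'a) operad \<Rightarrow>
    ('c, 'k, 'a) alg \<Rightarrow> ('c, 'k, 'a) alg \<Rightarrow> ('c \<Rightarrow> int \<Rightarrow> 'a \<Rightarrow> 'a) set" where
  "algebra_homs K g P E F = {f \<in> Hom (power_cat (Ch K g)) (fst E) (fst F).
     \<forall>d cs. \<forall>p \<in> helems (PO P d cs). \<forall>as \<in> tensors (map (fst E) cs).
       f d (deg (p # as)) (snd E d cs (p # as)) =
       snd F d cs (p # map2 (\<lambda>c (n, a). (n, f c n a)) cs as)}"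

definition Alg :: "'k ring \<Rightarrow> grading \<Rightarrow> ('c, 'k, 'a) operad \<Rightarrow>
    (('c, 'k, 'a) alg, 'c \<Rightarrow> int \<Rightarrow> 'a \<Rightarrow> 'a) cat" where
  "Alg K g P = \<lparr>
     Ob = {E. operad_algebra K g P E},
     Hom = algebra_homs K g P,
     Idn = (\<lambda>E. Idn (power_cat (Ch K g)) (fst E)),
     Cmp = (\<lambda>E F G. Cmp (power_cat (Ch K g)) (fst E) (fst F) (fst G))\<rparr>"

definition alg_trivial_fibrations :: "'k ring \<Rightarrow> grading \<Rightarrow> ('c, 'k, 'a) operad \<Rightarrow>
    (('c, 'k, 'a) alg, 'c \<Rightarrow> int \<Rightarrow> 'a \<Rightarrow> 'a) arr set" where
  "alg_trivial_fibrations K g P = {(E, F, f) \<in> Arr (Alg K g P).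
     (fst E, fst F, f) \<in> power_arr (Fib (Ch_model K g) \<inter> Weq (Ch_model K g))}"

definition cofibrant_algebras ::
  "'k ring \<Rightarrow> grading \<Rightarrow> ('c, 'k, 'a) operad \<Rightarrow> ('c, 'k, 'a) alg set" where
  "cofibrant_algebras K g P = {E \<in> Ob (Alg K g P). \<exists>I. initial_ob (Alg K g P) I \<and>
     (\<forall>f \<in> Hom (Alg K g P) I E. (I, E, f) \<in> llp (Alg K g P) (alg_trivial_fibrations K g P))}"


section \<open>Preservation of algebras\<close>

definition Loc_obj ::
  "(('k, 'a) cx, int \<Rightarrow> 'a \<Rightarrow> 'a, ('k, 'a) cx, int \<Rightarrow> 'a \<Rightarrow> 'a) func \<Rightarrow>
   (('k, 'a) cx, int \<Rightarrow> 'a \<Rightarrow> 'a, ('k, 'a) cx, int \<Rightarrow> 'a \<Rightarrow> 'a) func \<Rightarrow>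
   ('c \<Rightarrow> ('k, 'a) cx) \<Rightarrow> ('c \<Rightarrow> ('k, 'a) cx)" where
  "Loc_obj Q R A = (\<lambda>c. FOb R (FOb Q (A c)))"

text \<open>The derived adjunction unit \<open>A \<leftarrow> Q A \<rightarrow> R (Q A)\<close>\<close>

definition Loc_unit ::
  "(('k, 'a) cx, int \<Rightarrow> 'a \<Rightarrow> 'a, ('k, 'a) cx, int \<Rightarrow> 'a \<Rightarrow> 'a) func \<Rightarrow>
   (('k, 'a) cx \<Rightarrow> int \<Rightarrow> 'a \<Rightarrow> 'a) \<Rightarrow>
   (('k, 'a) cx, int \<Rightarrow> 'a \<Rightarrow> 'a, ('k, 'a) cx, int \<Rightarrow> 'a \<Rightarrow> 'a) func \<Rightarrow>
   (('k, 'a) cx \<Rightarrow> int \<Rightarrow> 'a \<Rightarrow> 'a) \<Rightarrow>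
   ('c \<Rightarrow> ('k, 'a) cx) \<Rightarrow> ('c \<Rightarrow> ('k, 'a) cx, 'c \<Rightarrow> int \<Rightarrow> 'a \<Rightarrow> 'a) step list" where
  "Loc_unit Q q R r A =
     [Bwd (\<lambda>c. FOb Q (A c)) A (\<lambda>c. q (A c)),
      Fwd (\<lambda>c. FOb Q (A c)) (Loc_obj Q R A) (\<lambda>c. r (FOb Q (A c)))]"

text \<open>In the second conjunct \<^term>\<open>T\<close> is the natural choice and \<^term>\<open>l\<close> the lift: under an isomorphism
  \<^term>\<open>\<beta>\<close> in the homotopy category between the complexes underlying \<^term>\<open>FOb T E\<close> and the localization,
  \<^term>\<open>l E\<close> becomes the localization map.\<close>

definition preserves_algebras :: "'k ring \<Rightarrow> grading \<Rightarrow>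
    (('k, 'a) cx, int \<Rightarrow> 'a \<Rightarrow> 'a, ('k, 'a) cx, int \<Rightarrow> 'a \<Rightarrow> 'a) func \<Rightarrow>
    (('k, 'a) cx \<Rightarrow> int \<Rightarrow> 'a \<Rightarrow> 'a) \<Rightarrow>
    (('k, 'a) cx, int \<Rightarrow> 'a \<Rightarrow> 'a, ('k, 'a) cx, int \<Rightarrow> 'a \<Rightarrow> 'a) func \<Rightarrow>
    (('k, 'a) cx \<Rightarrow> int \<Rightarrow> 'a \<Rightarrow> 'a) \<Rightarrow>
    ('c, 'k, 'a) operad \<Rightarrow> bool" where
  "preserves_algebras K g Q q R r P \<longleftrightarrow>
     (let M = power_cat (Ch K g); W = power_arr (quasi_isos K g);
          A = Alg K g P; A\<^sub>c = full_subcat A (cofibrant_algebras K g P) in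
      (\<forall>E \<in> Ob A. \<exists>E' \<in> Ob A. weakly_equivalent M W (fst E') (Loc_obj Q R (fst E))) \<and>
      (\<exists>T l. is_functor A\<^sub>c A T \<and> is_nat_trans A\<^sub>c A id_func T l \<and>
         (\<forall>E \<in> Ob A\<^sub>c. \<exists>\<beta>. ho_iso M W (fst (FOb T E)) (Loc_obj Q R (fst E)) \<beta> \<and>
            ho_eq M W (fst E) (Loc_obj Q R (fst E))
              (Fwd (fst E) (fst (FOb T E)) (l E) # \<beta>) (Loc_unit Q q R r (fst E)))))"

end

theory Submission
  imports Defs
begin

text \<open>
  Over a field a complex is determined up to quasi-isomorphism by its homology, and so a left Bousfield
  localization can only be a truncation: it leaves the homology in the degrees of a downward closed
  set \<open>U\<close> of integers unchanged and kills the homology in all other degrees.  Truncation carries algebra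
  structures along.

  The set \<open>U\<close> is found from the model structure alone, without mapping spaces.  Write \<open>S\<^sup>n\<close> for a
  one-dimensional space in degree \<open>n\<close> and \<open>D\<^sup>n\<^sup>+\<^sup>1\<close> for its cone.  If \<open>H\<^sub>n\<close> of one of the localization maps
  \<open>X \<rightarrow> RX\<close> is not bijective, then \<open>S\<^sup>n \<rightarrow> D\<^sup>n\<^sup>+\<^sup>1\<close> or \<open>0 \<rightarrow> S\<^sup>n\<close> is a retract of it, the required
  projection being a linear functional.  Hence \<open>S\<^sup>n \<rightarrow> D\<^sup>n\<^sup>+\<^sup>1\<close> is a local equivalence, by cobase change
  so are all \<open>S\<^sup>j \<rightarrow> D\<^sup>j\<^sup>+\<^sup>1\<close> with \<open>j \<ge> n\<close>, and lifting against these maps shows that every local object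
  has trivial homology in degrees \<open>j \<ge> n\<close>.  This is \<open>localization_homology\<close>.

  Truncation is realized as a quotient \<open>X \<rightarrow> \<tau>X\<close> that is functorial in \<open>X\<close>.  Its kernel is an ideal for every
  operad action if all complexes are non-negatively graded, because a product has at least the degree of
  each of its factors (\<open>to_trunc_kills_products\<close>); so \<open>\<tau>E\<close> is an algebra and \<open>E \<rightarrow> \<tau>E\<close> a homomorphism.
  In the unbounded case this fails for a general \<open>U\<close>, but a stable localization has \<open>U\<close> empty or everything
  (\<open>stable_unchanged_degrees\<close>), and then \<open>\<tau>\<close> is zero or the identity.  Since \<open>\<tau>\<close> inverts the replacement
  maps \<open>QE \<rightarrow> E\<close> and \<open>QE \<rightarrow> RQE\<close> and the projection of \<open>RQE\<close>, naturality identifies \<open>E \<rightarrow> \<tau>E\<close> with the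
  localization map in the homotopy category.
\<close>

section \<open>Linear maps, chain complexes and homology\<close>

lemma linmapsI:
  assumes "f \<in> extensional (carrier M)" "\<And>x. x \<in> carrier M \<Longrightarrow> f x \<in> carrier N"
    "\<And>x y. x \<in> carrier M \<Longrightarrow> y \<in> carrier M \<Longrightarrow> f (x \<oplus>\<^bsub>M\<^esub> y) = f x \<oplus>\<^bsub>N\<^esub> f y"
    "\<And>a x. a \<in> carrier K \<Longrightarrow> x \<in> carrier M \<Longrightarrow> f (a \<odot>\<^bsub>M\<^esub> x) = a \<odot>\<^bsub>N\<^esub> f x"
  shows "f \<in> linmaps K M N"
  using assms by (simp add: linmaps_def PiE_def Pi_def)

lemma linmaps_closed: "f \<in> linmaps K M N \<Longrightarrow> x \<in> carrier M \<Longrightarrow> f x \<in> carrier N"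
  by (auto simp: linmaps_def)

lemma linmaps_add: "f \<in> linmaps K M N \<Longrightarrow> x \<in> carrier M \<Longrightarrow> y \<in> carrier M \<Longrightarrow>
    f (x \<oplus>\<^bsub>M\<^esub> y) = f x \<oplus>\<^bsub>N\<^esub> f y"
  by (auto simp: linmaps_def)

lemma linmaps_smult: "f \<in> linmaps K M N \<Longrightarrow> a \<in> carrier K \<Longrightarrow> x \<in> carrier M \<Longrightarrow>
    f (a \<odot>\<^bsub>M\<^esub> x) = a \<odot>\<^bsub>N\<^esub> f x"
  by (auto simp: linmaps_def)

lemma linmaps_eqI:
  assumes "f \<in> linmaps K M N" "f' \<in> linmaps K M N'" "\<And>x. x \<in> carrier M \<Longrightarrow> f x = f' x"
  shows "f = f'"
proof
  fix x show "f x = f' x"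
    using assms by (cases "x \<in> carrier M") (auto simp: linmaps_def PiE_def extensional_def)
qed

lemma
  assumes "f \<in> linmaps K M N" "module K M" "module K N"
  shows linmaps_zero: "f \<zero>\<^bsub>M\<^esub> = \<zero>\<^bsub>N\<^esub>"
    and linmaps_uminus: "x \<in> carrier M \<Longrightarrow> f (\<ominus>\<^bsub>M\<^esub> x) = \<ominus>\<^bsub>N\<^esub> f x"
proof -
  interpret M: module K M by fact
  interpret N: module K N by fact
  have z: "f \<zero>\<^bsub>M\<^esub> \<oplus>\<^bsub>N\<^esub> f \<zero>\<^bsub>M\<^esub> = f \<zero>\<^bsub>M\<^esub>"
    using linmaps_add[OF assms(1), of "\<zero>\<^bsub>M\<^esub>" "\<zero>\<^bsub>M\<^esub>"] by simp
  have c: "f \<zero>\<^bsub>M\<^esub> \<in> carrier N" using linmaps_closed[OF assms(1)] by simp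
  show z': "f \<zero>\<^bsub>M\<^esub> = \<zero>\<^bsub>N\<^esub>" using z c N.add.l_cancel_one by blast
  assume x: "x \<in> carrier M"
  have "f (\<ominus>\<^bsub>M\<^esub> x) \<oplus>\<^bsub>N\<^esub> f x = f (\<ominus>\<^bsub>M\<^esub> x \<oplus>\<^bsub>M\<^esub> x)"
    using linmaps_add[OF assms(1), of "\<ominus>\<^bsub>M\<^esub> x" x] x by simp
  also have "\<dots> = \<zero>\<^bsub>N\<^esub>" using x z' by (simp add: M.l_neg)
  finally have "f (\<ominus>\<^bsub>M\<^esub> x) \<oplus>\<^bsub>N\<^esub> f x = \<zero>\<^bsub>N\<^esub>" .
  then show "f (\<ominus>\<^bsub>M\<^esub> x) = \<ominus>\<^bsub>N\<^esub> f x"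
    using x linmaps_closed[OF assms(1)] N.minus_equality by (metis M.a_inv_closed)
qed

lemma linmaps_comp:
  assumes "f \<in> linmaps K M N" "h \<in> linmaps K N L" "module K M"
  shows "(\<lambda>x \<in> carrier M. h (f x)) \<in> linmaps K M L"
proof -
  interpret M: module K M by fact
  show ?thesis using assms by (auto simp: linmaps_def PiE_def Pi_def)
qed

lemma linmaps_id: "module K M \<Longrightarrow> (\<lambda>x \<in> carrier M. x) \<in> linmaps K M M"
proof -
  assume "module K M"
  then interpret M: module K M .
  show ?thesis by (auto simp: linmaps_def)
qed

lemma linmaps_const_zero:
  "module K M \<Longrightarrow> module K N \<Longrightarrow> (\<lambda>x \<in> carrier M. \<zero>\<^bsub>N\<^esub>) \<in> linmaps K M N"
proof -
  assume "module K M" "module K N"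
  then interpret M: module K M + N: module K N by auto
  show ?thesis by (auto simp: linmaps_def)
qed

lemma submodule_module:
  assumes "module K M" "H \<subseteq> carrier M" "\<zero>\<^bsub>M\<^esub> \<in> H"
    "\<And>x y. x \<in> H \<Longrightarrow> y \<in> H \<Longrightarrow> x \<oplus>\<^bsub>M\<^esub> y \<in> H"
    "\<And>a x. a \<in> carrier K \<Longrightarrow> x \<in> H \<Longrightarrow> a \<odot>\<^bsub>M\<^esub> x \<in> H"
  shows "module K (M\<lparr>carrier := H\<rparr>)"
proof -
  interpret M: module K M by fact
  have neg: "\<ominus>\<^bsub>M\<^esub> x \<in> H" if "x \<in> H" for x
  proof -
    have "\<ominus>\<^bsub>M\<^esub> x = (\<ominus>\<^bsub>K\<^esub> \<one>\<^bsub>K\<^esub>) \<odot>\<^bsub>M\<^esub> x" using that assms(2) M.smult_l_minus[of "\<one>\<^bsub>K\<^esub>" x] by auto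
    then show ?thesis using that assms(5) by simp
  qed
  have c: "\<And>x. x \<in> H \<Longrightarrow> x \<in> carrier M" using assms(2) by auto
  show ?thesis
  proof (intro module.intro module_axioms.intro abelian_groupI)
    show "cring K" by (rule M.is_cring)
  next
    fix x assume x: "x \<in> carrier (M\<lparr>carrier := H\<rparr>)"
    show "\<exists>y\<in>carrier (M\<lparr>carrier := H\<rparr>). y \<oplus>\<^bsub>M\<lparr>carrier := H\<rparr>\<^esub> x = \<zero>\<^bsub>M\<lparr>carrier := H\<rparr>\<^esub>"
      using neg[of x] x c by (auto intro!: bexI[of _ "\<ominus>\<^bsub>M\<^esub> x"] simp: M.l_neg)
  next
    show "\<And>x y. x \<in> carrier (M\<lparr>carrier := H\<rparr>) \<Longrightarrow> y \<in> carrier (M\<lparr>carrier := H\<rparr>) \<Longrightarrow>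
        x \<oplus>\<^bsub>M\<lparr>carrier := H\<rparr>\<^esub> y = y \<oplus>\<^bsub>M\<lparr>carrier := H\<rparr>\<^esub> x"
      using c by (simp add: M.a_comm)
  qed (use assms c in \<open>auto simp: M.a_assoc M.smult_l_distr M.smult_r_distr M.smult_assoc1\<close>)
qed

lemma zero_module: "module K M \<Longrightarrow> module K (M\<lparr>carrier := {\<zero>\<^bsub>M\<^esub>}\<rparr>)"
proof -
  assume "module K M"
  then interpret M: module K M .
  show ?thesis by (rule submodule_module) (auto intro: M.module_axioms)
qed

lemma Ch_ObD: "X \<in> Ob (Ch K g) \<Longrightarrow> chain_complex K X"
  by (simp add: Ch_def)

lemma Ch_Ob_neg: "X \<in> Ob (Ch K NonNeg) \<Longrightarrow> n < 0 \<Longrightarrow> carrier (Md X n) = {\<zero>\<^bsub>Md X n\<^esub>}"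
  by (simp add: Ch_def)

lemma Ch_Hom [simp]: "Hom (Ch K g) X Y = chain_maps K X Y"
  by (simp add: Ch_def)

lemma Ch_Cmp: "Cmp (Ch K g) X Y Z f' f = (\<lambda>n. \<lambda>x \<in> carrier (Md X n). f' n (f n x))"
  by (simp add: Ch_def)

lemma Ch_Cmp_apply [simp]:
  "x \<in> carrier (Md X n) \<Longrightarrow> Cmp (Ch K g) X Y Z f' f n x = f' n (f n x)"
  by (simp add: Ch_def)

lemma Ch_Idn: "Idn (Ch K g) X = (\<lambda>n. \<lambda>x \<in> carrier (Md X n). x)"
  by (simp add: Ch_def)

lemma Ch_Idn_apply [simp]: "x \<in> carrier (Md X n) \<Longrightarrow> Idn (Ch K g) X n x = x"
  by (simp add: Ch_def)

lemma chain_complex_module: "chain_complex K X \<Longrightarrow> module K (Md X n)"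
  by (simp add: chain_complex_def)

lemma Df_lin: "chain_complex K X \<Longrightarrow> Df X n \<in> linmaps K (Md X n) (Md X (n - 1))"
  by (simp add: chain_complex_def)

lemma Df_closed: "chain_complex K X \<Longrightarrow> x \<in> carrier (Md X n) \<Longrightarrow> Df X n x \<in> carrier (Md X (n - 1))"
  using Df_lin linmaps_closed by fastforce

lemma Df_Df: "chain_complex K X \<Longrightarrow> x \<in> carrier (Md X n) \<Longrightarrow> Df X (n - 1) (Df X n x) = \<zero>\<^bsub>Md X (n - 2)\<^esub>"
  by (simp add: chain_complex_def)

lemma chain_maps_lin: "f \<in> chain_maps K X Y \<Longrightarrow> f n \<in> linmaps K (Md X n) (Md Y n)"
  by (simp add: chain_maps_def)

lemma chain_maps_closed: "f \<in> chain_maps K X Y \<Longrightarrow> x \<in> carrier (Md X n) \<Longrightarrow> f n x \<in> carrier (Md Y n)"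
  using chain_maps_lin linmaps_closed by fastforce

lemma chain_maps_Df:
  "f \<in> chain_maps K X Y \<Longrightarrow> x \<in> carrier (Md X n) \<Longrightarrow> Df Y n (f n x) = f (n - 1) (Df X n x)"
  by (simp add: chain_maps_def)

lemma chain_maps_eqI:
  assumes "f \<in> chain_maps K X Y" "f' \<in> chain_maps K X Y'"
    "\<And>n x. x \<in> carrier (Md X n) \<Longrightarrow> f n x = f' n x"
  shows "f = f'"
  by (rule ext, rule linmaps_eqI) (use assms chain_maps_lin in blast)+

lemma chain_maps_zero:
  "f \<in> chain_maps K X Y \<Longrightarrow> chain_complex K X \<Longrightarrow> chain_complex K Y \<Longrightarrow> f n \<zero>\<^bsub>Md X n\<^esub> = \<zero>\<^bsub>Md Y n\<^esub>"
  by (meson chain_complex_module chain_maps_lin linmaps_zero)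

lemma Df_zero: "chain_complex K X \<Longrightarrow> Df X n \<zero>\<^bsub>Md X n\<^esub> = \<zero>\<^bsub>Md X (n - 1)\<^esub>"
  by (meson chain_complex_module Df_lin linmaps_zero)

lemma chain_maps_comp:
  assumes "f \<in> chain_maps K X Y" "f' \<in> chain_maps K Y Z" "chain_complex K X"
  shows "Cmp (Ch K g) X Y Z f' f \<in> chain_maps K X Z"
proof -
  have "f' (n - 1) (f (n - 1) (Df X n x)) = Df Z n (f' n (f n x))" if "x \<in> carrier (Md X n)" for n x
    using that assms chain_maps_Df chain_maps_closed Df_closed by metis
  moreover have "(\<lambda>x \<in> carrier (Md X n). f' n (f n x)) \<in> linmaps K (Md X n) (Md Z n)" for n
    using assms by (intro linmaps_comp[OF chain_maps_lin chain_maps_lin] chain_complex_module)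
  ultimately show ?thesis
    using Df_closed[OF assms(3)] by (simp add: chain_maps_def Ch_Cmp)
qed

lemma chain_maps_id: "chain_complex K X \<Longrightarrow> Idn (Ch K g) X \<in> chain_maps K X X"
  by (auto simp: chain_maps_def Ch_Idn linmaps_id chain_complex_module Df_closed)

text \<open>The laws of a category, which \<^const>\<open>model_structure\<close> takes for granted.\<close>

locale category =
  fixes C :: "('o, 'm) cat"
  assumes Idn_Hom: "X \<in> Ob C \<Longrightarrow> Idn C X \<in> Hom C X X"
    and Cmp_Hom: "X \<in> Ob C \<Longrightarrow> Y \<in> Ob C \<Longrightarrow> Z \<in> Ob C \<Longrightarrow> f \<in> Hom C X Y \<Longrightarrow> g \<in> Hom C Y Z \<Longrightarrow>
      Cmp C X Y Z g f \<in> Hom C X Z"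
    and Cmp_Idn_right: "X \<in> Ob C \<Longrightarrow> Y \<in> Ob C \<Longrightarrow> f \<in> Hom C X Y \<Longrightarrow> Cmp C X X Y f (Idn C X) = f"
    and Cmp_Idn_left: "X \<in> Ob C \<Longrightarrow> Y \<in> Ob C \<Longrightarrow> f \<in> Hom C X Y \<Longrightarrow> Cmp C X Y Y (Idn C Y) f = f"
    and Cmp_assoc: "X \<in> Ob C \<Longrightarrow> Y \<in> Ob C \<Longrightarrow> Z \<in> Ob C \<Longrightarrow> V \<in> Ob C \<Longrightarrow>
      f \<in> Hom C X Y \<Longrightarrow> g \<in> Hom C Y Z \<Longrightarrow> h \<in> Hom C Z V \<Longrightarrow>
      Cmp C X Z V h (Cmp C X Y Z g f) = Cmp C X Y V (Cmp C Y Z V h g) f"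

lemma category_Ch: "category (Ch K g)"
proof
  fix X Y f assume "X \<in> Ob (Ch K g)" "Y \<in> Ob (Ch K g)" "f \<in> Hom (Ch K g) X Y"
  then have X: "chain_complex K X" "chain_complex K Y" "f \<in> chain_maps K X Y" by (auto dest: Ch_ObD)
  show "Cmp (Ch K g) X X Y f (Idn (Ch K g) X) = f"
    by (rule chain_maps_eqI[OF chain_maps_comp X(3)]) (use X chain_maps_id in auto)
  show "Cmp (Ch K g) X Y Y (Idn (Ch K g) Y) f = f"
    by (rule chain_maps_eqI[OF chain_maps_comp X(3)]) (use X chain_maps_id chain_maps_closed in fastforce)+
next
  fix X Y Z f f' assume "X \<in> Ob (Ch K g)" "f \<in> Hom (Ch K g) X Y" "f' \<in> Hom (Ch K g) Y Z"
  then show "Cmp (Ch K g) X Y Z f' f \<in> Hom (Ch K g) X Z" by (auto intro: chain_maps_comp dest: Ch_ObD)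
next
  fix X Y Z V f f' f'' assume "f \<in> Hom (Ch K g) X Y"
  then have f: "f \<in> chain_maps K X Y" by simp
  show "Cmp (Ch K g) X Z V f'' (Cmp (Ch K g) X Y Z f' f) = Cmp (Ch K g) X Y V (Cmp (Ch K g) Y Z V f'' f') f"
    using chain_maps_closed[OF f] by (auto simp: Ch_Cmp fun_eq_iff)
qed (auto simp: chain_maps_id Ch_ObD)

lemma category_power_cat: "category C \<Longrightarrow> category (power_cat C)"
  by (auto simp: category_def power_cat_def)

lemma boundaries_subset: "chain_complex K X \<Longrightarrow> boundaries X n \<subseteq> carrier (Md X n)"
  using Df_closed[of K X _ "n + 1"] by (auto simp: boundaries_def)

lemma boundaries_subset_cycles: "chain_complex K X \<Longrightarrow> boundaries X n \<subseteq> cycles X n"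
  using Df_closed[of K X _ "n + 1"] Df_Df[of K X _ "n + 1"] by (auto simp: boundaries_def cycles_def)

lemma boundaries_iff: "b \<in> boundaries X n \<longleftrightarrow> (\<exists>y \<in> carrier (Md X (n + 1)). b = Df X (n + 1) y)"
  by (auto simp: boundaries_def)

lemma zero_boundary: "chain_complex K X \<Longrightarrow> \<zero>\<^bsub>Md X n\<^esub> \<in> boundaries X n"
proof -
  assume X: "chain_complex K X"
  interpret module K "Md X (n + 1)" using X by (rule chain_complex_module)
  show ?thesis using Df_zero[OF X, of "n + 1"] by (auto simp: boundaries_def intro!: image_eqI)
qed

lemma boundaries_add:
  "chain_complex K X \<Longrightarrow> x \<in> boundaries X n \<Longrightarrow> y \<in> boundaries X n \<Longrightarrow> x \<oplus>\<^bsub>Md X n\<^esub> y \<in> boundaries X n"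
proof -
  assume X: "chain_complex K X" and xy: "x \<in> boundaries X n" "y \<in> boundaries X n"
  interpret module K "Md X (n + 1)" using X by (rule chain_complex_module)
  from xy obtain x' y' where "x' \<in> carrier (Md X (n+1))" "y' \<in> carrier (Md X (n+1))"
      "x = Df X (n + 1) x'" "y = Df X (n + 1) y'" by (auto simp: boundaries_iff)
  then show ?thesis using linmaps_add[OF Df_lin[OF X], of x' "n + 1" y']
    unfolding boundaries_iff by (intro bexI[of _ "x' \<oplus>\<^bsub>Md X (n + 1)\<^esub> y'"]) auto
qed

lemma boundaries_smult:
  "chain_complex K X \<Longrightarrow> x \<in> boundaries X n \<Longrightarrow> a \<in> carrier K \<Longrightarrow> a \<odot>\<^bsub>Md X n\<^esub> x \<in> boundaries X n"
proof -
  assume X: "chain_complex K X" and x: "x \<in> boundaries X n" "a \<in> carrier K"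
  interpret module K "Md X (n + 1)" using X by (rule chain_complex_module)
  from x obtain x' where "x' \<in> carrier (Md X (n+1))" "x = Df X (n + 1) x'" by (auto simp: boundaries_iff)
  then show ?thesis using linmaps_smult[OF Df_lin[OF X], of a x' "n + 1"] x
    unfolding boundaries_iff by (intro bexI[of _ "a \<odot>\<^bsub>Md X (n + 1)\<^esub> x'"]) auto
qed

lemma boundaries_uminus:
  "chain_complex K X \<Longrightarrow> x \<in> boundaries X n \<Longrightarrow> \<ominus>\<^bsub>Md X n\<^esub> x \<in> boundaries X n"
proof -
  assume X: "chain_complex K X" and x: "x \<in> boundaries X n"
  interpret module K "Md X n" using X by (rule chain_complex_module)
  have "\<ominus>\<^bsub>Md X n\<^esub> x = (\<ominus>\<^bsub>K\<^esub> \<one>\<^bsub>K\<^esub>) \<odot>\<^bsub>Md X n\<^esub> x"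
    using subsetD[OF boundaries_subset[OF X] x] smult_l_minus[of "\<one>\<^bsub>K\<^esub>" x] by auto
  then show ?thesis using boundaries_smult[OF X x] by simp
qed

lemma chain_maps_cycles:
  "f \<in> chain_maps K X Y \<Longrightarrow> chain_complex K X \<Longrightarrow> chain_complex K Y \<Longrightarrow> x \<in> cycles X n \<Longrightarrow> f n x \<in> cycles Y n"
  by (auto simp: cycles_def chain_maps_closed chain_maps_Df chain_maps_zero)

lemma chain_maps_boundaries:
  "f \<in> chain_maps K X Y \<Longrightarrow> x \<in> boundaries X n \<Longrightarrow> f n x \<in> boundaries Y n"
proof -
  assume f: "f \<in> chain_maps K X Y" and "x \<in> boundaries X n"
  then obtain y where "y \<in> carrier (Md X (n + 1))" "x = Df X (n + 1) y" by (auto simp: boundaries_iff)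
  then show ?thesis
    using chain_maps_Df[OF f, of y "n + 1"] chain_maps_closed[OF f, of y "n + 1"]
    unfolding boundaries_iff by (intro bexI[of _ "f (n + 1) y"]) auto
qed

lemma cycles_add:
  "chain_complex K X \<Longrightarrow> x \<in> cycles X n \<Longrightarrow> y \<in> cycles X n \<Longrightarrow> x \<oplus>\<^bsub>Md X n\<^esub> y \<in> cycles X n"
proof -
  assume X: "chain_complex K X" and xy: "x \<in> cycles X n" "y \<in> cycles X n"
  interpret module K "Md X n" using X by (rule chain_complex_module)
  interpret M': module K "Md X (n - 1)" using X by (rule chain_complex_module)
  show ?thesis using xy linmaps_add[OF Df_lin[OF X]] by (auto simp: cycles_def)
qed

lemma cycles_smult:
  "chain_complex K X \<Longrightarrow> x \<in> cycles X n \<Longrightarrow> a \<in> carrier K \<Longrightarrow> a \<odot>\<^bsub>Md X n\<^esub> x \<in> cycles X n"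
proof -
  assume X: "chain_complex K X" and xy: "x \<in> cycles X n" "a \<in> carrier K"
  interpret module K "Md X n" using X by (rule chain_complex_module)
  interpret M': module K "Md X (n - 1)" using X by (rule chain_complex_module)
  show ?thesis using xy linmaps_smult[OF Df_lin[OF X]] by (auto simp: cycles_def)
qed

definition hclass :: "('k, 'a) cx \<Rightarrow> int \<Rightarrow> 'a \<Rightarrow> 'a set" where
  "hclass X n x = {b \<oplus>\<^bsub>Md X n\<^esub> x | b. b \<in> boundaries X n}"

lemma hclass_eq_iff:
  assumes X: "chain_complex K X" and x: "x \<in> carrier (Md X n)" and y: "y \<in> carrier (Md X n)"
  shows "hclass X n x = hclass X n y \<longleftrightarrow> (\<exists>b \<in> boundaries X n. x = b \<oplus>\<^bsub>Md X n\<^esub> y)"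
proof -
  interpret module K "Md X n" using X by (rule chain_complex_module)
  note B = boundaries_subset[OF X, of n]
  have sub: "hclass X n u \<subseteq> hclass X n v" if "b \<in> boundaries X n" "u = b \<oplus>\<^bsub>Md X n\<^esub> v"
    "v \<in> carrier (Md X n)" for u v b
  proof
    fix w assume "w \<in> hclass X n u"
    then obtain b' where b': "b' \<in> boundaries X n" "w = b' \<oplus>\<^bsub>Md X n\<^esub> u" by (auto simp: hclass_def)
    then have "w = (b' \<oplus>\<^bsub>Md X n\<^esub> b) \<oplus>\<^bsub>Md X n\<^esub> v" using that B a_assoc by (simp add: subset_iff)
    then show "w \<in> hclass X n v" using boundaries_add[OF X b'(1) that(1)] by (auto simp: hclass_def)
  qed
  show ?thesis
  proof
    assume "hclass X n x = hclass X n y"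
    moreover have "x \<in> hclass X n x"
      using zero_boundary[OF X, of n] x by (auto simp: hclass_def intro!: exI[of _ "\<zero>\<^bsub>Md X n\<^esub>"])
    ultimately show "\<exists>b \<in> boundaries X n. x = b \<oplus>\<^bsub>Md X n\<^esub> y" by (auto simp: hclass_def)
  next
    assume "\<exists>b \<in> boundaries X n. x = b \<oplus>\<^bsub>Md X n\<^esub> y"
    then obtain b where b: "b \<in> boundaries X n" "x = b \<oplus>\<^bsub>Md X n\<^esub> y" by auto
    then have "y = (\<ominus>\<^bsub>Md X n\<^esub> b) \<oplus>\<^bsub>Md X n\<^esub> x" using B y by (auto simp: r_neg1)
    then show "hclass X n x = hclass X n y"
      using sub[OF b y] sub[OF boundaries_uminus[OF X b(1)] _ x] by blast
  qed
qed

lemma carrier_homology: "carrier (homology X n) = hclass X n ` cycles X n"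
  by (auto simp: homology_def FactGroup_def RCOSETS_def r_coset_def hclass_def image_def)

lemma homology_mult:
  assumes X: "chain_complex K X" and x: "x \<in> carrier (Md X n)" and y: "y \<in> carrier (Md X n)"
  shows "hclass X n x \<otimes>\<^bsub>homology X n\<^esub> hclass X n y = hclass X n (x \<oplus>\<^bsub>Md X n\<^esub> y)"
proof -
  interpret module K "Md X n" using X by (rule chain_complex_module)
  note B = subsetD[OF boundaries_subset[OF X, of n]]
  have "hclass X n x \<otimes>\<^bsub>homology X n\<^esub> hclass X n y =
      {(b \<oplus>\<^bsub>Md X n\<^esub> x) \<oplus>\<^bsub>Md X n\<^esub> (b' \<oplus>\<^bsub>Md X n\<^esub> y) | b b'. b \<in> boundaries X n \<and> b' \<in> boundaries X n}"
    by (auto simp: homology_def FactGroup_def set_mult_def hclass_def) 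
  also have "\<dots> = {(b \<oplus>\<^bsub>Md X n\<^esub> b') \<oplus>\<^bsub>Md X n\<^esub> (x \<oplus>\<^bsub>Md X n\<^esub> y) | b b'. b \<in> boundaries X n \<and> b' \<in> boundaries X n}"
  proof -
    have "(b \<oplus>\<^bsub>Md X n\<^esub> x) \<oplus>\<^bsub>Md X n\<^esub> (b' \<oplus>\<^bsub>Md X n\<^esub> y) = (b \<oplus>\<^bsub>Md X n\<^esub> b') \<oplus>\<^bsub>Md X n\<^esub> (x \<oplus>\<^bsub>Md X n\<^esub> y)"
      if "b \<in> boundaries X n" "b' \<in> boundaries X n" for b b'
      using that x y B by (simp add: a_ac)
    then show ?thesis by (intro Collect_cong ex_cong1) auto
  qed
  also have "\<dots> = hclass X n (x \<oplus>\<^bsub>Md X n\<^esub> y)"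
  proof (intro equalityI subsetI)
    fix w assume "w \<in> hclass X n (x \<oplus>\<^bsub>Md X n\<^esub> y)"
    then obtain b where b: "b \<in> boundaries X n" "w = b \<oplus>\<^bsub>Md X n\<^esub> (x \<oplus>\<^bsub>Md X n\<^esub> y)"
      by (auto simp: hclass_def)
    then have "w = (b \<oplus>\<^bsub>Md X n\<^esub> \<zero>\<^bsub>Md X n\<^esub>) \<oplus>\<^bsub>Md X n\<^esub> (x \<oplus>\<^bsub>Md X n\<^esub> y)" using B by simp
    then show "w \<in> {(b \<oplus>\<^bsub>Md X n\<^esub> b') \<oplus>\<^bsub>Md X n\<^esub> (x \<oplus>\<^bsub>Md X n\<^esub> y) | b b'. b \<in> boundaries X n \<and> b' \<in> boundaries X n}"
      using b zero_boundary[OF X] by blast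
  qed (use boundaries_add[OF X] in \<open>auto simp: hclass_def\<close>)
  finally show ?thesis .
qed

lemma homology_map_hclass:
  assumes X: "chain_complex K X" and Y: "chain_complex K Y" and f: "f \<in> chain_maps K X Y"
    and x: "x \<in> carrier (Md X n)"
  shows "homology_map Y f n (hclass X n x) = hclass Y n (f n x)"
proof -
  interpret module K "Md Y n" using Y by (rule chain_complex_module)
  note B = subsetD[OF boundaries_subset[OF Y, of n]]
  note B' = subsetD[OF boundaries_subset[OF X, of n]]
  have fx: "f n x \<in> carrier (Md Y n)" using chain_maps_closed[OF f x] .
  have "homology_map Y f n (hclass X n x) =
     {b \<oplus>\<^bsub>Md Y n\<^esub> (f n b' \<oplus>\<^bsub>Md Y n\<^esub> f n x) | b b'. b \<in> boundaries Y n \<and> b' \<in> boundaries X n}"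
    using linmaps_add[OF chain_maps_lin[OF f] B' x]
    by (force simp: homology_map_def set_mult_def hclass_def)
  also have "\<dots> = hclass Y n (f n x)"
  proof (intro equalityI subsetI)
    fix w assume "w \<in> {b \<oplus>\<^bsub>Md Y n\<^esub> (f n b' \<oplus>\<^bsub>Md Y n\<^esub> f n x) | b b'. b \<in> boundaries Y n \<and> b' \<in> boundaries X n}"
    then obtain b b' where b: "b \<in> boundaries Y n" "b' \<in> boundaries X n"
      "w = b \<oplus>\<^bsub>Md Y n\<^esub> (f n b' \<oplus>\<^bsub>Md Y n\<^esub> f n x)" by blast
    have fb: "f n b' \<in> boundaries Y n" using chain_maps_boundaries[OF f b(2)] .
    have "w = (b \<oplus>\<^bsub>Md Y n\<^esub> f n b') \<oplus>\<^bsub>Md Y n\<^esub> f n x"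
      using b B fb fx by (simp add: a_assoc)
    then show "w \<in> hclass Y n (f n x)" using boundaries_add[OF Y b(1) fb] by (auto simp: hclass_def)
  next
    fix w assume "w \<in> hclass Y n (f n x)"
    then obtain b where b: "b \<in> boundaries Y n" "w = b \<oplus>\<^bsub>Md Y n\<^esub> f n x" by (auto simp: hclass_def)
    then have "w = b \<oplus>\<^bsub>Md Y n\<^esub> (f n \<zero>\<^bsub>Md X n\<^esub> \<oplus>\<^bsub>Md Y n\<^esub> f n x)"
      using fx by (simp add: chain_maps_zero[OF f X Y])
    then show "w \<in> {b \<oplus>\<^bsub>Md Y n\<^esub> (f n b' \<oplus>\<^bsub>Md Y n\<^esub> f n x) | b b'. b \<in> boundaries Y n \<and> b' \<in> boundaries X n}"
      using b zero_boundary[OF X] by blast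
  qed
  finally show ?thesis .
qed

text \<open>Bijectivity of \<open>H\<^sub>n(f)\<close>, by elements, so that quotient groups need not be handled later.\<close>

definition homology_bij :: "('k, 'a) cx \<Rightarrow> ('k, 'b) cx \<Rightarrow> (int \<Rightarrow> 'a \<Rightarrow> 'b) \<Rightarrow> int \<Rightarrow> bool" where
  "homology_bij X Y f n \<longleftrightarrow>
     (\<forall>x \<in> cycles X n. f n x \<in> boundaries Y n \<longrightarrow> x \<in> boundaries X n) \<and>
     (\<forall>y \<in> cycles Y n. \<exists>x \<in> cycles X n. \<exists>b \<in> boundaries Y n. y = b \<oplus>\<^bsub>Md Y n\<^esub> f n x)"

text \<open>A homomorphism is injective if its kernel is trivial, and it is surjective if every class of a cycle is
  hit; both conditions are spelled out on representatives.\<close>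

lemma homology_iso_iff:
  assumes X: "chain_complex K X" and Y: "chain_complex K Y" and f: "f \<in> chain_maps K X Y"
  shows "homology_map Y f n \<in> iso (homology X n) (homology Y n) \<longleftrightarrow> homology_bij X Y f n"
proof -
  interpret X: module K "Md X n" using X by (rule chain_complex_module)
  interpret Y: module K "Md Y n" using Y by (rule chain_complex_module)
  note BX = subsetD[OF boundaries_subset[OF X, of n]]
  note BY = subsetD[OF boundaries_subset[OF Y, of n]]
  have cX: "x \<in> cycles X n \<Longrightarrow> x \<in> carrier (Md X n)" for x by (simp add: cycles_def)
  have cY: "x \<in> cycles Y n \<Longrightarrow> x \<in> carrier (Md Y n)" for x by (simp add: cycles_def)
  note hm = homology_map_hclass[OF X Y f]
  note fc = chain_maps_closed[OF f]
  note fcyc = chain_maps_cycles[OF f X Y]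
  have hom: "homology_map Y f n \<in> hom (homology X n) (homology Y n)"
    by (rule homI)
       (auto simp: carrier_homology hm cX homology_mult[OF X] homology_mult[OF Y] fc fcyc
          linmaps_add[OF chain_maps_lin[OF f]])
  have inj: "inj_on (homology_map Y f n) (carrier (homology X n)) \<longleftrightarrow>
      (\<forall>x \<in> cycles X n. f n x \<in> boundaries Y n \<longrightarrow> x \<in> boundaries X n)" (is "?L \<longleftrightarrow> ?R")
  proof
    assume L: ?L
    show ?R
    proof (intro ballI impI)
      fix x assume x: "x \<in> cycles X n" "f n x \<in> boundaries Y n"
      have z: "\<zero>\<^bsub>Md X n\<^esub> \<in> cycles X n" using zero_boundary[OF X] boundaries_subset_cycles[OF X] by blast
      have "f n x = f n x \<oplus>\<^bsub>Md Y n\<^esub> f n \<zero>\<^bsub>Md X n\<^esub>"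
        using fc[OF cX[OF x(1)]] by (simp add: chain_maps_zero[OF f X Y])
      then have "hclass Y n (f n x) = hclass Y n (f n \<zero>\<^bsub>Md X n\<^esub>)"
        using hclass_eq_iff[OF Y fc[OF cX[OF x(1)]] fc[OF cX[OF z]]] x(2) by blast
      then have "hclass X n x = hclass X n \<zero>\<^bsub>Md X n\<^esub>"
        using inj_onD[OF L, of "hclass X n x" "hclass X n \<zero>\<^bsub>Md X n\<^esub>"] x(1) z
        by (simp add: carrier_homology hm cX)
      then obtain b where "b \<in> boundaries X n" "x = b \<oplus>\<^bsub>Md X n\<^esub> \<zero>\<^bsub>Md X n\<^esub>"
        using hclass_eq_iff[OF X cX[OF x(1)], of "\<zero>\<^bsub>Md X n\<^esub>"] by auto
      then show "x \<in> boundaries X n" using BX by simp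
    qed
  next
    assume R: ?R
    show ?L
    proof (rule inj_onI)
      fix c c' assume "c \<in> carrier (homology X n)" "c' \<in> carrier (homology X n)"
        and eq: "homology_map Y f n c = homology_map Y f n c'"
      then obtain x x' where x: "x \<in> cycles X n" "c = hclass X n x" "x' \<in> cycles X n" "c' = hclass X n x'"
        by (auto simp: carrier_homology)
      have c: "x \<in> carrier (Md X n)" "x' \<in> carrier (Md X n)" using x cX by auto
      have neg: "(\<ominus>\<^bsub>K\<^esub> \<one>\<^bsub>K\<^esub>) \<odot>\<^bsub>Md X n\<^esub> x' = \<ominus>\<^bsub>Md X n\<^esub> x'" 
        using c X.smult_l_minus[of "\<one>\<^bsub>K\<^esub>" x'] by simp
      have n: "\<ominus>\<^bsub>Md X n\<^esub> x' \<in> cycles X n" using cycles_smult[OF X x(3), of "\<ominus>\<^bsub>K\<^esub> \<one>\<^bsub>K\<^esub>"] neg by simp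
      have d: "x \<oplus>\<^bsub>Md X n\<^esub> \<ominus>\<^bsub>Md X n\<^esub> x' \<in> cycles X n" using cycles_add[OF X x(1) n] .
      have "hclass Y n (f n x) = hclass Y n (f n x')" using eq x c hm by simp
      then obtain b where b: "b \<in> boundaries Y n" "f n x = b \<oplus>\<^bsub>Md Y n\<^esub> f n x'"
        using hclass_eq_iff[OF Y fc fc] c by blast
      have "f n (x \<oplus>\<^bsub>Md X n\<^esub> \<ominus>\<^bsub>Md X n\<^esub> x') = f n x \<oplus>\<^bsub>Md Y n\<^esub> \<ominus>\<^bsub>Md Y n\<^esub> f n x'"
        using c linmaps_add[OF chain_maps_lin[OF f]]
          linmaps_uminus[OF chain_maps_lin[OF f] X.module_axioms Y.module_axioms] by simp
      also have "\<dots> = b" using b BY fc c by (simp add: Y.a_assoc Y.r_neg)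
      finally have "x \<oplus>\<^bsub>Md X n\<^esub> \<ominus>\<^bsub>Md X n\<^esub> x' \<in> boundaries X n" using R d b by simp
      moreover have "x = (x \<oplus>\<^bsub>Md X n\<^esub> \<ominus>\<^bsub>Md X n\<^esub> x') \<oplus>\<^bsub>Md X n\<^esub> x'"
        using c by (simp add: X.a_assoc X.l_neg)
      ultimately show "c = c'" using hclass_eq_iff[OF X c] x by blast
    qed
  qed
  have surj: "homology_map Y f n ` carrier (homology X n) = carrier (homology Y n) \<longleftrightarrow>
      (\<forall>y \<in> cycles Y n. \<exists>x \<in> cycles X n. \<exists>b \<in> boundaries Y n. y = b \<oplus>\<^bsub>Md Y n\<^esub> f n x)"
  proof -
    have e: "homology_map Y f n ` carrier (homology X n) = (\<lambda>x. hclass Y n (f n x)) ` cycles X n"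
      unfolding carrier_homology image_image by (rule image_cong[OF refl]) (rule hm[OF cX])
    have s: "(\<lambda>x. hclass Y n (f n x)) ` cycles X n \<subseteq> carrier (homology Y n)"
      unfolding carrier_homology by (intro image_subsetI imageI fcyc)
    have "homology_map Y f n ` carrier (homology X n) = carrier (homology Y n) \<longleftrightarrow>
       carrier (homology Y n) \<subseteq> (\<lambda>x. hclass Y n (f n x)) ` cycles X n"
      unfolding e by (simp only: set_eq_subset[of _ "carrier (homology Y n)"] s simp_thms)
    also have "\<dots> \<longleftrightarrow> (\<forall>y \<in> cycles Y n. \<exists>x \<in> cycles X n. hclass Y n y = hclass Y n (f n x))"
      unfolding carrier_homology image_subset_iff image_iff ..
    also have "\<dots> \<longleftrightarrow>
      (\<forall>y \<in> cycles Y n. \<exists>x \<in> cycles X n. \<exists>b \<in> boundaries Y n. y = b \<oplus>\<^bsub>Md Y n\<^esub> f n x)"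
      by (intro ball_cong bex_cong refl hclass_eq_iff[OF Y] cY fc[OF cX])
    finally show ?thesis .
  qed
  show ?thesis using hom inj surj by (auto simp: iso_def bij_betw_def homology_bij_def)
qed

lemma quasi_isos_iff:
  "(X, Y, f) \<in> quasi_isos K g \<longleftrightarrow> (X, Y, f) \<in> Arr (Ch K g) \<and> (\<forall>n. homology_bij X Y f n)"
proof -
  have "homology_map Y f n \<in> iso (homology X n) (homology Y n) \<longleftrightarrow> homology_bij X Y f n"
    if "(X, Y, f) \<in> Arr (Ch K g)" for n
    by (rule homology_iso_iff) (use that in \<open>auto simp: Arr_def dest: Ch_ObD\<close>)
  then show ?thesis by (auto simp: quasi_isos_def)
qed

section \<open>Homotopy categories and model structures\<close>

lemma zigzag_append: "zigzag C W X Y p \<Longrightarrow> zigzag C W Y Z q \<Longrightarrow> zigzag C W X Z (p @ q)"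
  by (induction rule: zigzag.induct) (auto intro: zigzag.intros)

lemma zigzag_Fwd: "(X, Y, f) \<in> Arr C \<Longrightarrow> zigzag C W X Y [Fwd X Y f]"
  by (auto intro!: zigzag.intros simp: Arr_def)

lemma zigzag_Bwd: "(X, Y, f) \<in> W \<inter> Arr C \<Longrightarrow> zigzag C W Y X [Bwd X Y f]"
  by (auto intro!: zigzag.intros simp: Arr_def)

lemma ho_eq_in_context:
  assumes "zigzag C W X' X a" "ho_eq C W X Y p q" "zigzag C W Y Y' b"
    "s = a @ p @ b" "t = a @ q @ b"
  shows "ho_eq C W X' Y' s t"
  using ho_ctxt[OF assms(1-3)] assms(4,5) by simp

lemma ho_iso_Fwd: "(X, Y, f) \<in> W \<inter> Arr C \<Longrightarrow> ho_iso C W X Y [Fwd X Y f]"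
  unfolding ho_iso_def
  by (intro conjI exI[of _ "[Bwd X Y f]"])
     (auto intro: ho_inv1 ho_inv2 zigzag_Fwd zigzag_Bwd)

lemma ho_iso_Bwd: "(X, Y, f) \<in> W \<inter> Arr C \<Longrightarrow> ho_iso C W Y X [Bwd X Y f]"
  unfolding ho_iso_def
  by (intro conjI exI[of _ "[Fwd X Y f]"])
     (auto intro: ho_inv1 ho_inv2 zigzag_Fwd zigzag_Bwd)

lemma ho_iso_append:
  assumes "ho_iso C W X Y p" "ho_iso C W Y Z q"
  shows "ho_iso C W X Z (p @ q)"
proof -
  from assms obtain p' q' where
    p: "zigzag C W X Y p" "zigzag C W Y X p'" "ho_eq C W X X (p @ p') []" "ho_eq C W Y Y (p' @ p) []" and
    q: "zigzag C W Y Z q" "zigzag C W Z Y q'" "ho_eq C W Y Y (q @ q') []" "ho_eq C W Z Z (q' @ q) []"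
    by (auto simp: ho_iso_def)
  have "ho_eq C W X X ((p @ q) @ (q' @ p')) (p @ p')"
    by (rule ho_eq_in_context[OF p(1) q(3) p(2)]) auto
  moreover have "ho_eq C W Z Z ((q' @ p') @ (p @ q)) (q' @ q)"
    by (rule ho_eq_in_context[OF q(2) p(4) q(1)]) auto
  ultimately show ?thesis
    unfolding ho_iso_def using p q
    by (intro conjI exI[of _ "q' @ p'"]) (blast intro: zigzag_append ho_trans)+
qed

text \<open>A natural transformation \<open>\<pi>\<close> to a functor that inverts \<open>q\<close> and \<open>r\<close> exhibits the zigzag
  \<open>X \<leftarrow> Q \<rightarrow> L\<close> as \<open>\<pi>\<^sub>X\<close>, up to the weak equivalences \<open>t\<^sub>q\<close>, \<open>t\<^sub>r\<close> and \<open>\<pi>\<^sub>L\<close>.\<close>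

lemma zigzag_through_natural_transformation:
  assumes C: "category C"
    and q: "(Q, X, q) \<in> W \<inter> Arr C" and r: "(Q, L, r) \<in> Arr C"
    and pX: "(X, TX, pX) \<in> Arr C" and pQ: "(Q, TQ, pQ) \<in> Arr C" and pL: "(L, TL, pL) \<in> W \<inter> Arr C"
    and tq: "(TQ, TX, tq) \<in> W \<inter> Arr C" and tr: "(TQ, TL, tr) \<in> W \<inter> Arr C"
    and sq: "Cmp C Q X TX pX q = Cmp C Q TQ TX tq pQ"
    and sr: "Cmp C Q L TL pL r = Cmp C Q TQ TL tr pQ"
  shows "ho_iso C W TX L [Bwd TQ TX tq, Fwd TQ TL tr, Bwd L TL pL]"
    and "ho_eq C W X L [Fwd X TX pX, Bwd TQ TX tq, Fwd TQ TL tr, Bwd L TL pL] [Bwd Q X q, Fwd Q L r]"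
proof -
  show "ho_iso C W TX L [Bwd TQ TX tq, Fwd TQ TL tr, Bwd L TL pL]"
    using ho_iso_append[OF ho_iso_Bwd[OF tq] ho_iso_append[OF ho_iso_Fwd[OF tr] ho_iso_Bwd[OF pL]]]
    by simp
  have ob: "X \<in> Ob C" "Q \<in> Ob C" "L \<in> Ob C" "TX \<in> Ob C" "TQ \<in> Ob C" "TL \<in> Ob C"
    using assms by (auto simp: Arr_def)
  note ho_trans [trans]
  have zq: "zigzag C W X Q [Bwd Q X q]" using zigzag_Bwd[OF q] .
  have z1: "zigzag C W TX L [Bwd TQ TX tq, Fwd TQ TL tr, Bwd L TL pL]"
    using pL tr tq ob by (auto intro!: zigzag.intros)
  have z1': "zigzag C W X L [Fwd X TX pX, Bwd TQ TX tq, Fwd TQ TL tr, Bwd L TL pL]"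
    using z1 pX by (auto intro!: zigzag.intros)
  have z2: "zigzag C W TQ L [Fwd TQ TL tr, Bwd L TL pL]"
    using pL tr ob by (auto intro!: zigzag.intros)
  have z3: "zigzag C W X TQ [Bwd Q X q, Fwd Q TQ pQ]"
    using zq q pQ ob by (auto intro!: zigzag.intros)
  have z4: "zigzag C W TL L [Bwd L TL pL]" using zigzag_Bwd[OF pL] .
  have z5: "zigzag C W X L [Bwd Q X q, Fwd Q L r]" using q r ob by (auto intro!: zigzag.intros)
  have zL: "zigzag C W L L []" "zigzag C W X X []" using ob by (auto intro: zz_nil)
  have a: "(Q, X, q) \<in> Arr C" "(TQ, TX, tq) \<in> Arr C" "(TQ, TL, tr) \<in> Arr C" "(L, TL, pL) \<in> Arr C"
    using q tq tr pL by auto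
  have "ho_eq C W X L [Fwd X TX pX, Bwd TQ TX tq, Fwd TQ TL tr, Bwd L TL pL]
      [Bwd Q X q, Fwd Q X q, Fwd X TX pX, Bwd TQ TX tq, Fwd TQ TL tr, Bwd L TL pL]"
    by (rule ho_eq_in_context[OF zL(2) ho_sym[OF ho_inv2[OF q]] z1']) auto
  also have "ho_eq C W X L \<dots>
      [Bwd Q X q, Fwd Q TX (Cmp C Q X TX pX q), Bwd TQ TX tq, Fwd TQ TL tr, Bwd L TL pL]"
    by (rule ho_eq_in_context[OF zq ho_comp[OF a(1) pX] z1]) auto
  also have "ho_eq C W X L \<dots>
      [Bwd Q X q, Fwd Q TQ pQ, Fwd TQ TX tq, Bwd TQ TX tq, Fwd TQ TL tr, Bwd L TL pL]"
    unfolding sq by (rule ho_eq_in_context[OF zq ho_sym[OF ho_comp[OF pQ a(2)]] z1]) auto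
  also have "ho_eq C W X L \<dots> [Bwd Q X q, Fwd Q TQ pQ, Fwd TQ TL tr, Bwd L TL pL]"
    by (rule ho_eq_in_context[OF z3 ho_inv1[OF tq] z2]) auto
  also have "ho_eq C W X L \<dots> [Bwd Q X q, Fwd Q TL (Cmp C Q TQ TL tr pQ), Bwd L TL pL]"
    by (rule ho_eq_in_context[OF zq ho_comp[OF pQ a(3)] z4]) auto
  also have "ho_eq C W X L \<dots> [Bwd Q X q, Fwd Q L r, Fwd L TL pL, Bwd L TL pL]"
    unfolding sr[symmetric] by (rule ho_eq_in_context[OF zq ho_sym[OF ho_comp[OF r a(4)]] z4]) auto
  also have "ho_eq C W X L \<dots> [Bwd Q X q, Fwd Q L r]"
    by (rule ho_eq_in_context[OF z5 ho_inv1[OF pL] zL(1)]) auto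
  finally show "ho_eq C W X L [Fwd X TX pX, Bwd TQ TX tq, Fwd TQ TL tr, Bwd L TL pL]
      [Bwd Q X q, Fwd Q L r]" .
qed

lemma factorizesD:
  "factorizes C S T \<Longrightarrow> (X, Y, f) \<in> Arr C \<Longrightarrow>
     \<exists>Z i p. (X, Z, i) \<in> S \<and> (Z, Y, p) \<in> T \<and> Cmp C X Z Y p i = f"
  by (auto simp: factorizes_def)

text \<open>The retract argument: factor the map as a cofibration followed by a trivial fibration.  Lifting against
  the cofibration makes it a retract of the trivial fibration.\<close>

lemma rlp_Cof_imp_Weq:
  assumes C: "category C" and M: "model_structure C M"
    and p: "(X, Y, p) \<in> Arr C" and lift: "\<And>i. i \<in> Cof M \<Longrightarrow> has_lift C i (X, Y, p)"
  shows "(X, Y, p) \<in> Weq M"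
proof -
  interpret category C by fact
  from M have fac: "factorizes C (Cof M) (Fib M \<inter> Weq M)" and sub: "Cof M \<subseteq> Arr C" "Fib M \<subseteq> Arr C"
    and ret: "retract_closed C (Weq M)"
    by (auto simp: model_structure_def)
  from factorizesD[OF fac p] obtain Z i p' where i: "(X, Z, i) \<in> Cof M" and p': "(Z, Y, p') \<in> Fib M \<inter> Weq M"
    and e: "Cmp C X Z Y p' i = p"
    by blast
  have ob: "X \<in> Ob C" "Y \<in> Ob C" "Z \<in> Ob C" and h: "i \<in> Hom C X Z" "p' \<in> Hom C Z Y" "p \<in> Hom C X Y"
    using i p' p sub by (auto simp: Arr_def)
  have "\<exists>k \<in> Hom C Z X. Cmp C X Z X k i = Idn C X \<and> Cmp C Z X Y p k = p'"
    using lift[OF i] h ob e Idn_Hom Cmp_Idn_right[OF ob(1,2) h(3)] by (auto simp: has_lift_def)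
  then obtain k where k: "k \<in> Hom C Z X" "Cmp C X Z X k i = Idn C X" "Cmp C Z X Y p k = p'" by auto
  have "Cmp C Y Y Y (Idn C Y) (Idn C Y) = Idn C Y" using Idn_Hom Cmp_Idn_left ob by blast
  then show ?thesis
    using ret[unfolded retract_closed_def, rule_format, OF h(1) k(1) Idn_Hom[OF ob(2)] Idn_Hom[OF ob(2)],
      of p p'] p p' k e Cmp_Idn_left[OF ob(1,2) h(3)] Cmp_Idn_left[OF ob(3,2) h(2)] by auto
qed

text \<open>The dual retract argument: the map is a retract of a trivial cofibration.\<close>

lemma llp_Fib_imp_Weq:
  assumes C: "category C" and M: "model_structure C M"
    and i: "(A, B, i) \<in> Arr C" and lift: "\<And>p. p \<in> Fib M \<Longrightarrow> has_lift C (A, B, i) p"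
  shows "(A, B, i) \<in> Weq M"
proof -
  interpret category C by fact
  from M have fac: "factorizes C (Cof M \<inter> Weq M) (Fib M)" and sub: "Cof M \<subseteq> Arr C" "Fib M \<subseteq> Arr C"
    and ret: "retract_closed C (Weq M)"
    by (auto simp: model_structure_def)
  from factorizesD[OF fac i] obtain Z j p where j: "(A, Z, j) \<in> Cof M \<inter> Weq M" and p: "(Z, B, p) \<in> Fib M"
    and e: "Cmp C A Z B p j = i"
    by blast
  have ob: "A \<in> Ob C" "B \<in> Ob C" "Z \<in> Ob C" and h: "j \<in> Hom C A Z" "p \<in> Hom C Z B" "i \<in> Hom C A B"
    using i p j sub by (auto simp: Arr_def)
  have "\<exists>k \<in> Hom C B Z. Cmp C A B Z k i = j \<and> Cmp C B Z B p k = Idn C B"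
    using lift[OF p] h ob e Idn_Hom Cmp_Idn_left[OF ob(1,2) h(3)] by (auto simp: has_lift_def)
  then obtain k where k: "k \<in> Hom C B Z" "Cmp C A B Z k i = j" "Cmp C B Z B p k = Idn C B" by auto
  have "Cmp C A A A (Idn C A) (Idn C A) = Idn C A" using Idn_Hom Cmp_Idn_left ob by blast
  then show ?thesis
    using ret[unfolded retract_closed_def, rule_format, OF Idn_Hom[OF ob(1)] Idn_Hom[OF ob(1)] k(1) h(2),
      of i j] i j k e Cmp_Idn_right[OF ob(1,2) h(3)] Cmp_Idn_right[OF ob(1,3) h(1)] by auto
qed

lemma Weq_Idn: "category C \<Longrightarrow> model_structure C M \<Longrightarrow> X \<in> Ob C \<Longrightarrow> (X, X, Idn C X) \<in> Weq M"
proof (rule rlp_Cof_imp_Weq)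
  assume C: "category C" and M: "model_structure C M" and X: "X \<in> Ob C"
  interpret category C by fact
  show "(X, X, Idn C X) \<in> Arr C" using X Idn_Hom by (simp add: Arr_def)
  fix i assume "i \<in> Cof M"
  moreover obtain A B j where ij: "i = (A, B, j)" by (cases i)
  ultimately have j: "A \<in> Ob C" "B \<in> Ob C" "j \<in> Hom C A B" using M by (auto simp: model_structure_def Arr_def)
  show "has_lift C i (X, X, Idn C X)"
    unfolding has_lift_def ij prod.case
  proof (intro ballI impI)
    fix u v assume u: "u \<in> Hom C A X" "v \<in> Hom C B X"
      and e: "Cmp C A X X (Idn C X) u = Cmp C A B X v j"
    then show "\<exists>h \<in> Hom C B X. Cmp C A B X h j = u \<and> Cmp C B X X (Idn C X) h = v"
      using Cmp_Idn_left[OF j(1) X u(1)] Cmp_Idn_left[OF j(2) X u(2)] by auto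
  qed
qed

subsection \<open>Homology as an invariant of the homotopy category\<close>

text \<open>Homology inverts quasi-isomorphisms, so every zigzag acts on it; the relations that define equality in
  the homotopy category do not change this action.\<close>

primrec step_homology :: "int \<Rightarrow> (('k, 'a) cx, int \<Rightarrow> 'a \<Rightarrow> 'a) step \<Rightarrow> 'a set \<Rightarrow> 'a set" where
  "step_homology n (Fwd X Y f) = homology_map Y f n"
| "step_homology n (Bwd X Y f) = inv_into (carrier (homology X n)) (homology_map Y f n)"

lemma homology_map_closed:
  assumes "(X, Y, f) \<in> Arr (Ch K g)" "c \<in> carrier (homology X n)"
  shows "homology_map Y f n c \<in> carrier (homology Y n)"
proof -
  have X: "chain_complex K X" "chain_complex K Y" "f \<in> chain_maps K X Y"
    using assms by (auto simp: Arr_def dest: Ch_ObD)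
  from assms(2) obtain x where x: "x \<in> cycles X n" "c = hclass X n x" by (auto simp: carrier_homology)
  then have "homology_map Y f n c = hclass Y n (f n x)"
    using homology_map_hclass[OF X, of x n] by (simp add: cycles_def)
  then show ?thesis using chain_maps_cycles[OF X(3,1,2) x(1)] by (auto simp: carrier_homology)
qed

lemma quasi_isos_bij:
  "(X, Y, f) \<in> quasi_isos K g \<Longrightarrow>
     bij_betw (homology_map Y f n) (carrier (homology X n)) (carrier (homology Y n))"
  by (auto simp: quasi_isos_def iso_def)

lemma zigzag_homology_closed:
  "zigzag (Ch K g) (quasi_isos K g) X Y p \<Longrightarrow> c \<in> carrier (homology X n) \<Longrightarrow>
     fold (step_homology n) p c \<in> carrier (homology Y n)"
proof (induction arbitrary: c rule: zigzag.induct)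
  case (zz_fwd X Y f Z p)
  then show ?case using homology_map_closed[OF zz_fwd(1)] by simp
next
  case (zz_bwd Y X w Z p)
  then have "inv_into (carrier (homology Y n)) (homology_map X w n) c \<in> carrier (homology Y n)"
    using quasi_isos_bij[of Y X w K g n] by (auto simp: bij_betw_def intro!: inv_into_into)
  then show ?case using zz_bwd by simp
qed simp

lemma ho_eq_homology:
  "ho_eq (Ch K g) (quasi_isos K g) X Y p q \<Longrightarrow> c \<in> carrier (homology X n) \<Longrightarrow>
     fold (step_homology n) p c = fold (step_homology n) q c"
proof (induction arbitrary: c rule: ho_eq.induct)
  case (ho_ctxt X' X a Y p q Y' b)
  then show ?case using zigzag_homology_closed[OF ho_ctxt(1)] by simp
next
  case (ho_id X)
  then obtain x where x: "x \<in> cycles X n" "c = hclass X n x" by (auto simp: carrier_homology)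
  have X: "chain_complex K X" using ho_id by (auto dest: Ch_ObD)
  then show ?case using homology_map_hclass[OF X X chain_maps_id[OF X], of x n g] x
    by (simp add: cycles_def)
next
  case (ho_comp X Y f Z f')
  then obtain x where x: "x \<in> cycles X n" "c = hclass X n x" by (auto simp: carrier_homology)
  have X: "chain_complex K X" "chain_complex K Y" "chain_complex K Z" "f \<in> chain_maps K X Y"
      "f' \<in> chain_maps K Y Z"
    using ho_comp by (auto simp: Arr_def dest: Ch_ObD)
  have x': "x \<in> carrier (Md X n)" using x by (simp add: cycles_def)
  then show ?case
    using homology_map_hclass[OF X(1,2,4) x'] homology_map_hclass[OF X(2,3,5) chain_maps_closed[OF X(4) x']]
      homology_map_hclass[OF X(1,3) chain_maps_comp[OF X(4,5,1)] x'] x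
    by simp
next
  case (ho_inv1 X Y w)
  then have "bij_betw (homology_map Y w n) (carrier (homology X n)) (carrier (homology Y n))"
    using quasi_isos_bij by blast
  then show ?case using ho_inv1 by (simp add: bij_betw_def)
next
  case (ho_inv2 X Y w)
  then have "bij_betw (homology_map Y w n) (carrier (homology X n)) (carrier (homology Y n))"
    using quasi_isos_bij by blast
  then show ?case using ho_inv2 by (simp add: bij_betw_def f_inv_into_f)
qed simp_all

lemma homology_trivial_iff:
  assumes X: "chain_complex K X"
  shows "cycles X n \<subseteq> boundaries X n \<longleftrightarrow> (\<exists>c. carrier (homology X n) \<subseteq> {c})"
proof
  interpret module K "Md X n" using X by (rule chain_complex_module)
  have z: "\<zero>\<^bsub>Md X n\<^esub> \<in> cycles X n" using zero_boundary[OF X] boundaries_subset_cycles[OF X] by blast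
  {
    assume "\<exists>c. carrier (homology X n) \<subseteq> {c}"
    then have "hclass X n x = hclass X n \<zero>\<^bsub>Md X n\<^esub>" if "x \<in> cycles X n" for x
      using that z unfolding carrier_homology by blast
    then show "cycles X n \<subseteq> boundaries X n"
      using hclass_eq_iff[OF X, of _ n "\<zero>\<^bsub>Md X n\<^esub>"] boundaries_subset[OF X, of n]
      by (fastforce simp: cycles_def)
  }
  assume B: "cycles X n \<subseteq> boundaries X n"
  have "hclass X n x = hclass X n \<zero>\<^bsub>Md X n\<^esub>" if "x \<in> cycles X n" for x
    using hclass_eq_iff[OF X, of x n "\<zero>\<^bsub>Md X n\<^esub>"] that B by (force simp: cycles_def)
  then show "\<exists>c. carrier (homology X n) \<subseteq> {c}" unfolding carrier_homology by blast
qed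

lemma ho_iso_homology_trivial:
  assumes p: "ho_iso (Ch K g) (quasi_isos K g) X Y p"
    and X: "chain_complex K X" "cycles X n \<subseteq> boundaries X n" and Y: "chain_complex K Y"
  shows "cycles Y n \<subseteq> boundaries Y n"
proof -
  from p obtain p' where p': "zigzag (Ch K g) (quasi_isos K g) Y X p'"
    "ho_eq (Ch K g) (quasi_isos K g) Y Y (p' @ p) []" by (auto simp: ho_iso_def)
  obtain c where c: "carrier (homology X n) \<subseteq> {c}" using X(2) homology_trivial_iff[OF X(1), of n] by auto
  have "d = fold (step_homology n) p c" if d: "d \<in> carrier (homology Y n)" for d
  proof -
    have "fold (step_homology n) p' d = c" using zigzag_homology_closed[OF p'(1) d] c by blast
    then show ?thesis using ho_eq_homology[OF p'(2) d] by simp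
  qed
  then show ?thesis unfolding homology_trivial_iff[OF Y] by blast
qed

section \<open>Linear functionals, spheres and discs\<close>

definition subspace :: "'k ring \<Rightarrow> ('k, 'a) module \<Rightarrow> 'a set \<Rightarrow> bool" where
  "subspace K M H \<longleftrightarrow> H \<subseteq> carrier M \<and> \<zero>\<^bsub>M\<^esub> \<in> H \<and> (\<forall>x \<in> H. \<forall>y \<in> H. x \<oplus>\<^bsub>M\<^esub> y \<in> H) \<and>
     (\<forall>a \<in> carrier K. \<forall>x \<in> H. a \<odot>\<^bsub>M\<^esub> x \<in> H)"

lemma subspace_minus:
  assumes "module K M" "subspace K M H" "x \<in> H" "y \<in> H"
  shows "x \<ominus>\<^bsub>M\<^esub> y \<in> H"
proof -
  interpret M: module K M by fact
  have "\<ominus>\<^bsub>M\<^esub> y = (\<ominus>\<^bsub>K\<^esub> \<one>\<^bsub>K\<^esub>) \<odot>\<^bsub>M\<^esub> y" using assms M.smult_l_minus[of "\<one>\<^bsub>K\<^esub>" y] by (auto simp: subspace_def)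
  then show ?thesis using assms by (auto simp: subspace_def M.minus_eq)
qed

lemma field_smult_cancel:
  assumes "field K" "module K M" "subspace K M H" "a \<in> carrier K" "a \<noteq> \<zero>\<^bsub>K\<^esub>" "x \<in> carrier M"
    "a \<odot>\<^bsub>M\<^esub> x \<in> H"
  shows "x \<in> H"
proof -
  interpret K: field K by fact
  interpret M: module K M by fact
  have u: "a \<in> Units K" using assms K.field_Units by auto
  have "inv\<^bsub>K\<^esub> a \<odot>\<^bsub>M\<^esub> (a \<odot>\<^bsub>M\<^esub> x) \<in> H" using assms u by (auto simp: subspace_def)
  then show ?thesis using assms u M.smult_assoc1[of "inv\<^bsub>K\<^esub> a" a x] by simp
qed

text \<open>The projection of \<open>M = H \<oplus> Kz\<close> to the line \<open>Kz\<close>, followed by \<open>z \<mapsto> w\<close>.\<close>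

lemma linmap_along_complement:
  assumes K: "field K" and M: "module K M" and H: "subspace K M H" and z: "z \<in> carrier M" "z \<notin> H"
    and span: "\<And>x. x \<in> carrier M \<Longrightarrow> \<exists>a \<in> carrier K. \<exists>h \<in> H. x = h \<oplus>\<^bsub>M\<^esub> a \<odot>\<^bsub>M\<^esub> z"
    and L: "module K L" and w: "w \<in> carrier L"
  shows "\<exists>\<phi> \<in> linmaps K M L. (\<forall>h \<in> H. \<phi> h = \<zero>\<^bsub>L\<^esub>) \<and> \<phi> z = w"
proof -
  interpret K: field K by fact
  interpret M: module K M by fact
  interpret L: module K L by fact
  have HM: "h \<in> carrier M" if "h \<in> H" for h using H that by (auto simp: subspace_def)
  define c where "c x = (SOME a. a \<in> carrier K \<and> (\<exists>h \<in> H. x = h \<oplus>\<^bsub>M\<^esub> a \<odot>\<^bsub>M\<^esub> z))" for x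
  have c: "c x \<in> carrier K \<and> (\<exists>h \<in> H. x = h \<oplus>\<^bsub>M\<^esub> c x \<odot>\<^bsub>M\<^esub> z)" if "x \<in> carrier M" for x
    unfolding c_def by (rule someI_ex) (use span[OF that] in blast)
  have uniq: "a = b" if a: "a \<in> carrier K" and b: "b \<in> carrier K" and h: "h \<in> H" "h' \<in> H"
    and e: "h \<oplus>\<^bsub>M\<^esub> a \<odot>\<^bsub>M\<^esub> z = h' \<oplus>\<^bsub>M\<^esub> b \<odot>\<^bsub>M\<^esub> z" for a b h h'
  proof (rule ccontr)
    assume "a \<noteq> b"
    then have ne: "a \<ominus>\<^bsub>K\<^esub> b \<noteq> \<zero>\<^bsub>K\<^esub>" using a b K.minus_equality[of a "\<ominus>\<^bsub>K\<^esub> b"] by (auto simp: K.minus_eq)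
    have cl: "a \<odot>\<^bsub>M\<^esub> z \<in> carrier M" "b \<odot>\<^bsub>M\<^esub> z \<in> carrier M" using a b z by auto
    have "a \<odot>\<^bsub>M\<^esub> z = \<ominus>\<^bsub>M\<^esub> h \<oplus>\<^bsub>M\<^esub> (h \<oplus>\<^bsub>M\<^esub> a \<odot>\<^bsub>M\<^esub> z)"
      using cl HM[OF h(1)] M.r_neg1 by simp
    also have "\<dots> = \<ominus>\<^bsub>M\<^esub> h \<oplus>\<^bsub>M\<^esub> (h' \<oplus>\<^bsub>M\<^esub> b \<odot>\<^bsub>M\<^esub> z)" using e by simp
    also have "\<dots> = (h' \<ominus>\<^bsub>M\<^esub> h) \<oplus>\<^bsub>M\<^esub> b \<odot>\<^bsub>M\<^esub> z"
      using cl HM[OF h(1)] HM[OF h(2)] by (simp add: M.minus_eq M.a_ac)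
    finally have "a \<odot>\<^bsub>M\<^esub> z \<ominus>\<^bsub>M\<^esub> b \<odot>\<^bsub>M\<^esub> z = (h' \<ominus>\<^bsub>M\<^esub> h)"
      using cl HM[OF h(1)] HM[OF h(2)] by (simp add: M.minus_eq M.a_assoc M.r_neg)
    moreover have "(a \<ominus>\<^bsub>K\<^esub> b) \<odot>\<^bsub>M\<^esub> z = a \<odot>\<^bsub>M\<^esub> z \<ominus>\<^bsub>M\<^esub> b \<odot>\<^bsub>M\<^esub> z"
      using a b z by (simp add: K.minus_eq M.minus_eq M.smult_l_distr M.smult_l_minus)
    ultimately have "(a \<ominus>\<^bsub>K\<^esub> b) \<odot>\<^bsub>M\<^esub> z \<in> H" using subspace_minus[OF M H h(2,1)] by simp
    then show False using field_smult_cancel[OF K M H _ ne z(1)] a b z by simp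
  qed
  have ceq: "c x = a" if "a \<in> carrier K" "h \<in> H" "x = h \<oplus>\<^bsub>M\<^esub> a \<odot>\<^bsub>M\<^esub> z" for x a h
  proof -
    have "x \<in> carrier M" using that z HM by simp
    from c[OF this] obtain h' where "c x \<in> carrier K" "h' \<in> H" "x = h' \<oplus>\<^bsub>M\<^esub> c x \<odot>\<^bsub>M\<^esub> z" by blast
    then show ?thesis using uniq that by metis
  qed
  have cadd: "c (x \<oplus>\<^bsub>M\<^esub> y) = c x \<oplus>\<^bsub>K\<^esub> c y" if xy: "x \<in> carrier M" "y \<in> carrier M" for x y
  proof -
    from c xy obtain h h' where h: "c x \<in> carrier K" "h \<in> H" "x = h \<oplus>\<^bsub>M\<^esub> c x \<odot>\<^bsub>M\<^esub> z"
      "c y \<in> carrier K" "h' \<in> H" "y = h' \<oplus>\<^bsub>M\<^esub> c y \<odot>\<^bsub>M\<^esub> z" by metis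
    have "x \<oplus>\<^bsub>M\<^esub> y = (h \<oplus>\<^bsub>M\<^esub> c x \<odot>\<^bsub>M\<^esub> z) \<oplus>\<^bsub>M\<^esub> (h' \<oplus>\<^bsub>M\<^esub> c y \<odot>\<^bsub>M\<^esub> z)" using h by simp
    also have "\<dots> = (h \<oplus>\<^bsub>M\<^esub> h') \<oplus>\<^bsub>M\<^esub> (c x \<oplus>\<^bsub>K\<^esub> c y) \<odot>\<^bsub>M\<^esub> z"
      using h(1,2,4,5) HM z by (simp add: M.smult_l_distr M.a_ac)
    finally show ?thesis using h H by (intro ceq[of _ "h \<oplus>\<^bsub>M\<^esub> h'"]) (auto simp: subspace_def)
  qed
  have csmult: "c (b \<odot>\<^bsub>M\<^esub> x) = b \<otimes>\<^bsub>K\<^esub> c x" if xy: "x \<in> carrier M" "b \<in> carrier K" for x b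
  proof -
    from c xy obtain h where h: "c x \<in> carrier K" "h \<in> H" "x = h \<oplus>\<^bsub>M\<^esub> c x \<odot>\<^bsub>M\<^esub> z" by metis
    have "b \<odot>\<^bsub>M\<^esub> x = b \<odot>\<^bsub>M\<^esub> (h \<oplus>\<^bsub>M\<^esub> c x \<odot>\<^bsub>M\<^esub> z)" using h by simp
    also have "\<dots> = (b \<odot>\<^bsub>M\<^esub> h) \<oplus>\<^bsub>M\<^esub> (b \<otimes>\<^bsub>K\<^esub> c x) \<odot>\<^bsub>M\<^esub> z"
      using h(1,2) HM z xy by (simp add: M.smult_r_distr M.smult_assoc1)
    finally show ?thesis using h H xy by (intro ceq[of _ "b \<odot>\<^bsub>M\<^esub> h"]) (auto simp: subspace_def)
  qed
  have ck: "c x \<in> carrier K" if "x \<in> carrier M" for x using c that by blast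
  have "(\<lambda>x \<in> carrier M. c x \<odot>\<^bsub>L\<^esub> w) \<in> linmaps K M L"
    using ck w by (auto simp: linmaps_def cadd csmult L.smult_l_distr L.smult_assoc1)
  moreover have "c h = \<zero>\<^bsub>K\<^esub>" if "h \<in> H" for h
    using that HM z by (intro ceq[of _ h]) (auto simp: M.smult_l_null)
  moreover have "c z = \<one>\<^bsub>K\<^esub>"
    using z H by (intro ceq[of _ "\<zero>\<^bsub>M\<^esub>"]) (auto simp: subspace_def)
  ultimately show ?thesis
    using HM z w by (intro bexI[of _ "\<lambda>x \<in> carrier M. c x \<odot>\<^bsub>L\<^esub> w"]) (auto simp: L.smult_l_null)
qed

text \<open>A subspace that is maximal among those that avoid \<open>z\<close> is a complement of the line \<open>Kz\<close>.\<close>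

lemma linear_functional_exists:
  assumes K: "field K" and M: "module K M" and N: "subspace K M N" and z: "z \<in> carrier M" "z \<notin> N"
    and L: "module K L" and w: "w \<in> carrier L"
  shows "\<exists>\<phi> \<in> linmaps K M L. (\<forall>h \<in> N. \<phi> h = \<zero>\<^bsub>L\<^esub>) \<and> \<phi> z = w"
proof -
  interpret K: field K by fact
  interpret M: module K M by fact
  define \<A> where "\<A> = {H. subspace K M H \<and> N \<subseteq> H \<and> z \<notin> H}"
  have "\<exists>H \<in> \<A>. \<forall>X \<in> \<A>. H \<subseteq> X \<longrightarrow> X = H"
  proof (rule subset_Zorn_nonempty)
    show "\<A> \<noteq> {}" using N z by (auto simp: \<A>_def)
    fix \<C> assume ne: "\<C> \<noteq> {}" and ch: "subset.chain \<A> \<C>"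
    have sub: "subspace K M H" if "H \<in> \<C>" for H using ch that by (auto simp: subset.chain_def \<A>_def)
    have "x \<oplus>\<^bsub>M\<^esub> y \<in> \<Union>\<C>" if xy: "x \<in> \<Union>\<C>" "y \<in> \<Union>\<C>" for x y
    proof -
      from xy obtain X Y where X: "X \<in> \<C>" "x \<in> X" "Y \<in> \<C>" "y \<in> Y" by auto
      then have "X \<subseteq> Y \<or> Y \<subseteq> X" using ch by (auto simp: subset_chain_def)
      then show ?thesis
      proof
        assume "X \<subseteq> Y"
        then have "x \<oplus>\<^bsub>M\<^esub> y \<in> Y" using X sub[OF X(3)] by (auto simp: subspace_def)
        then show ?thesis using X by blast
      next
        assume "Y \<subseteq> X"
        then have "x \<oplus>\<^bsub>M\<^esub> y \<in> X" using X sub[OF X(1)] by (auto simp: subspace_def)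
        then show ?thesis using X by blast
      qed
    qed
    moreover have "a \<odot>\<^bsub>M\<^esub> x \<in> \<Union>\<C>" if "a \<in> carrier K" "x \<in> \<Union>\<C>" for a x
      using that sub by (fastforce simp: subspace_def)
    moreover have "\<Union>\<C> \<subseteq> carrier M" using sub by (intro Union_least) (simp add: subspace_def)
    moreover have "\<zero>\<^bsub>M\<^esub> \<in> \<Union>\<C>" using ne sub by (auto simp: subspace_def)
    ultimately have "subspace K M (\<Union>\<C>)" by (simp add: subspace_def)
    moreover have "N \<subseteq> H" "z \<notin> H" if "H \<in> \<C>" for H using ch that by (auto simp: subset.chain_def \<A>_def)
    then have "N \<subseteq> \<Union>\<C>" "z \<notin> \<Union>\<C>" using ne by blast+
    ultimately show "\<Union>\<C> \<in> \<A>" by (simp add: \<A>_def)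
  qed
  then obtain H where H: "subspace K M H" "N \<subseteq> H" "z \<notin> H"
    and max: "\<And>X. subspace K M X \<Longrightarrow> H \<subseteq> X \<Longrightarrow> z \<notin> X \<Longrightarrow> X = H"
    by (auto simp: \<A>_def)
  have HM: "h \<in> carrier M" if "h \<in> H" for h using H that by (auto simp: subspace_def)
  have span: "\<exists>a \<in> carrier K. \<exists>h \<in> H. x = h \<oplus>\<^bsub>M\<^esub> a \<odot>\<^bsub>M\<^esub> z" if x: "x \<in> carrier M" for x
  proof (cases "x \<in> H")
    case True
    then show ?thesis using x z by (intro bexI[of _ "\<zero>\<^bsub>K\<^esub>"] bexI[of _ x]) (auto simp: M.smult_l_null)
  next
    case False
    define X where "X = {h \<oplus>\<^bsub>M\<^esub> b \<odot>\<^bsub>M\<^esub> x | h b. h \<in> H \<and> b \<in> carrier K}"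
    have X: "subspace K M X"
      unfolding subspace_def
    proof (intro conjI ballI)
      show "X \<subseteq> carrier M" using x HM by (auto simp: X_def)
      show "\<zero>\<^bsub>M\<^esub> \<in> X"
        using H x by (auto simp: X_def subspace_def M.smult_l_null intro!: exI[of _ "\<zero>\<^bsub>M\<^esub>"] exI[of _ "\<zero>\<^bsub>K\<^esub>"])
      fix u assume "u \<in> X"
      then obtain h b where u: "h \<in> H" "b \<in> carrier K" "u = h \<oplus>\<^bsub>M\<^esub> b \<odot>\<^bsub>M\<^esub> x" by (auto simp: X_def)
      {
        fix v assume "v \<in> X"
        then obtain h' b' where v: "h' \<in> H" "b' \<in> carrier K" "v = h' \<oplus>\<^bsub>M\<^esub> b' \<odot>\<^bsub>M\<^esub> x" by (auto simp: X_def)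
        have "u \<oplus>\<^bsub>M\<^esub> v = (h \<oplus>\<^bsub>M\<^esub> h') \<oplus>\<^bsub>M\<^esub> (b \<oplus>\<^bsub>K\<^esub> b') \<odot>\<^bsub>M\<^esub> x"
          using u v x HM by (simp add: M.smult_l_distr M.a_ac)
        moreover have "h \<oplus>\<^bsub>M\<^esub> h' \<in> H" using H u v by (auto simp: subspace_def)
        ultimately show "u \<oplus>\<^bsub>M\<^esub> v \<in> X" using u v unfolding X_def by blast
      }
      fix a assume a: "a \<in> carrier K"
      have "a \<odot>\<^bsub>M\<^esub> u = (a \<odot>\<^bsub>M\<^esub> h) \<oplus>\<^bsub>M\<^esub> (a \<otimes>\<^bsub>K\<^esub> b) \<odot>\<^bsub>M\<^esub> x"
        using u x a HM by (simp add: M.smult_r_distr M.smult_assoc1)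
      moreover have "a \<odot>\<^bsub>M\<^esub> h \<in> H" using H u a by (auto simp: subspace_def)
      ultimately show "a \<odot>\<^bsub>M\<^esub> u \<in> X" using u a unfolding X_def by blast
    qed
    have "h \<in> X" if "h \<in> H" for h
      using that HM x by (auto simp: X_def M.smult_l_null intro!: exI[of _ h] exI[of _ "\<zero>\<^bsub>K\<^esub>"])
    moreover have "x \<in> X"
      using H x by (auto simp: X_def subspace_def intro!: exI[of _ "\<zero>\<^bsub>M\<^esub>"] exI[of _ "\<one>\<^bsub>K\<^esub>"])
    ultimately have "z \<in> X" using max[OF X] False by blast
    then obtain h b where hb: "h \<in> H" "b \<in> carrier K" "z = h \<oplus>\<^bsub>M\<^esub> b \<odot>\<^bsub>M\<^esub> x" by (auto simp: X_def)
    have "b \<noteq> \<zero>\<^bsub>K\<^esub>" using hb H HM x by (auto simp: M.smult_l_null)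
    then have u: "b \<in> Units K" using hb K.field_Units by auto
    have i: "inv\<^bsub>K\<^esub> b \<in> carrier K" using u by simp
    have "\<ominus>\<^bsub>M\<^esub> (inv\<^bsub>K\<^esub> b \<odot>\<^bsub>M\<^esub> h) \<oplus>\<^bsub>M\<^esub> inv\<^bsub>K\<^esub> b \<odot>\<^bsub>M\<^esub> z =
        \<ominus>\<^bsub>M\<^esub> (inv\<^bsub>K\<^esub> b \<odot>\<^bsub>M\<^esub> h) \<oplus>\<^bsub>M\<^esub> (inv\<^bsub>K\<^esub> b \<odot>\<^bsub>M\<^esub> h \<oplus>\<^bsub>M\<^esub> (inv\<^bsub>K\<^esub> b \<otimes>\<^bsub>K\<^esub> b) \<odot>\<^bsub>M\<^esub> x)"
      using hb i x HM by (simp add: M.smult_r_distr M.smult_assoc1)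
    also have "\<dots> = x" using hb i u x HM by (simp add: M.r_neg1)
    finally have e: "x = \<ominus>\<^bsub>M\<^esub> (inv\<^bsub>K\<^esub> b \<odot>\<^bsub>M\<^esub> h) \<oplus>\<^bsub>M\<^esub> inv\<^bsub>K\<^esub> b \<odot>\<^bsub>M\<^esub> z" by simp
    have "\<zero>\<^bsub>M\<^esub> \<in> H" "inv\<^bsub>K\<^esub> b \<odot>\<^bsub>M\<^esub> h \<in> H" using H(1) hb(1) i by (auto simp: subspace_def)
    then have "\<ominus>\<^bsub>M\<^esub> (inv\<^bsub>K\<^esub> b \<odot>\<^bsub>M\<^esub> h) \<in> H"
      using subspace_minus[OF M H(1), of "\<zero>\<^bsub>M\<^esub>"] HM by (fastforce simp: M.minus_eq)
    then show ?thesis using e i by blast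
  qed
  show ?thesis using linmap_along_complement[OF K M H(1) z(1) H(3) span L w] H(2) by blast
qed

text \<open>A one-dimensional space with a chosen generator.  All test objects are built from such a line, and the
  line is spanned by an element of a given complex: the type of elements is the universe, and nothing
  larger than the given complexes is known to exist in it.\<close>

locale vector_line =
  fixes K :: "'k ring" and V :: "('k, 'a) module" and e :: 'a
  assumes field: "field K" and V: "module K V" and e: "e \<in> carrier V" "e \<noteq> \<zero>\<^bsub>V\<^esub>"
    and span: "v \<in> carrier V \<Longrightarrow> \<exists>a \<in> carrier K. v = a \<odot>\<^bsub>V\<^esub> e"
begin

sublocale K: field K by (rule field)
sublocale V: module K V by (rule V)

lemma linmap_exists: "module K M \<Longrightarrow> w \<in> carrier M \<Longrightarrow> \<exists>\<phi> \<in> linmaps K V M. \<phi> e = w"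
  using linmap_along_complement[OF field V _ e(1), of "{\<zero>\<^bsub>V\<^esub>}" M w] e span
  by (fastforce simp: subspace_def)

lemma linmap_eqI:
  "f \<in> linmaps K V M \<Longrightarrow> f' \<in> linmaps K V M \<Longrightarrow> f e = f' e \<Longrightarrow> f = f'"
  by (rule linmaps_eqI, assumption+) (metis e(1) linmaps_smult span)

text \<open>The complex with \<open>V\<close> in the degrees in \<open>D\<close> and as many identities as differentials as possible:
  the zero complex for \<open>D = {}\<close>, the sphere \<open>S\<^sup>n\<close> for \<open>D = {n}\<close>, the disc \<open>D\<^sup>n\<^sup>+\<^sup>1\<close> for \<open>D = {n, n + 1}\<close>.\<close>

definition strand :: "int set \<Rightarrow> ('k, 'a) cx" where
  "strand D = \<lparr>Md = (\<lambda>j. if j \<in> D then V else V\<lparr>carrier := {\<zero>\<^bsub>V\<^esub>}\<rparr>),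
     Df = (\<lambda>j. \<lambda>x \<in> (if j \<in> D then carrier V else {\<zero>\<^bsub>V\<^esub>}). if j \<in> D \<and> j - 1 \<in> D then x else \<zero>\<^bsub>V\<^esub>)\<rparr>"

text \<open>No two identities are composable, so that the differential squares to zero.\<close>

definition thin :: "int set \<Rightarrow> bool" where
  "thin D \<longleftrightarrow> (\<forall>j. \<not> (j \<in> D \<and> j - 1 \<in> D \<and> j - 2 \<in> D))"

lemma thin [simp]: "thin {}" "thin {n}" "thin {n, n + 1}"
  by (auto simp: thin_def)

lemma Md_strand: "Md (strand D) j = (if j \<in> D then V else V\<lparr>carrier := {\<zero>\<^bsub>V\<^esub>}\<rparr>)"
  by (simp add: strand_def)

lemma carrier_strand: "carrier (Md (strand D) j) = (if j \<in> D then carrier V else {\<zero>\<^bsub>V\<^esub>})"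
  by (simp add: strand_def)

lemma zero_strand [simp]: "\<zero>\<^bsub>Md (strand D) j\<^esub> = \<zero>\<^bsub>V\<^esub>"
  by (simp add: strand_def)

lemma Df_strand: "x \<in> carrier (Md (strand D) j) \<Longrightarrow>
    Df (strand D) j x = (if j \<in> D \<and> j - 1 \<in> D then x else \<zero>\<^bsub>V\<^esub>)"
  by (auto simp: strand_def split: if_splits)

lemma strand_complex: "thin D \<Longrightarrow> chain_complex K (strand D)"
  unfolding chain_complex_def
proof (intro allI conjI ballI)
  fix j assume D: "thin D"
  show "module K (Md (strand D) j)" using V zero_module[OF V] by (simp add: Md_strand)
  show "Df (strand D) j \<in> linmaps K (Md (strand D) j) (Md (strand D) (j - 1))"
    by (auto simp: linmaps_def strand_def)
  fix x assume "x \<in> carrier (Md (strand D) j)"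
  then show "Df (strand D) (j - 1) (Df (strand D) j x) = \<zero>\<^bsub>Md (strand D) (j - 2)\<^esub>"
    using D by (auto simp: strand_def thin_def)
qed

lemma strand_Ob: "thin D \<Longrightarrow> (g = NonNeg \<Longrightarrow> D \<subseteq> {0..}) \<Longrightarrow> strand D \<in> Ob (Ch K g)"
  using strand_complex[of D] by (force simp: Ch_def carrier_strand)

lemma sphere_nonneg: "strand {n} \<in> Ob (Ch K NonNeg) \<Longrightarrow> n \<ge> 0"
  using Ch_Ob_neg[of "strand {n}" K n] e by (auto simp: carrier_strand not_le[symmetric])

lemma from_strand_exists:
  assumes X: "chain_complex K X" and D: "thin D"
    and w: "\<And>j. j \<in> D \<Longrightarrow> w j \<in> carrier (Md X j)"
    and dw: "\<And>j. j \<in> D \<Longrightarrow> Df X j (w j) = (if j - 1 \<in> D then w (j - 1) else \<zero>\<^bsub>Md X (j - 1)\<^esub>)"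
  shows "\<exists>f \<in> chain_maps K (strand D) X. \<forall>j \<in> D. f j e = w j"
proof -
  have "\<exists>\<phi>. \<phi> \<in> linmaps K (Md (strand D) j) (Md X j) \<and> (j \<in> D \<longrightarrow> \<phi> e = w j)" for j
  proof (cases "j \<in> D")
    case True
    then show ?thesis using linmap_exists[OF chain_complex_module[OF X] w] by (auto simp: Md_strand)
  next
    case False
    then show ?thesis
      using linmaps_const_zero[OF chain_complex_module[OF strand_complex[OF D]] chain_complex_module[OF X], of j]
      by auto
  qed
  then obtain f where f: "\<And>j. f j \<in> linmaps K (Md (strand D) j) (Md X j)" "\<And>j. j \<in> D \<Longrightarrow> f j e = w j"
    by metis
  have fz: "f j \<zero>\<^bsub>V\<^esub> = \<zero>\<^bsub>Md X j\<^esub>" for j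
    using linmaps_zero[OF f(1) chain_complex_module[OF strand_complex[OF D]] chain_complex_module[OF X]] by simp
  have "f (j - 1) (Df (strand D) j x) = Df X j (f j x)" if x: "x \<in> carrier (Md (strand D) j)" for j x
  proof (cases "j \<in> D")
    case True
    then obtain a where a: "a \<in> carrier K" "x = a \<odot>\<^bsub>V\<^esub> e" using x span by (auto simp: carrier_strand)
    have e': "e \<in> carrier (Md (strand D) j)" using True e by (simp add: carrier_strand)
    have fj: "f j x = a \<odot>\<^bsub>Md X j\<^esub> w j"
      using linmaps_smult[OF f(1) a(1), of e j] f(2)[OF True] a e True by (simp add: Md_strand)
    have d: "Df X j (f j x) = a \<odot>\<^bsub>Md X (j - 1)\<^esub> Df X j (w j)"
      unfolding fj using linmaps_smult[OF Df_lin[OF X] a(1) w[OF True]] .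
    show ?thesis
    proof (cases "j - 1 \<in> D")
      case True': True
      have "f (j - 1) x = a \<odot>\<^bsub>Md X (j - 1)\<^esub> w (j - 1)"
        using linmaps_smult[OF f(1) a(1), of e "j - 1"] f(2)[OF True'] a e True' by (simp add: Md_strand)
      then show ?thesis using d dw[OF True] True True' x by (simp add: Df_strand)
    next
      case False
      interpret M: module K "Md X (j - 1)" using X by (rule chain_complex_module)
      show ?thesis using d dw[OF True] False x a by (simp add: Df_strand fz M.smult_r_null)
    qed
  next
    case False
    then show ?thesis using x Df_zero[OF X] by (simp add: carrier_strand Df_strand fz)
  qed
  then have "f \<in> chain_maps K (strand D) X" using f by (simp add: chain_maps_def)
  then show ?thesis using f(2) by blast
qed

lemma to_strand_exists:
  assumes X: "chain_complex K X" and D: "thin D"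
    and \<phi>: "\<And>j. j \<in> D \<Longrightarrow> \<phi> j \<in> linmaps K (Md X j) V"
    and d\<phi>: "\<And>j x. j - 1 \<in> D \<Longrightarrow> x \<in> carrier (Md X j) \<Longrightarrow>
      \<phi> (j - 1) (Df X j x) = (if j \<in> D then \<phi> j x else \<zero>\<^bsub>V\<^esub>)"
  shows "\<exists>f \<in> chain_maps K X (strand D). \<forall>j \<in> D. f j = \<phi> j"
proof -
  define f where "f j = (if j \<in> D then \<phi> j else (\<lambda>x \<in> carrier (Md X j). \<zero>\<^bsub>V\<^esub>))" for j
  have l: "f j \<in> linmaps K (Md X j) (Md (strand D) j)" for j
    using \<phi>[of j] linmaps_const_zero[OF chain_complex_module[OF X] zero_module[OF V], of j]
    by (auto simp: f_def Md_strand)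
  have "f (j - 1) (Df X j x) = Df (strand D) j (f j x)" if x: "x \<in> carrier (Md X j)" for j x
    unfolding Df_strand[OF linmaps_closed[OF l x]]
    using x d\<phi>[of j x] Df_closed[OF X x] by (auto simp: f_def)
  then have "f \<in> chain_maps K X (strand D)" using l by (simp add: chain_maps_def)
  moreover have "\<forall>j \<in> D. f j = \<phi> j" by (simp add: f_def)
  ultimately show ?thesis by blast
qed

lemma from_strand_eqI:
  assumes f: "f \<in> chain_maps K (strand D) X" "f' \<in> chain_maps K (strand D) X"
    and D: "thin D" "chain_complex K X"
    and e': "\<And>j. j \<in> D \<Longrightarrow> f j e = f' j e"
  shows "f = f'"
proof
  fix j
  have l: "f j \<in> linmaps K (Md (strand D) j) (Md X j)" "f' j \<in> linmaps K (Md (strand D) j) (Md X j)"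
    using chain_maps_lin[OF f(1), of j] chain_maps_lin[OF f(2), of j] by auto
  show "f j = f' j"
  proof (cases "j \<in> D")
    case True
    then show ?thesis using linmap_eqI[of "f j" "Md X j" "f' j"] l e' by (simp add: Md_strand)
  next
    case False
    note c = chain_complex_module[OF strand_complex[OF D(1)]] chain_complex_module[OF D(2)]
    show ?thesis
      by (rule linmaps_eqI[OF l]) (use False linmaps_zero[OF l(1) c] linmaps_zero[OF l(2) c] in \<open>simp add: carrier_strand\<close>)
  qed
qed

end

section \<open>The homology of local objects\<close>

lemma has_liftI:
  assumes "\<And>u v. u \<in> Hom C A X \<Longrightarrow> v \<in> Hom C B Y \<Longrightarrow> Cmp C A X Y p u = Cmp C A B Y v i \<Longrightarrow>
    \<exists>h \<in> Hom C B X. Cmp C A B X h i = u \<and> Cmp C B X Y p h = v"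
  shows "has_lift C (A, B, i) (X, Y, p)"
  using assms by (auto simp: has_lift_def)

lemma has_liftD:
  assumes "has_lift C (A, B, i) (X, Y, p)" "u \<in> Hom C A X" "v \<in> Hom C B Y"
    "Cmp C A X Y p u = Cmp C A B Y v i"
  shows "\<exists>h \<in> Hom C B X. Cmp C A B X h i = u \<and> Cmp C B X Y p h = v"
  using assms by (auto simp: has_lift_def)

text \<open>The lifting property of a trivial fibration against \<open>S\<^sup>n \<rightarrow> D\<^sup>n\<^sup>+\<^sup>1\<close>.  Injectivity on homology gives
  some \<open>x\<^sub>0\<close> with \<open>d x\<^sub>0 = w\<close>; then \<open>y - p x\<^sub>0\<close> is a cycle, which surjectivity on homology and in degree \<open>n + 2\<close>
  lifts to a cycle by which \<open>x\<^sub>0\<close> is corrected.\<close>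

lemma trivial_fibration_lift:
  assumes p: "(X, Y, p) \<in> ch_fibrations K g \<inter> quasi_isos K g" and w: "w \<in> cycles X n"
    and y: "y \<in> carrier (Md Y (n + 1))" and e: "p n w = Df Y (n + 1) y" and n: "g = NonNeg \<Longrightarrow> n \<ge> 0"
  shows "\<exists>x \<in> carrier (Md X (n + 1)). Df X (n + 1) x = w \<and> p (n + 1) x = y"
proof -
  have X: "chain_complex K X" and Y: "chain_complex K Y" and pc: "p \<in> chain_maps K X Y"
    and hb: "\<And>n. homology_bij X Y p n"
    using p by (auto simp: quasi_isos_iff Arr_def dest: Ch_ObD)
  interpret X: module K "Md X (n + 1)" using X by (rule chain_complex_module)
  interpret X0: module K "Md X n" using X by (rule chain_complex_module)
  interpret Y: module K "Md Y (n + 1)" using Y by (rule chain_complex_module)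
  interpret Y0: module K "Md Y n" using Y by (rule chain_complex_module)
  note pcl = chain_maps_closed[OF pc]
  note pl = chain_maps_lin[OF pc]
  have Dl: "Df X (n + 1) \<in> linmaps K (Md X (n + 1)) (Md X n)" "Df Y (n + 1) \<in> linmaps K (Md Y (n + 1)) (Md Y n)"
    using Df_lin[OF X, of "n + 1"] Df_lin[OF Y, of "n + 1"] by auto
  have "p n w \<in> boundaries Y n" using e y by (auto simp: boundaries_iff)
  then have "w \<in> boundaries X n" using hb[of n] w by (auto simp: homology_bij_def)
  then obtain x0 where x0: "x0 \<in> carrier (Md X (n + 1))" "w = Df X (n + 1) x0" by (auto simp: boundaries_iff)
  define t where "t = y \<oplus>\<^bsub>Md Y (n + 1)\<^esub> \<ominus>\<^bsub>Md Y (n + 1)\<^esub> p (n + 1) x0"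
  have tc: "t \<in> carrier (Md Y (n + 1))" using y pcl[OF x0(1)] by (simp add: t_def)
  have wc: "p n w \<in> carrier (Md Y n)" using w pcl by (auto simp: cycles_def)
  have "Df Y (n + 1) (p (n + 1) x0) = p n w"
    using chain_maps_Df[OF pc x0(1)] x0 by simp
  then have "Df Y (n + 1) t = \<zero>\<^bsub>Md Y n\<^esub>"
    using y pcl[OF x0(1)] linmaps_add[OF Dl(2)] linmaps_uminus[OF Dl(2) Y.module_axioms Y0.module_axioms] wc e
    by (simp add: t_def Y0.r_neg)
  then have "t \<in> cycles Y (n + 1)" using tc by (simp add: cycles_def)
  then obtain c b where c: "c \<in> cycles X (n + 1)" "b \<in> boundaries Y (n + 1)"
    and tb: "t = b \<oplus>\<^bsub>Md Y (n + 1)\<^esub> p (n + 1) c"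
    using hb[of "n + 1"] by (auto simp: homology_bij_def)
  obtain y2 where y2: "y2 \<in> carrier (Md Y (n + 2))" "b = Df Y (n + 2) y2"
    using c(2)[unfolded boundaries_iff] by (auto simp: add.assoc)
  have "p (n + 2) ` carrier (Md X (n + 2)) = carrier (Md Y (n + 2))"
  proof -
    have "\<forall>m. (g = NonNeg \<longrightarrow> m > 0) \<longrightarrow> p m ` carrier (Md X m) = carrier (Md Y m)"
      using p by (simp add: ch_fibrations_def)
    moreover have "g = NonNeg \<longrightarrow> n + 2 > 0" using n by force
    ultimately show ?thesis by blast
  qed
  then obtain x2 where x2: "x2 \<in> carrier (Md X (n + 2))" "y2 = p (n + 2) x2" using y2 by auto
  have cc: "c \<in> carrier (Md X (n + 1))" "Df X (n + 1) c = \<zero>\<^bsub>Md X n\<^esub>" using c by (auto simp: cycles_def)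
  have deg: "n + 2 - 1 = n + 1" "n + 2 - 2 = n" by simp_all
  have Dx2: "Df X (n + 2) x2 \<in> carrier (Md X (n + 1))" using Df_closed[OF X x2(1)] unfolding deg .
  have DDx2: "Df X (n + 1) (Df X (n + 2) x2) = \<zero>\<^bsub>Md X n\<^esub>" using Df_Df[OF X x2(1)] unfolding deg .
  have pDx2: "p (n + 1) (Df X (n + 2) x2) = b" using chain_maps_Df[OF pc x2(1)] y2 x2 unfolding deg by simp
  define x where "x = x0 \<oplus>\<^bsub>Md X (n + 1)\<^esub> (Df X (n + 2) x2 \<oplus>\<^bsub>Md X (n + 1)\<^esub> c)"
  have "Df X (n + 1) x = w"
    using x0 cc Dx2 DDx2 linmaps_add[OF Dl(1)] w by (simp add: x_def cycles_def)
  moreover have "p (n + 1) x = p (n + 1) x0 \<oplus>\<^bsub>Md Y (n + 1)\<^esub> t"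
    using x0 cc Dx2 linmaps_add[OF pl] by (simp add: x_def pDx2 tb)
  then have "p (n + 1) x = y" using pcl[OF x0(1)] y by (simp add: t_def Y.a_ac Y.r_neg1 Y.r_neg2 Y.r_neg)
  ultimately show ?thesis using x0 cc Dx2 by (intro bexI[of _ x]) (auto simp: x_def)
qed

context vector_line begin

definition incl :: "int set \<Rightarrow> int \<Rightarrow> 'a \<Rightarrow> 'a" where
  "incl D = (\<lambda>j. \<lambda>x \<in> carrier (Md (strand D) j). x)"

definition collapse :: "int set \<Rightarrow> int \<Rightarrow> 'a \<Rightarrow> 'a" where
  "collapse D = (\<lambda>j. \<lambda>x \<in> carrier (Md (strand D) j). \<zero>\<^bsub>V\<^esub>)"

lemma incl_chain_map:
  assumes "thin D" "thin D'" "D \<subseteq> D'" "\<And>j. j \<in> D \<Longrightarrow> j - 1 \<in> D' \<Longrightarrow> j - 1 \<in> D"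
  shows "incl D \<in> chain_maps K (strand D) (strand D')"
  using assms e
  by (auto simp: chain_maps_def linmaps_def incl_def carrier_strand Df_strand Md_strand subset_iff) 

lemma collapse_chain_map:
  assumes "thin D" shows "collapse D \<in> chain_maps K (strand D) (strand {})"
  by (auto simp: chain_maps_def linmaps_def collapse_def carrier_strand Df_strand Md_strand)

lemma incl_arrows:
  assumes "g = NonNeg \<Longrightarrow> n \<ge> 0"
  shows "(strand {n}, strand {n, n + 1}, incl {n}) \<in> Arr (Ch K g)"
    and "(strand {}, strand {n}, incl {}) \<in> Arr (Ch K g)"
    and "(strand {n, n + 1}, strand {}, collapse {n, n + 1}) \<in> Arr (Ch K g)"
    and "(strand {n}, strand {}, collapse {n}) \<in> Arr (Ch K g)"
  using assms by (auto simp: Arr_def intro!: strand_Ob incl_chain_map collapse_chain_map)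

lemma e_cycle: "e \<in> cycles (strand {n}) n"
  using e by (simp add: cycles_def carrier_strand Df_strand)

lemma sphere_map_exists:
  assumes "chain_complex K X" "w \<in> cycles X n"
  shows "\<exists>u \<in> chain_maps K (strand {n}) X. u n e = w"
  using from_strand_exists[OF assms(1), of "{n}" "\<lambda>_. w"] assms(2) by (auto simp: cycles_def)

lemma disc_map_exists:
  assumes X: "chain_complex K X" and y: "y \<in> carrier (Md X (n + 1))"
  shows "\<exists>u \<in> chain_maps K (strand {n, n + 1}) X. u (n + 1) e = y \<and> u n e = Df X (n + 1) y"
proof -
  define w where "w j = (if j = n then Df X (n + 1) y else y)" for j
  have "w j \<in> carrier (Md X j)" if "j \<in> {n, n + 1}" for j
    using that y Df_closed[OF X y] by (auto simp: w_def)
  moreover have "Df X j (w j) = (if j - 1 \<in> {n, n + 1} then w (j - 1) else \<zero>\<^bsub>Md X (j - 1)\<^esub>)"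
    if "j \<in> {n, n + 1}" for j
    using that y Df_Df[OF X y] by (auto simp: w_def)
  ultimately have "\<exists>u \<in> chain_maps K (strand {n, n + 1}) X. \<forall>j \<in> {n, n + 1}. u j e = w j"
    by (rule from_strand_exists[OF X thin(3)])
  then show ?thesis by (auto simp: w_def)
qed

lemma disc_map_bottom:
  assumes "u \<in> chain_maps K (strand {n, n + 1}) X"
  shows "u n e = Df X (n + 1) (u (n + 1) e)"
  using chain_maps_Df[OF assms, of e "n + 1"] e by (simp add: carrier_strand Df_strand)

lemma to_strand_eqI:
  assumes "f \<in> chain_maps K X (strand D)" "f' \<in> chain_maps K X (strand D)"
    "\<And>j x. j \<in> D \<Longrightarrow> x \<in> carrier (Md X j) \<Longrightarrow> f j x = f' j x"
  shows "f = f'"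
proof (rule chain_maps_eqI[OF assms(1,2)])
  fix j x assume x: "x \<in> carrier (Md X j)"
  show "f j x = f' j x"
    using assms(3)[OF _ x] chain_maps_closed[OF assms(1) x] chain_maps_closed[OF assms(2) x]
    by (cases "j \<in> D") (auto simp: carrier_strand)
qed

lemma to_sphere_exists:
  assumes X: "chain_complex K X" and \<phi>: "\<phi> \<in> linmaps K (Md X n) V"
    and B: "\<And>b. b \<in> boundaries X n \<Longrightarrow> \<phi> b = \<zero>\<^bsub>V\<^esub>"
  shows "\<exists>u \<in> chain_maps K X (strand {n}). u n = \<phi>"
proof -
  have "\<phi> (Df X j x) = (if j \<in> {n} then \<phi> x else \<zero>\<^bsub>V\<^esub>)"
    if j: "j - 1 \<in> {n}" and x: "x \<in> carrier (Md X j)" for j x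
  proof -
    have "j = n + 1" using j by simp
    then have "Df X j x \<in> boundaries X n" using x by (simp add: boundaries_def)
    then show ?thesis using B \<open>j = n + 1\<close> by simp
  qed
  moreover have "\<phi> \<in> linmaps K (Md X j) V" if "j \<in> {n}" for j using that \<phi> by simp
  ultimately have "\<exists>u \<in> chain_maps K X (strand {n}). \<forall>j \<in> {n}. u j = \<phi>"
    by (intro to_strand_exists[OF X thin(2)])
  then show ?thesis by simp
qed

lemma to_disc_top:
  assumes "f \<in> chain_maps K X (strand {n, n + 1})" "x \<in> carrier (Md X (n + 1))"
  shows "f (n + 1) x = f n (Df X (n + 1) x)"
  using chain_maps_Df[OF assms] chain_maps_closed[OF assms] by (simp add: carrier_strand Df_strand)

lemma sphere_to_disc_Cof:
  assumes n: "g = NonNeg \<Longrightarrow> n \<ge> 0"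
  shows "(strand {n}, strand {n, n + 1}, incl {n}) \<in> Cof (Ch_model K g)"
proof -
  have "has_lift (Ch K g) (strand {n}, strand {n, n + 1}, incl {n}) (X, Y, p)"
    if p: "(X, Y, p) \<in> ch_fibrations K g \<inter> quasi_isos K g" for X Y p
  proof (rule has_liftI)
    fix u v assume u: "u \<in> Hom (Ch K g) (strand {n}) X" and v: "v \<in> Hom (Ch K g) (strand {n, n + 1}) Y"
      and sq: "Cmp (Ch K g) (strand {n}) X Y p u = Cmp (Ch K g) (strand {n}) (strand {n, n + 1}) Y v (incl {n})"
    have X: "chain_complex K X" and Y: "chain_complex K Y" and pc: "p \<in> chain_maps K X Y"
      using p by (auto simp: quasi_isos_iff Arr_def dest: Ch_ObD)
    have en: "e \<in> carrier (Md (strand {n}) n)" using e by (simp add: carrier_strand)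
    have pu: "p n (u n e) = v n e"
      using fun_cong[OF fun_cong[OF sq, of n], of e] en by (simp add: incl_def)
    have uc: "u n e \<in> cycles X n"
      using chain_maps_cycles[OF _ strand_complex X e_cycle] u by simp
    have vc: "v (n + 1) e \<in> carrier (Md Y (n + 1))"
      using chain_maps_closed[of v K "strand {n, n + 1}" Y e "n + 1"] v e by (simp add: carrier_strand)
    obtain x where x: "x \<in> carrier (Md X (n + 1))" "Df X (n + 1) x = u n e" "p (n + 1) x = v (n + 1) e"
      using trivial_fibration_lift[OF p uc vc _ n] pu disc_map_bottom[of v n Y] v by auto
    from disc_map_exists[OF X x(1)] obtain h where h: "h \<in> chain_maps K (strand {n, n + 1}) X"
      "h (n + 1) e = x" "h n e = u n e" using x by auto
    have i: "incl {n} \<in> chain_maps K (strand {n}) (strand {n, n + 1})" by (rule incl_chain_map) auto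
    have "Cmp (Ch K g) (strand {n}) (strand {n, n + 1}) X h (incl {n}) = u"
      by (rule from_strand_eqI[OF chain_maps_comp[OF i h(1) strand_complex]])
         (use u X h en in \<open>auto simp: incl_def\<close>)
    moreover have "Cmp (Ch K g) (strand {n, n + 1}) X Y p h = v"
      by (rule from_strand_eqI[OF chain_maps_comp[OF h(1) pc strand_complex]])
         (use v Y h x pu e in \<open>auto simp: carrier_strand\<close>)
    ultimately show "\<exists>h \<in> Hom (Ch K g) (strand {n, n + 1}) X.
        Cmp (Ch K g) (strand {n}) (strand {n, n + 1}) X h (incl {n}) = u \<and>
        Cmp (Ch K g) (strand {n, n + 1}) X Y p h = v"
      using h by auto
  qed
  then show ?thesis using incl_arrows(1)[OF n] by (auto simp: Ch_model_def llp_def)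
qed

lemma disc_acyclic: "cycles (strand {n, n + 1}) j \<subseteq> boundaries (strand {n, n + 1}) j"
proof
  fix x assume x: "x \<in> cycles (strand {n, n + 1}) j"
  have z: "\<zero>\<^bsub>V\<^esub> \<in> boundaries (strand {n, n + 1}) j"
    using zero_boundary[OF strand_complex, of "{n, n + 1}" j] by simp
  show "x \<in> boundaries (strand {n, n + 1}) j"
  proof (cases "j = n")
    case True
    then show ?thesis using x
      by (auto simp: boundaries_iff cycles_def carrier_strand Df_strand intro!: bexI[of _ x])
  next
    case False
    then have "x = \<zero>\<^bsub>V\<^esub>" using x by (auto simp: cycles_def carrier_strand Df_strand split: if_splits)
    then show ?thesis using z by simp
  qed
qed

lemma disc_collapse_trivial_fibration:
  assumes n: "g = NonNeg \<Longrightarrow> n \<ge> 0"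
  shows "(strand {n, n + 1}, strand {}, collapse {n, n + 1}) \<in> ch_fibrations K g \<inter> quasi_isos K g"
proof -
  have "\<zero>\<^bsub>V\<^esub> \<in> cycles (strand {n, n + 1}) j" for j
    by (simp add: cycles_def carrier_strand Df_strand)
  moreover have "\<zero>\<^bsub>V\<^esub> \<in> boundaries (strand {}) j" for j
    using zero_boundary[OF strand_complex, of "{}" j] by simp
  ultimately have "homology_bij (strand {n, n + 1}) (strand {}) (collapse {n, n + 1}) j" for j
    using disc_acyclic[of n j]
    by (auto simp: homology_bij_def collapse_def cycles_def carrier_strand Md_strand
        intro!: exI[of _ "\<zero>\<^bsub>V\<^esub>"] bexI[of _ "\<zero>\<^bsub>V\<^esub>"])
  moreover have "collapse {n, n + 1} j ` carrier (Md (strand {n, n + 1}) j) = carrier (Md (strand {}) j)" for j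
    by (auto simp: collapse_def carrier_strand image_iff)
  ultimately show ?thesis using incl_arrows(3)[OF n] by (auto simp: ch_fibrations_def quasi_isos_iff)
qed

text \<open>A functional on \<open>X\<^sub>n\<close> is the same as a chain map from \<open>X\<close> to the disc, and the disc is acyclic, so that
  the chain map extends along cofibrations.\<close>

lemma Cof_extends_functionals:
  fixes X Y :: "('k, 'a) cx"
  assumes f: "(X, Y, f) \<in> Cof (Ch_model K g)" and n: "g = NonNeg \<Longrightarrow> n \<ge> 0"
    and \<phi>: "\<phi> \<in> linmaps K (Md X n) V"
  shows "\<exists>\<psi> \<in> chain_maps K Y (strand {n, n + 1}). \<forall>x \<in> carrier (Md X n). \<psi> n (f n x) = \<phi> x"
proof -
  have arr: "(X, Y, f) \<in> Arr (Ch K g)" using f by (simp add: Ch_model_def llp_def)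
  then have X: "chain_complex K X" and Y: "chain_complex K Y" and fc: "f \<in> chain_maps K X Y"
    by (auto simp: Arr_def dest: Ch_ObD)
  have lift: "has_lift (Ch K g) (X, Y, f) (strand {n, n + 1}, strand {}, collapse {n, n + 1})"
    using f disc_collapse_trivial_fibration[OF n] by (simp add: Ch_model_def llp_def)
  define \<phi>' where "\<phi>' j = (if j = n then \<phi> else (\<lambda>x \<in> carrier (Md X (n + 1)). \<phi> (Df X (n + 1) x)))" for j
  have Dl: "Df X (n + 1) \<in> linmaps K (Md X (n + 1)) (Md X n)" using Df_lin[OF X, of "n + 1"] by simp
  have "\<phi>' j \<in> linmaps K (Md X j) V" if "j \<in> {n, n + 1}" for j
    using that \<phi> linmaps_comp[OF Dl \<phi> chain_complex_module[OF X]] by (auto simp: \<phi>'_def)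
  moreover have "\<phi>' (j - 1) (Df X j x) = (if j \<in> {n, n + 1} then \<phi>' j x else \<zero>\<^bsub>V\<^esub>)"
    if j: "j - 1 \<in> {n, n + 1}" and x: "x \<in> carrier (Md X j)" for j x
  proof (cases "j = n + 1")
    case True
    then show ?thesis using x by (simp add: \<phi>'_def)
  next
    case False
    then have j: "j - 1 = n + 1" "j \<notin> {n, n + 1}" "j - 2 = n" using j by auto
    have "Df X (n + 1) (Df X j x) = \<zero>\<^bsub>Md X n\<^esub>" using Df_Df[OF X x] j by simp
    moreover have "Df X j x \<in> carrier (Md X (n + 1))" using Df_closed[OF X x] j by simp
    ultimately show ?thesis
      unfolding j(1) using j(2) linmaps_zero[OF \<phi> chain_complex_module[OF X] V] by (simp add: \<phi>'_def)
  qed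
  ultimately obtain u where u: "u \<in> chain_maps K X (strand {n, n + 1})" "\<forall>j \<in> {n, n + 1}. u j = \<phi>' j"
    using to_strand_exists[OF X thin(3), of n \<phi>'] by blast
  obtain v where v: "v \<in> chain_maps K Y (strand {})" using to_strand_exists[OF Y thin(1)] by blast
  have "Cmp (Ch K g) X (strand {n, n + 1}) (strand {}) (collapse {n, n + 1}) u = Cmp (Ch K g) X Y (strand {}) v f"
    by (rule to_strand_eqI[OF chain_maps_comp[OF u(1) collapse_chain_map X] chain_maps_comp[OF fc v X]]) auto
  then obtain h where h: "h \<in> chain_maps K Y (strand {n, n + 1})"
      "Cmp (Ch K g) X Y (strand {n, n + 1}) h f = u"
    using has_liftD[OF lift, of u v] u v by auto
  have "h n (f n x) = \<phi> x" if "x \<in> carrier (Md X n)" for x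
    using fun_cong[OF fun_cong[OF h(2), of n], of x] that u(2) by (simp add: \<phi>'_def)
  then show ?thesis using h by blast
qed

text \<open>A nonzero element is detected by a functional, and functionals extend.\<close>

lemma Cof_injective:
  fixes X Y :: "('k, 'a) cx"
  assumes f: "(X, Y, f) \<in> Cof (Ch_model K g)" and x: "x \<in> carrier (Md X n)" "f n x = \<zero>\<^bsub>Md Y n\<^esub>"
  shows "x = \<zero>\<^bsub>Md X n\<^esub>"
proof (rule ccontr)
  assume ne: "x \<noteq> \<zero>\<^bsub>Md X n\<^esub>"
  have arr: "(X, Y, f) \<in> Arr (Ch K g)" using f by (simp add: Ch_model_def llp_def)
  then have X: "chain_complex K X" and Y: "chain_complex K Y"
    by (auto simp: Arr_def dest: Ch_ObD)
  interpret M: module K "Md X n" using X by (rule chain_complex_module)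
  have n: "n \<ge> 0" if "g = NonNeg"
    using arr Ch_Ob_neg[of X K n] that ne x by (force simp: Arr_def)
  have "subspace K (Md X n) {\<zero>\<^bsub>Md X n\<^esub>}" by (simp add: subspace_def)
  then obtain \<phi> where \<phi>: "\<phi> \<in> linmaps K (Md X n) V" "\<phi> x = e"
    using linear_functional_exists[OF field M.module_axioms _ x(1) _ V e(1)] ne by blast
  from Cof_extends_functionals[OF f n \<phi>(1)] obtain \<psi> where
    \<psi>: "\<psi> \<in> chain_maps K Y (strand {n, n + 1})" "\<psi> n (f n x) = e" using x \<phi> by auto
  then show False
    using x(2) chain_maps_zero[OF \<psi>(1) Y strand_complex, of n] e by simp
qed

end

locale localized_line = vector_line K V e
  for K :: "'k ring" and V :: "('k, 'a) module" and e :: 'a +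
  fixes g :: grading and S :: "(('k, 'a) cx, int \<Rightarrow> 'a \<Rightarrow> 'a) arr set"
  assumes model: "model_structure (Ch K g) (Loc_model K g S)"
begin

abbreviation "W \<equiv> Weq (Loc_model K g S)"

lemma W_arrow: "(X, Y, f) \<in> W \<Longrightarrow> (X, Y, f) \<in> Arr (Ch K g)"
  using model by (auto simp: model_structure_def)

lemma W_two_of_three:
  assumes "(X, Y, f) \<in> Arr (Ch K g)" "(Y, Z, f') \<in> Arr (Ch K g)"
  shows "(X, Y, f) \<in> W \<Longrightarrow> (Y, Z, f') \<in> W \<Longrightarrow> (X, Z, Cmp (Ch K g) X Y Z f' f) \<in> W"
    and "(X, Y, f) \<in> W \<Longrightarrow> (X, Z, Cmp (Ch K g) X Y Z f' f) \<in> W \<Longrightarrow> (Y, Z, f') \<in> W"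
    and "(Y, Z, f') \<in> W \<Longrightarrow> (X, Z, Cmp (Ch K g) X Y Z f' f) \<in> W \<Longrightarrow> (X, Y, f) \<in> W"
proof -
  have t: "two_of_three (Ch K g) W" using model by (simp add: model_structure_def)
  show "(X, Y, f) \<in> W \<Longrightarrow> (Y, Z, f') \<in> W \<Longrightarrow> (X, Z, Cmp (Ch K g) X Y Z f' f) \<in> W"
    "(X, Y, f) \<in> W \<Longrightarrow> (X, Z, Cmp (Ch K g) X Y Z f' f) \<in> W \<Longrightarrow> (Y, Z, f') \<in> W"
    "(Y, Z, f') \<in> W \<Longrightarrow> (X, Z, Cmp (Ch K g) X Y Z f' f) \<in> W \<Longrightarrow> (X, Y, f) \<in> W"
    using t[unfolded two_of_three_def Let_def, rule_format, OF conjI[OF assms]] by blast+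
qed

text \<open>Localization does not change the cofibrations, hence not the trivial fibrations either.\<close>

lemma disc_collapse_W:
  assumes "g = NonNeg \<Longrightarrow> n \<ge> 0"
  shows "(strand {n, n + 1}, strand {}, collapse {n, n + 1}) \<in> W"
proof (rule rlp_Cof_imp_Weq[OF category_Ch model incl_arrows(3)[OF assms]])
  fix i assume "i \<in> Cof (Loc_model K g S)"
  then show "has_lift (Ch K g) i (strand {n, n + 1}, strand {}, collapse {n, n + 1})"
    using disc_collapse_trivial_fibration[OF assms] by (simp add: Loc_model_def Ch_model_def llp_def)
qed

text \<open>Two out of three, for \<open>0 \<rightarrow> S\<^sup>n \<rightarrow> 0\<close> and for \<open>S\<^sup>n \<rightarrow> D\<^sup>n\<^sup>+\<^sup>1 \<rightarrow> 0\<close>.\<close>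

lemma zero_to_sphere_imp_sphere_to_disc:
  assumes "(strand {}, strand {n}, incl {}) \<in> W"
  shows "(strand {n}, strand {n, n + 1}, incl {n}) \<in> W"
proof -
  have n: "n \<ge> 0" if "g = NonNeg" using W_arrow[OF assms] sphere_nonneg that by (auto simp: Arr_def)
  note a = incl_arrows[OF n]
  have c: "collapse {n} \<in> chain_maps K (strand {n}) (strand {})"
    "incl {} \<in> chain_maps K (strand {}) (strand {n})"
    "incl {n} \<in> chain_maps K (strand {n}) (strand {n, n + 1})"
    "collapse {n, n + 1} \<in> chain_maps K (strand {n, n + 1}) (strand {})"
    using a by (auto simp: Arr_def)
  have "Cmp (Ch K g) (strand {}) (strand {n}) (strand {}) (collapse {n}) (incl {}) = Idn (Ch K g) (strand {})"
    by (rule to_strand_eqI[OF chain_maps_comp[OF c(2,1) strand_complex] chain_maps_id[OF strand_complex]]) auto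
  then have 1: "(strand {n}, strand {}, collapse {n}) \<in> W"
    using W_two_of_three(2)[OF a(2,4)] assms Weq_Idn[OF category_Ch model strand_Ob, of "{}"] by simp
  have "Cmp (Ch K g) (strand {n}) (strand {n, n + 1}) (strand {}) (collapse {n, n + 1}) (incl {n}) = collapse {n}"
    by (rule to_strand_eqI[OF chain_maps_comp[OF c(3,4) strand_complex] c(1)]) auto
  then show ?thesis using W_two_of_three(3)[OF a(1,3)] 1 disc_collapse_W[OF n] by simp
qed

lemma sphere_to_disc_nonneg:
  assumes "(strand {n}, D, f) \<in> W" "g = NonNeg"
  shows "n \<ge> 0"
  using W_arrow[OF assms(1)] assms(2) sphere_nonneg by (auto simp: Arr_def)

text \<open>The map \<open>0 \<rightarrow> S\<^sup>n\<^sup>+\<^sup>1\<close> is the cobase change of \<open>S\<^sup>n \<rightarrow> D\<^sup>n\<^sup>+\<^sup>1\<close> along \<open>S\<^sup>n \<rightarrow> 0\<close>, so it lifts against all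
  local fibrations: a lifting problem for it is one for \<open>S\<^sup>n \<rightarrow> D\<^sup>n\<^sup>+\<^sup>1\<close> with zero map on \<open>S\<^sup>n\<close>.\<close>

lemma sphere_to_disc_Suc:
  assumes W: "(strand {n}, strand {n, n + 1}, incl {n}) \<in> W"
  shows "(strand {n + 1}, strand {n + 1, n + 1 + 1}, incl {n + 1}) \<in> W"
proof (rule zero_to_sphere_imp_sphere_to_disc)
  have n: "g = NonNeg \<Longrightarrow> n \<ge> 0" using sphere_to_disc_nonneg[OF W] .
  then have n': "g = NonNeg \<Longrightarrow> n + 1 \<ge> 0" by force
  show "(strand {}, strand {n + 1}, incl {}) \<in> W"
  proof (rule llp_Fib_imp_Weq[OF category_Ch model incl_arrows(2)[OF n']])
    fix q assume q: "q \<in> Fib (Loc_model K g S)"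
    obtain A B p where qp: "q = (A, B, p)" by (cases q)
    have p: "(A, B, p) \<in> Arr (Ch K g)" using q by (simp add: qp Loc_model_def rlp_def)
    then have A: "chain_complex K A" and B: "chain_complex K B" and pc: "p \<in> chain_maps K A B"
      by (auto simp: Arr_def dest: Ch_ObD)
    have lift: "has_lift (Ch K g) (strand {n}, strand {n, n + 1}, incl {n}) (A, B, p)"
      using q W sphere_to_disc_Cof[OF n] by (simp add: qp Loc_model_def rlp_def)
    show "has_lift (Ch K g) (strand {}, strand {n + 1}, incl {}) q"
      unfolding qp
    proof (rule has_liftI)
      fix u v assume u: "u \<in> Hom (Ch K g) (strand {}) A" and v: "v \<in> Hom (Ch K g) (strand {n + 1}) B"
      have yc: "v (n + 1) e \<in> cycles B (n + 1)"
        using chain_maps_cycles[OF _ strand_complex B e_cycle] v by simp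
      then have y: "v (n + 1) e \<in> carrier (Md B (n + 1))" "Df B (n + 1) (v (n + 1) e) = \<zero>\<^bsub>Md B n\<^esub>"
        by (auto simp: cycles_def)
      have "\<zero>\<^bsub>Md A n\<^esub> \<in> cycles A n" using zero_boundary[OF A] boundaries_subset_cycles[OF A] by blast
      from sphere_map_exists[OF A this] obtain u0 where
        u0: "u0 \<in> chain_maps K (strand {n}) A" "u0 n e = \<zero>\<^bsub>Md A n\<^esub>" by blast
      from disc_map_exists[OF B y(1)] obtain v0 where
        v0: "v0 \<in> chain_maps K (strand {n, n + 1}) B" "v0 (n + 1) e = v (n + 1) e" "v0 n e = \<zero>\<^bsub>Md B n\<^esub>"
        using y by auto
      have i: "incl {n} \<in> chain_maps K (strand {n}) (strand {n, n + 1})" by (rule incl_chain_map) auto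
      have en: "e \<in> carrier (Md (strand {n}) n)" using e by (simp add: carrier_strand)
      have "Cmp (Ch K g) (strand {n}) A B p u0 = Cmp (Ch K g) (strand {n}) (strand {n, n + 1}) B v0 (incl {n})"
        by (rule from_strand_eqI[OF chain_maps_comp[OF u0(1) pc strand_complex]
              chain_maps_comp[OF i v0(1) strand_complex]])
           (use B u0 v0 en chain_maps_zero[OF pc A B] in \<open>auto simp: incl_def\<close>)
      then obtain h0 where h0: "h0 \<in> chain_maps K (strand {n, n + 1}) A"
        "Cmp (Ch K g) (strand {n}) (strand {n, n + 1}) A h0 (incl {n}) = u0"
        "Cmp (Ch K g) (strand {n, n + 1}) A B p h0 = v0"
        using has_liftD[OF lift, of u0 v0] u0 v0 by auto
      have e1: "e \<in> carrier (Md (strand {n, n + 1}) (n + 1))" using e by (simp add: carrier_strand)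
      have "h0 n e = \<zero>\<^bsub>Md A n\<^esub>"
        using fun_cong[OF fun_cong[OF h0(2), of n], of e] en u0 by (simp add: incl_def)
      then have "h0 (n + 1) e \<in> cycles A (n + 1)"
        using disc_map_bottom[OF h0(1)] chain_maps_closed[OF h0(1) e1] by (simp add: cycles_def)
      from sphere_map_exists[OF A this] obtain h where
        h: "h \<in> chain_maps K (strand {n + 1}) A" "h (n + 1) e = h0 (n + 1) e" by blast
      have i': "incl {} \<in> chain_maps K (strand {}) (strand {n + 1})" by (rule incl_chain_map) auto
      have "Cmp (Ch K g) (strand {}) (strand {n + 1}) A h (incl {}) = u"
        by (rule from_strand_eqI[OF chain_maps_comp[OF i' h(1) strand_complex]]) (use u A in auto)
      moreover have "p (n + 1) (h0 (n + 1) e) = v (n + 1) e"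
        using fun_cong[OF fun_cong[OF h0(3), of "n + 1"], of e] e1 v0 by simp
      then have "Cmp (Ch K g) (strand {n + 1}) A B p h = v"
        by (intro from_strand_eqI[OF chain_maps_comp[OF h(1) pc strand_complex]])
           (use v B h e in \<open>auto simp: carrier_strand\<close>)
      ultimately show "\<exists>h \<in> Hom (Ch K g) (strand {n + 1}) A.
          Cmp (Ch K g) (strand {}) (strand {n + 1}) A h (incl {}) = u \<and>
          Cmp (Ch K g) (strand {n + 1}) A B p h = v"
        using h by auto
    qed
  qed
qed

lemma sphere_to_disc_upward:
  assumes "(strand {n}, strand {n, n + 1}, incl {n}) \<in> W" "n \<le> m"
  shows "(strand {m}, strand {m, m + 1}, incl {m}) \<in> W"
  using assms(2,1) by (induction rule: int_ge_induct) (auto dest: sphere_to_disc_Suc)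

text \<open>A cycle is a map from \<open>S\<^sup>n\<close>, and an extension of this map to the disc exhibits it as a boundary.\<close>

lemma fibrant_homology_trivial:
  assumes W: "(strand {n}, strand {n, n + 1}, incl {n}) \<in> W"
    and N: "fibrant (Ch K g) (Loc_model K g S) N"
  shows "cycles N n \<subseteq> boundaries N n"
proof
  fix w assume w: "w \<in> cycles N n"
  have n: "g = NonNeg \<Longrightarrow> n \<ge> 0" using sphere_to_disc_nonneg[OF W] .
  have Nob: "N \<in> Ob (Ch K g)" using N by (simp add: fibrant_def)
  then have NC: "chain_complex K N" by (rule Ch_ObD)
  from N obtain T where T: "terminal_ob (Ch K g) T"
    and TF: "\<And>f. f \<in> chain_maps K N T \<Longrightarrow> (N, T, f) \<in> Fib (Loc_model K g S)"
    by (auto simp: fibrant_def)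
  have Tm: "\<exists>!f. f \<in> chain_maps K X T" if "X \<in> Ob (Ch K g)" for X :: "('k, 'a) cx"
    using T that by (simp add: terminal_ob_def)
  obtain f where f: "f \<in> chain_maps K N T" using Tm[OF Nob] by blast
  have a: "(strand {n}, strand {n, n + 1}, incl {n}) \<in> Arr (Ch K g)" using incl_arrows(1)[OF n] .
  then have ob: "strand {n} \<in> Ob (Ch K g)" "strand {n, n + 1} \<in> Ob (Ch K g)"
    and i: "incl {n} \<in> chain_maps K (strand {n}) (strand {n, n + 1})" by (auto simp: Arr_def)
  obtain v where v: "v \<in> chain_maps K (strand {n, n + 1}) T" using Tm[OF ob(2)] by blast
  from sphere_map_exists[OF NC w] obtain u where u: "u \<in> chain_maps K (strand {n}) N" "u n e = w" by blast
  have lift: "has_lift (Ch K g) (strand {n}, strand {n, n + 1}, incl {n}) (N, T, f)"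
    using TF[OF f] W sphere_to_disc_Cof[OF n] by (simp add: Loc_model_def rlp_def)
  have "Cmp (Ch K g) (strand {n}) N T f u = Cmp (Ch K g) (strand {n}) (strand {n, n + 1}) T v (incl {n})"
    using Tm[OF ob(1)] chain_maps_comp[OF u(1) f strand_complex] chain_maps_comp[OF i v strand_complex] by auto
  then obtain h where h: "h \<in> chain_maps K (strand {n, n + 1}) N"
    "Cmp (Ch K g) (strand {n}) (strand {n, n + 1}) N h (incl {n}) = u"
    using has_liftD[OF lift, of u v] u v by auto
  have "h n e = w"
    using fun_cong[OF fun_cong[OF h(2), of n], of e] e u by (simp add: incl_def carrier_strand)
  moreover have "h (n + 1) e \<in> carrier (Md N (n + 1))"
    using chain_maps_closed[OF h(1), of e "n + 1"] e by (simp add: carrier_strand)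
  ultimately show "w \<in> boundaries N n"
    using disc_map_bottom[OF h(1)] unfolding boundaries_iff by auto
qed

text \<open>Let \<open>f z = d y\<close>, where \<open>z\<close> is no boundary.  The pair \<open>(z, y)\<close> maps \<open>S\<^sup>n \<rightarrow> D\<^sup>n\<^sup>+\<^sup>1\<close> to \<open>f\<close>, and a functional that
  is \<open>1\<close> on \<open>z\<close> and vanishes on boundaries, extended to \<open>Y\<close>, maps back.  So \<open>S\<^sup>n \<rightarrow> D\<^sup>n\<^sup>+\<^sup>1\<close> is a retract
  of \<open>f\<close>.\<close>

lemma sphere_to_disc_if_not_injective:
  assumes C: "(X, Y, f) \<in> Cof (Ch_model K g)" and W: "(X, Y, f) \<in> W"
    and z: "z \<in> cycles X n" "f n z \<in> boundaries Y n" "z \<notin> boundaries X n"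
  shows "(strand {n}, strand {n, n + 1}, incl {n}) \<in> W"
proof -
  have arr: "(X, Y, f) \<in> Arr (Ch K g)" using W_arrow[OF W] .
  then have X: "chain_complex K X" and Y: "chain_complex K Y" and fc: "f \<in> chain_maps K X Y"
    by (auto simp: Arr_def dest: Ch_ObD)
  have zc: "z \<in> carrier (Md X n)" using z by (simp add: cycles_def)
  have n: "n \<ge> 0" if "g = NonNeg"
    using arr Ch_Ob_neg[of X K n] that zc z(3) zero_boundary[OF X, of n] by (force simp: Arr_def)
  have "subspace K (Md X n) (boundaries X n)"
    using boundaries_subset[OF X] zero_boundary[OF X] boundaries_add[OF X] boundaries_smult[OF X]
    by (auto simp: subspace_def)
  then obtain \<phi> where \<phi>: "\<phi> \<in> linmaps K (Md X n) V" "\<forall>b \<in> boundaries X n. \<phi> b = \<zero>\<^bsub>V\<^esub>" "\<phi> z = e"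
    using linear_functional_exists[OF field chain_complex_module[OF X] _ zc z(3) V e(1)] by blast
  from Cof_extends_functionals[OF C n \<phi>(1)] obtain \<psi> where
    \<psi>: "\<psi> \<in> chain_maps K Y (strand {n, n + 1})" "\<And>x. x \<in> carrier (Md X n) \<Longrightarrow> \<psi> n (f n x) = \<phi> x" by blast
  from z(2) obtain y where y: "y \<in> carrier (Md Y (n + 1))" "f n z = Df Y (n + 1) y" by (auto simp: boundaries_iff)
  from sphere_map_exists[OF X z(1)] obtain a where a: "a \<in> chain_maps K (strand {n}) X" "a n e = z" by blast
  from disc_map_exists[OF Y y(1)] obtain b where
    b: "b \<in> chain_maps K (strand {n, n + 1}) Y" "b (n + 1) e = y" "b n e = f n z" using y by auto
  obtain a' where a': "a' \<in> chain_maps K X (strand {n})" "a' n = \<phi>"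
    using to_sphere_exists[OF X \<phi>(1)] \<phi>(2) by blast
  have i: "incl {n} \<in> chain_maps K (strand {n}) (strand {n, n + 1})" by (rule incl_chain_map) auto
  have en: "e \<in> carrier (Md (strand {n}) n)" "e \<in> carrier (Md (strand {n, n + 1}) n)"
    "e \<in> carrier (Md (strand {n, n + 1}) (n + 1))" using e by (auto simp: carrier_strand)
  have top: "\<psi> (n + 1) y = e" using to_disc_top[OF \<psi>(1) y(1)] y(2) \<psi>(2)[OF zc] \<phi> by simp
  note sc = strand_complex
  have 1: "Cmp (Ch K g) (strand {n}) X (strand {n}) a' a = Idn (Ch K g) (strand {n})"
    by (rule from_strand_eqI[OF chain_maps_comp[OF a(1) a'(1) sc] chain_maps_id[OF sc]])
       (use sc a a' \<phi> en in auto)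
  have 2: "Cmp (Ch K g) (strand {n, n + 1}) Y (strand {n, n + 1}) \<psi> b = Idn (Ch K g) (strand {n, n + 1})"
    by (rule from_strand_eqI[OF chain_maps_comp[OF b(1) \<psi>(1) sc] chain_maps_id[OF sc]])
       (use sc b \<psi> \<phi> en zc top in auto)
  have 3: "Cmp (Ch K g) (strand {n}) X Y f a = Cmp (Ch K g) (strand {n}) (strand {n, n + 1}) Y b (incl {n})"
    by (rule from_strand_eqI[OF chain_maps_comp[OF a(1) fc sc] chain_maps_comp[OF i b(1) sc]])
       (use Y a b en in \<open>auto simp: incl_def\<close>)
  have 4: "Cmp (Ch K g) X (strand {n}) (strand {n, n + 1}) (incl {n}) a' = Cmp (Ch K g) X Y (strand {n, n + 1}) \<psi> f"
    (is "?l = ?r")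
  proof (rule to_strand_eqI)
    show l: "?l \<in> chain_maps K X (strand {n, n + 1})" by (rule chain_maps_comp[OF a'(1) i X])
    show r: "?r \<in> chain_maps K X (strand {n, n + 1})" by (rule chain_maps_comp[OF fc \<psi>(1) X])
    have bot: "?l n x = ?r n x" if "x \<in> carrier (Md X n)" for x
      using that a'(2) \<psi>(2) chain_maps_closed[OF a'(1) that] by (simp add: incl_def)
    fix j x assume j: "j \<in> {n, n + 1}" and x: "x \<in> carrier (Md X j)"
    show "?l j x = ?r j x"
    proof (cases "j = n")
      case False
      then have "j = n + 1" using j by auto
      then show ?thesis
        using to_disc_top[OF l, of x] to_disc_top[OF r, of x] x bot[of "Df X (n + 1) x"] Df_closed[OF X, of x "n + 1"] by simp
    qed (use bot x in auto)
  qed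
  have ret: "retract_closed (Ch K g) W" using model by (simp add: model_structure_def)
  show ?thesis
    using ret[unfolded retract_closed_def, rule_format, of a "strand {n}" X a' b "strand {n, n + 1}" Y \<psi> "incl {n}" f]
      a a' b \<psi>(1) 1 2 3 4 W incl_arrows(1)[OF n] by simp
qed

text \<open>Here \<open>0 \<rightarrow> S\<^sup>n\<close> is a retract of \<open>f\<close>, by the cycle \<open>y\<close> and a functional that vanishes on boundaries and on
  the image of \<open>X\<^sub>n\<close>.  Such a functional exists because \<open>f\<close> is injective: if \<open>y\<close> is homologous to \<open>f x\<close>,
  then \<open>f (d x) = 0\<close>, so \<open>x\<close> is a cycle.\<close>

lemma sphere_to_disc_if_not_surjective:
  assumes C: "(X, Y, f) \<in> Cof (Ch_model K g)" and W: "(X, Y, f) \<in> W"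
    and y: "y \<in> cycles Y n" "\<And>x b. x \<in> cycles X n \<Longrightarrow> b \<in> boundaries Y n \<Longrightarrow> y \<noteq> b \<oplus>\<^bsub>Md Y n\<^esub> f n x"
  shows "(strand {n}, strand {n, n + 1}, incl {n}) \<in> W"
proof (rule zero_to_sphere_imp_sphere_to_disc)
  have arr: "(X, Y, f) \<in> Arr (Ch K g)" using W_arrow[OF W] .
  then have X: "chain_complex K X" and Y: "chain_complex K Y" and fc: "f \<in> chain_maps K X Y"
    by (auto simp: Arr_def dest: Ch_ObD)
  interpret X: module K "Md X n" using X by (rule chain_complex_module)
  interpret Y: module K "Md Y n" using Y by (rule chain_complex_module)
  interpret Y1: module K "Md Y (n - 1)" using Y by (rule chain_complex_module)
  note fcl = chain_maps_closed[OF fc]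
  note fl = chain_maps_lin[OF fc]
  note BY = subsetD[OF boundaries_subset[OF Y]]
  have yc: "y \<in> carrier (Md Y n)" using y by (simp add: cycles_def)
  have z: "\<zero>\<^bsub>Md X n\<^esub> \<in> cycles X n" using zero_boundary[OF X] boundaries_subset_cycles[OF X] by blast
  have "y \<noteq> \<zero>\<^bsub>Md Y n\<^esub>"
    using y(2)[OF z zero_boundary[OF Y]] by (simp add: chain_maps_zero[OF fc X Y])
  then have n: "n \<ge> 0" if "g = NonNeg"
    using arr Ch_Ob_neg[of Y K n] that yc by (force simp: Arr_def)
  define N where "N = {b \<oplus>\<^bsub>Md Y n\<^esub> f n x | b x. b \<in> boundaries Y n \<and> x \<in> carrier (Md X n)}"
  have yN: "y \<notin> N"
  proof
    assume "y \<in> N"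
    then obtain b x where bx: "b \<in> boundaries Y n" "x \<in> carrier (Md X n)" "y = b \<oplus>\<^bsub>Md Y n\<^esub> f n x"
      by (auto simp: N_def)
    have "Df Y n y = Df Y n b \<oplus>\<^bsub>Md Y (n - 1)\<^esub> f (n - 1) (Df X n x)"
      using bx BY fcl linmaps_add[OF Df_lin[OF Y]] chain_maps_Df[OF fc] by simp
    also have "Df Y n b = \<zero>\<^bsub>Md Y (n - 1)\<^esub>"
      using bx boundaries_subset_cycles[OF Y, of n] by (auto simp: cycles_def)
    finally have "f (n - 1) (Df X n x) = \<zero>\<^bsub>Md Y (n - 1)\<^esub>"
      using y(1) fcl[OF Df_closed[OF X bx(2)]] by (simp add: cycles_def)
    then have "x \<in> cycles X n"
      using Cof_injective[OF C Df_closed[OF X bx(2)]] bx by (simp add: cycles_def)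
    then show False using y(2) bx by blast
  qed
  have N: "subspace K (Md Y n) N"
    unfolding subspace_def
  proof (intro conjI ballI)
    show "N \<subseteq> carrier (Md Y n)" using BY fcl by (auto simp: N_def)
    have "\<zero>\<^bsub>Md Y n\<^esub> = \<zero>\<^bsub>Md Y n\<^esub> \<oplus>\<^bsub>Md Y n\<^esub> f n \<zero>\<^bsub>Md X n\<^esub>" by (simp add: chain_maps_zero[OF fc X Y])
    then show "\<zero>\<^bsub>Md Y n\<^esub> \<in> N" using zero_boundary[OF Y] X.zero_closed unfolding N_def by blast
    fix u assume "u \<in> N"
    then obtain b x where u: "b \<in> boundaries Y n" "x \<in> carrier (Md X n)" "u = b \<oplus>\<^bsub>Md Y n\<^esub> f n x"
      by (auto simp: N_def)
    {
      fix v assume "v \<in> N"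
      then obtain b' x' where v: "b' \<in> boundaries Y n" "x' \<in> carrier (Md X n)" "v = b' \<oplus>\<^bsub>Md Y n\<^esub> f n x'"
        by (auto simp: N_def)
      have "u \<oplus>\<^bsub>Md Y n\<^esub> v = (b \<oplus>\<^bsub>Md Y n\<^esub> b') \<oplus>\<^bsub>Md Y n\<^esub> f n (x \<oplus>\<^bsub>Md X n\<^esub> x')"
        using u v BY fcl linmaps_add[OF fl] by (simp add: Y.a_ac)
      then show "u \<oplus>\<^bsub>Md Y n\<^esub> v \<in> N" using boundaries_add[OF Y u(1) v(1)] X.a_closed[OF u(2) v(2)]
        unfolding N_def by blast
    }
    fix a assume a: "a \<in> carrier K"
    have "a \<odot>\<^bsub>Md Y n\<^esub> u = (a \<odot>\<^bsub>Md Y n\<^esub> b) \<oplus>\<^bsub>Md Y n\<^esub> f n (a \<odot>\<^bsub>Md X n\<^esub> x)"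
      using u a BY fcl linmaps_smult[OF fl] by (simp add: Y.smult_r_distr)
    then show "a \<odot>\<^bsub>Md Y n\<^esub> u \<in> N" using boundaries_smult[OF Y u(1) a] X.smult_closed[OF a u(2)]
      unfolding N_def by blast
  qed
  from linear_functional_exists[OF field Y.module_axioms N yc yN V e(1)] obtain \<phi> where
    \<phi>: "\<phi> \<in> linmaps K (Md Y n) V" "\<And>h. h \<in> N \<Longrightarrow> \<phi> h = \<zero>\<^bsub>V\<^esub>" "\<phi> y = e" by blast
  have BN: "b \<in> N" if "b \<in> boundaries Y n" for b
  proof -
    have "b = b \<oplus>\<^bsub>Md Y n\<^esub> f n \<zero>\<^bsub>Md X n\<^esub>" using BY[OF that] by (simp add: chain_maps_zero[OF fc X Y])
    then show ?thesis using that X.zero_closed unfolding N_def by blast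
  qed
  have fN: "f n x \<in> N" if "x \<in> carrier (Md X n)" for x
  proof -
    have "f n x = \<zero>\<^bsub>Md Y n\<^esub> \<oplus>\<^bsub>Md Y n\<^esub> f n x" using fcl[OF that] by simp
    then show ?thesis using that zero_boundary[OF Y] unfolding N_def by blast
  qed
  obtain b' where b': "b' \<in> chain_maps K Y (strand {n})" "b' n = \<phi>"
    using to_sphere_exists[OF Y \<phi>(1)] \<phi>(2)[OF BN] by blast
  from sphere_map_exists[OF Y y(1)] obtain b where b: "b \<in> chain_maps K (strand {n}) Y" "b n e = y" by blast
  obtain a where a: "a \<in> chain_maps K (strand {}) X" using from_strand_exists[OF X thin(1)] by blast
  obtain a' where a': "a' \<in> chain_maps K X (strand {})" using to_strand_exists[OF X thin(1)] by blast
  have i: "incl {} \<in> chain_maps K (strand {}) (strand {n})" by (rule incl_chain_map) auto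
  have en: "e \<in> carrier (Md (strand {n}) n)" using e by (auto simp: carrier_strand)
  note sc = strand_complex
  have 1: "Cmp (Ch K g) (strand {}) X (strand {}) a' a = Idn (Ch K g) (strand {})"
    by (rule from_strand_eqI[OF chain_maps_comp[OF a a' sc] chain_maps_id[OF sc]]) (use sc in auto)
  have 2: "Cmp (Ch K g) (strand {n}) Y (strand {n}) b' b = Idn (Ch K g) (strand {n})"
    by (rule from_strand_eqI[OF chain_maps_comp[OF b(1) b'(1) sc] chain_maps_id[OF sc]])
       (use sc b b' \<phi> en in auto)
  have 3: "Cmp (Ch K g) (strand {}) X Y f a = Cmp (Ch K g) (strand {}) (strand {n}) Y b (incl {})"
    by (rule from_strand_eqI[OF chain_maps_comp[OF a fc sc] chain_maps_comp[OF i b(1) sc]]) (use Y in auto)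
  have "a' j x = \<zero>\<^bsub>V\<^esub>" if "x \<in> carrier (Md X j)" for j x
    using chain_maps_closed[OF a' that] by (simp add: carrier_strand)
  then have 4: "Cmp (Ch K g) X (strand {}) (strand {n}) (incl {}) a' = Cmp (Ch K g) X Y (strand {n}) b' f"
    by (intro to_strand_eqI[OF chain_maps_comp[OF a' i X] chain_maps_comp[OF fc b'(1) X]])
       (auto simp: b'(2) \<phi>(2)[OF fN] incl_def carrier_strand)
  have ret: "retract_closed (Ch K g) W" using model by (simp add: model_structure_def)
  show "(strand {}, strand {n}, incl {}) \<in> W"
    using ret[unfolded retract_closed_def, rule_format, of a "strand {}" X a' b "strand {n}" Y b' "incl {}" f]
      a a' b b'(1) 1 2 3 4 W incl_arrows(2)[OF n] by simp
qed

lemma sphere_to_disc_if_not_homology_bij: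
  assumes "(X, Y, f) \<in> Cof (Ch_model K g)" "(X, Y, f) \<in> W" "\<not> homology_bij X Y f n"
  shows "(strand {n}, strand {n, n + 1}, incl {n}) \<in> W"
  using assms(3) sphere_to_disc_if_not_injective[OF assms(1,2)] sphere_to_disc_if_not_surjective[OF assms(1,2)]
  unfolding homology_bij_def by blast

end

lemma vector_line_span:
  assumes K: "field K" and M: "module K M" and z: "z \<in> carrier M" "z \<noteq> \<zero>\<^bsub>M\<^esub>"
  shows "vector_line K (M\<lparr>carrier := {a \<odot>\<^bsub>M\<^esub> z | a. a \<in> carrier K}\<rparr>) z"
proof -
  interpret K: field K by fact
  interpret M: module K M by fact
  have "module K (M\<lparr>carrier := {a \<odot>\<^bsub>M\<^esub> z | a. a \<in> carrier K}\<rparr>)"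
  proof (rule submodule_module[OF M])
    show "\<zero>\<^bsub>M\<^esub> \<in> {a \<odot>\<^bsub>M\<^esub> z | a. a \<in> carrier K}" using z by (auto intro!: exI[of _ "\<zero>\<^bsub>K\<^esub>"] simp: M.smult_l_null)
    show "x \<oplus>\<^bsub>M\<^esub> y \<in> {a \<odot>\<^bsub>M\<^esub> z | a. a \<in> carrier K}"
      if xy: "x \<in> {a \<odot>\<^bsub>M\<^esub> z | a. a \<in> carrier K}" "y \<in> {a \<odot>\<^bsub>M\<^esub> z | a. a \<in> carrier K}" for x y
    proof -
      from xy obtain a b where "a \<in> carrier K" "b \<in> carrier K" "x = a \<odot>\<^bsub>M\<^esub> z" "y = b \<odot>\<^bsub>M\<^esub> z" by auto
      then show ?thesis using z by (auto intro!: exI[of _ "a \<oplus>\<^bsub>K\<^esub> b"] simp: M.smult_l_distr)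
    qed
    show "a \<odot>\<^bsub>M\<^esub> x \<in> {a \<odot>\<^bsub>M\<^esub> z | a. a \<in> carrier K}"
      if ax: "a \<in> carrier K" "x \<in> {a \<odot>\<^bsub>M\<^esub> z | a. a \<in> carrier K}" for a x
    proof -
      from ax obtain b where "b \<in> carrier K" "x = b \<odot>\<^bsub>M\<^esub> z" by auto
      then show ?thesis using z ax by (auto intro!: exI[of _ "a \<otimes>\<^bsub>K\<^esub> b"] simp: M.smult_assoc1)
    qed
  qed (use z in auto)
  moreover have "z \<in> {a \<odot>\<^bsub>M\<^esub> z | a. a \<in> carrier K}" using z by (auto intro!: exI[of _ "\<one>\<^bsub>K\<^esub>"])
  ultimately show ?thesis using K z(2) unfolding vector_line_def by auto
qed

text \<open>A map between complexes that vanish in degree \<open>n\<close> is bijective on \<open>H\<^sub>n\<close>, so one of the two contains a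
  nonzero element.\<close>

lemma vector_line_exists:
  fixes X Y :: "('k, 'a) cx"
  assumes K: "field K" and X: "chain_complex K X" and Y: "chain_complex K Y" and f: "f \<in> chain_maps K X Y"
    and nb: "\<not> homology_bij X Y f n"
  shows "\<exists>(V :: ('k, 'a) module) e. vector_line K V e"
proof -
  have "homology_bij X Y f n"
    if X0: "\<And>x. x \<in> carrier (Md X n) \<Longrightarrow> x = \<zero>\<^bsub>Md X n\<^esub>"
      and Y0: "\<And>y. y \<in> carrier (Md Y n) \<Longrightarrow> y = \<zero>\<^bsub>Md Y n\<^esub>"
  proof -
    interpret Y: module K "Md Y n" using Y by (rule chain_complex_module)
    have z: "\<zero>\<^bsub>Md X n\<^esub> \<in> cycles X n"
      using zero_boundary[OF X, of n] boundaries_subset_cycles[OF X, of n] by blast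
    have s: "y = \<zero>\<^bsub>Md Y n\<^esub> \<oplus>\<^bsub>Md Y n\<^esub> f n \<zero>\<^bsub>Md X n\<^esub>" if "y \<in> cycles Y n" for y
      using that Y0[of y] by (simp add: cycles_def chain_maps_zero[OF f X Y])
    show ?thesis
      unfolding homology_bij_def
    proof (intro conjI ballI impI)
      fix x assume "x \<in> cycles X n"
      then show "x \<in> boundaries X n" using X0[of x] zero_boundary[OF X, of n] by (simp add: cycles_def)
    next
      fix y assume "y \<in> cycles Y n"
      then show "\<exists>x \<in> cycles X n. \<exists>b \<in> boundaries Y n. y = b \<oplus>\<^bsub>Md Y n\<^esub> f n x"
        using s z zero_boundary[OF Y, of n] by blast
    qed
  qed
  then consider x where "x \<in> carrier (Md X n)" "x \<noteq> \<zero>\<^bsub>Md X n\<^esub>" | y where "y \<in> carrier (Md Y n)" "y \<noteq> \<zero>\<^bsub>Md Y n\<^esub>"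
    using nb by auto
  then show ?thesis
  proof cases
    case (1 x)
    then show ?thesis using vector_line_span[OF K chain_complex_module[OF X]] by blast
  next
    case (2 y)
    then show ?thesis using vector_line_span[OF K chain_complex_module[OF Y]] by blast
  qed
qed

text \<open>The degrees up to which localization does not change homology.  Asking for all lower degrees as well makes
  the set downward closed.\<close>

definition unchanged_degrees ::
  "(('k, 'a) cx, int \<Rightarrow> 'a \<Rightarrow> 'a) cat \<Rightarrow> (('k, 'a) cx, int \<Rightarrow> 'a \<Rightarrow> 'a, ('k, 'a) cx, int \<Rightarrow> 'a \<Rightarrow> 'a) func \<Rightarrow>
    (('k, 'a) cx \<Rightarrow> int \<Rightarrow> 'a \<Rightarrow> 'a) \<Rightarrow> int set" where
  "unchanged_degrees C R r = {n. \<forall>j \<le> n. \<forall>X \<in> Ob C. homology_bij X (FOb R X) (r X) j}"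

text \<open>A degree outside this set is at least some degree \<open>j\<close> in which some localization map is not bijective on
  homology, so \<open>S\<^sup>j \<rightarrow> D\<^sup>j\<^sup>+\<^sup>1\<close> and all later maps of this kind are local equivalences.\<close>

lemma localization_homology:
  assumes K: "field K" and L: "left_bousfield_localization K g S Q q R r" and X: "X \<in> Ob (Ch K g)"
  shows "n \<in> unchanged_degrees (Ch K g) R r \<Longrightarrow> homology_bij X (FOb R X) (r X) n"
    and "n \<notin> unchanged_degrees (Ch K g) R r \<Longrightarrow> cycles (FOb R X) n \<subseteq> boundaries (FOb R X) n"
proof -
  show "n \<in> unchanged_degrees (Ch K g) R r \<Longrightarrow> homology_bij X (FOb R X) (r X) n"
    using X by (auto simp: unchanged_degrees_def)
  have M: "model_structure (Ch K g) (Loc_model K g S)"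
    and R: "\<And>X. X \<in> Ob (Ch K g) \<Longrightarrow> fibrant (Ch K g) (Loc_model K g S) (FOb R X) \<and>
      (X, FOb R X, r X) \<in> Cof (Loc_model K g S) \<inter> Weq (Loc_model K g S)"
    using L by (auto simp: left_bousfield_localization_def fibrant_replacement_def)
  assume "n \<notin> unchanged_degrees (Ch K g) R r"
  then obtain j Z where j: "j \<le> n" "Z \<in> Ob (Ch K g)" "\<not> homology_bij Z (FOb R Z) (r Z) j"
    by (auto simp: unchanged_degrees_def)
  have Z: "(Z, FOb R Z, r Z) \<in> Cof (Ch_model K g)" "(Z, FOb R Z, r Z) \<in> Weq (Loc_model K g S)"
    using R[OF j(2)] by (auto simp: Loc_model_def)
  have "(Z, FOb R Z, r Z) \<in> Arr (Ch K g)" using Z(1) by (simp add: Ch_model_def llp_def)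
  then have "chain_complex K Z" "chain_complex K (FOb R Z)" "r Z \<in> chain_maps K Z (FOb R Z)"
    by (auto simp: Arr_def dest: Ch_ObD)
  from vector_line_exists[OF K this j(3)] obtain V e where "vector_line K (V :: ('a, 'b) module) e" by blast
  then interpret vector_line K V e .
  interpret localized_line K V e g S by unfold_locales (rule M)
  show "cycles (FOb R X) n \<subseteq> boundaries (FOb R X) n"
    using fibrant_homology_trivial[OF sphere_to_disc_upward[OF sphere_to_disc_if_not_homology_bij[OF Z j(3)] j(1)]]
      R[OF X] by blast
qed

section \<open>Truncation\<close>

text \<open>The quotient of \<open>X\<close> with the homology of \<open>X\<close> in the degrees of a downward closed set \<open>U\<close> and none
  elsewhere.  In the lowest degree \<open>n\<close> outside \<open>U\<close> it is \<open>X\<^sub>n / Z\<^sub>n\<close>, represented by the isomorphic space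
  \<open>d X\<^sub>n \<subseteq> X\<^sub>n\<^sub>-\<^sub>1\<close>: a space of cosets would not lie in the universe.\<close>

definition trunc :: "int set \<Rightarrow> ('k, 'a) cx \<Rightarrow> ('k, 'a) cx" where
  "trunc U X = \<lparr>
     Md = (\<lambda>n. if n \<in> U then Md X n
       else (Md X (n - 1))\<lparr>carrier := if n - 1 \<in> U then boundaries X (n - 1) else {\<zero>\<^bsub>Md X (n - 1)\<^esub>}\<rparr>),
     Df = (\<lambda>n. if n \<in> U then Df X n
       else if n - 1 \<in> U then (\<lambda>x \<in> boundaries X (n - 1). x)
       else (\<lambda>x \<in> {\<zero>\<^bsub>Md X (n - 1)\<^esub>}. \<zero>\<^bsub>Md X (n - 2)\<^esub>))\<rparr>"

definition trunc_map :: "int set \<Rightarrow> ('k, 'a) cx \<Rightarrow> (int \<Rightarrow> 'a \<Rightarrow> 'a) \<Rightarrow> int \<Rightarrow> 'a \<Rightarrow> 'a" where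
  "trunc_map U X f n = (if n \<in> U then f n else (\<lambda>x \<in> carrier (Md (trunc U X) n). f (n - 1) x))"

definition to_trunc :: "int set \<Rightarrow> ('k, 'a) cx \<Rightarrow> int \<Rightarrow> 'a \<Rightarrow> 'a" where
  "to_trunc U X n = (if n \<in> U then (\<lambda>x \<in> carrier (Md X n). x)
     else if n - 1 \<in> U then Df X n else (\<lambda>x \<in> carrier (Md X n). \<zero>\<^bsub>Md X (n - 1)\<^esub>))"

definition down_closed :: "int set \<Rightarrow> bool" where
  "down_closed U \<longleftrightarrow> (\<forall>n \<in> U. \<forall>m \<le> n. m \<in> U)"

lemma down_closed_pred: "down_closed U \<Longrightarrow> n \<in> U \<Longrightarrow> n - 1 \<in> U"
  by (force simp: down_closed_def)

lemma Md_trunc_in [simp]: "n \<in> U \<Longrightarrow> Md (trunc U X) n = Md X n"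
  by (simp add: trunc_def)

lemma carrier_trunc: "carrier (Md (trunc U X) n) = (if n \<in> U then carrier (Md X n)
    else if n - 1 \<in> U then boundaries X (n - 1) else {\<zero>\<^bsub>Md X (n - 1)\<^esub>})"
  by (simp add: trunc_def)

lemma zero_trunc: "\<zero>\<^bsub>Md (trunc U X) n\<^esub> = (if n \<in> U then \<zero>\<^bsub>Md X n\<^esub> else \<zero>\<^bsub>Md X (n - 1)\<^esub>)"
  by (simp add: trunc_def)

lemma add_trunc: "x \<oplus>\<^bsub>Md (trunc U X) n\<^esub> y = (if n \<in> U then x \<oplus>\<^bsub>Md X n\<^esub> y else x \<oplus>\<^bsub>Md X (n - 1)\<^esub> y)"
  by (simp add: trunc_def)

lemma smult_trunc: "a \<odot>\<^bsub>Md (trunc U X) n\<^esub> y = (if n \<in> U then a \<odot>\<^bsub>Md X n\<^esub> y else a \<odot>\<^bsub>Md X (n - 1)\<^esub> y)"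
  by (simp add: trunc_def)

lemma Df_trunc: "x \<in> carrier (Md (trunc U X) n) \<Longrightarrow> Df (trunc U X) n x =
    (if n \<in> U then Df X n x else if n - 1 \<in> U then x else \<zero>\<^bsub>Md X (n - 2)\<^esub>)"
  by (auto simp: carrier_trunc trunc_def)

lemma carrier_trunc_subset:
  "chain_complex K X \<Longrightarrow> n \<notin> U \<Longrightarrow> carrier (Md (trunc U X) n) \<subseteq> carrier (Md X (n - 1))"
  using boundaries_subset[of K X "n - 1"] zero_boundary[of K X "n - 1"] by (auto simp: carrier_trunc)

lemma trunc_module:
  assumes X: "chain_complex K X"
  shows "module K (Md (trunc U X) n)"
proof -
  interpret M: module K "Md X (n - 1)" using X by (rule chain_complex_module)
  have "module K ((Md X (n - 1))\<lparr>carrier := boundaries X (n - 1)\<rparr>)"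
    by (rule submodule_module[OF M.module_axioms boundaries_subset[OF X] zero_boundary[OF X]])
       (simp_all add: boundaries_add[OF X] boundaries_smult[OF X])
  then show ?thesis
    using X zero_module[OF M.module_axioms] by (simp add: trunc_def chain_complex_module)
qed

lemma trunc_complex:
  assumes X: "chain_complex K X" and U: "down_closed U"
  shows "chain_complex K (trunc U X)"
  unfolding chain_complex_def
proof (intro allI conjI ballI)
  fix n
  interpret M2: module K "Md X (n - 2)" using X by (rule chain_complex_module)
  show "module K (Md (trunc U X) n)" by (rule trunc_module[OF X])
  have cl: "Df (trunc U X) n x \<in> carrier (Md (trunc U X) (n - 1))" if x: "x \<in> carrier (Md (trunc U X) n)" for x
  proof (cases "n \<in> U")
    case True
    then show ?thesis using x down_closed_pred[OF U True] Df_closed[OF X] by (simp add: Df_trunc carrier_trunc)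
  next
    case False
    then show ?thesis using x boundaries_subset[OF X, of "n - 1"]
      down_closed_pred[OF U, of "n - 1"] zero_boundary[OF X, of "n - 2"]
      by (auto simp: Df_trunc carrier_trunc)
  qed
  have ext: "Df (trunc U X) n \<in> extensional (carrier (Md (trunc U X) n))"
    using Df_lin[OF X, of n] by (auto simp: trunc_def linmaps_def PiE_def)
  have "Df (trunc U X) n (x \<oplus>\<^bsub>Md (trunc U X) n\<^esub> y) =
      Df (trunc U X) n x \<oplus>\<^bsub>Md (trunc U X) (n - 1)\<^esub> Df (trunc U X) n y"
    if x: "x \<in> carrier (Md (trunc U X) n)" and y: "y \<in> carrier (Md (trunc U X) n)" for x y
  proof -
    interpret T: module K "Md (trunc U X) n" by (rule trunc_module[OF X])
    show ?thesis
      unfolding Df_trunc[OF x] Df_trunc[OF y] Df_trunc[OF T.a_closed[OF x y]]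
      using x y linmaps_add[OF Df_lin[OF X]] down_closed_pred[OF U, of n]
      by (auto simp: carrier_trunc add_trunc)
  qed
  moreover have "Df (trunc U X) n (a \<odot>\<^bsub>Md (trunc U X) n\<^esub> x) =
      a \<odot>\<^bsub>Md (trunc U X) (n - 1)\<^esub> Df (trunc U X) n x"
    if a: "a \<in> carrier K" and x: "x \<in> carrier (Md (trunc U X) n)" for x a
  proof -
    interpret T: module K "Md (trunc U X) n" by (rule trunc_module[OF X])
    show ?thesis
      unfolding Df_trunc[OF x] Df_trunc[OF T.smult_closed[OF a x]]
      using x a linmaps_smult[OF Df_lin[OF X]] down_closed_pred[OF U, of n]
      by (auto simp: carrier_trunc smult_trunc M2.smult_r_null)
  qed
  ultimately show "Df (trunc U X) n \<in> linmaps K (Md (trunc U X) n) (Md (trunc U X) (n - 1))"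
    using cl ext by (intro linmapsI)
  fix x assume x: "x \<in> carrier (Md (trunc U X) n)"
  show "Df (trunc U X) (n - 1) (Df (trunc U X) n x) = \<zero>\<^bsub>Md (trunc U X) (n - 2)\<^esub>"
  proof (cases "n \<in> U")
    case True
    then have "n - 1 \<in> U" "n - 2 \<in> U" using U by (auto simp: down_closed_def)
    then show ?thesis using True x Df_Df[OF X] Df_closed[OF X]
      by (simp add: Df_trunc[OF cl[OF x]] zero_trunc) (simp add: Df_trunc carrier_trunc)
  next
    case False
    show ?thesis
    proof (cases "n - 1 \<in> U")
      case True
      then have "n - 2 \<in> U" using U by (auto simp: down_closed_def)
      moreover have "x \<in> cycles X (n - 1)"
        using x False True boundaries_subset_cycles[OF X, of "n - 1"] by (auto simp: carrier_trunc)
      ultimately show ?thesis using x False True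
        by (simp add: Df_trunc[OF cl[OF x]] zero_trunc) (simp add: Df_trunc cycles_def)
    next
      case n: False
      then have "Df (trunc U X) n x = \<zero>\<^bsub>Md X (n - 2)\<^esub>" using False Df_trunc[OF x] by simp
      then show ?thesis using n Df_trunc[OF cl[OF x]] by (simp add: zero_trunc)
    qed
  qed
qed

lemma trunc_Ob:
  assumes X: "X \<in> Ob (Ch K g)" and U: "down_closed U"
  shows "trunc U X \<in> Ob (Ch K g)"
proof -
  have "carrier (Md (trunc U X) n) = {\<zero>\<^bsub>Md (trunc U X) n\<^esub>}" if g: "g = NonNeg" and n: "n < 0" for n
  proof -
    have 0: "carrier (Md X m) = {\<zero>\<^bsub>Md X m\<^esub>}" if "m < 0" for m using Ch_Ob_neg[of X K m] X g that by simp
    have "boundaries X (n - 1) = {\<zero>\<^bsub>Md X (n - 1)\<^esub>}"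
      using boundaries_subset[OF Ch_ObD[OF X], of "n - 1"] zero_boundary[OF Ch_ObD[OF X], of "n - 1"] 0[of "n - 1"] n
      by auto
    then show ?thesis using 0[OF n] by (simp add: carrier_trunc zero_trunc)
  qed
  then show ?thesis using trunc_complex[OF Ch_ObD[OF X] U] by (simp add: Ch_def)
qed

lemma to_trunc_surj:
  assumes X: "chain_complex K X"
  shows "to_trunc U X n ` carrier (Md X n) = carrier (Md (trunc U X) n)"
proof -
  interpret M: module K "Md X n" using X by (rule chain_complex_module)
  show ?thesis using M.zero_closed by (auto simp: to_trunc_def carrier_trunc boundaries_def)
qed

lemma to_trunc_lin:
  assumes X: "chain_complex K X"
  shows "to_trunc U X n \<in> linmaps K (Md X n) (Md (trunc U X) n)"
proof -
  interpret M: module K "Md X (n - 1)" using X by (rule chain_complex_module)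
  interpret M0: module K "Md X n" using X by (rule chain_complex_module)
  have "to_trunc U X n x \<in> carrier (Md (trunc U X) n)" if "x \<in> carrier (Md X n)" for x
    using to_trunc_surj[OF X, of U n] that by blast
  moreover have "to_trunc U X n \<in> extensional (carrier (Md X n))"
    using Df_lin[OF X, of n] by (auto simp: to_trunc_def linmaps_def PiE_def)
  moreover have "to_trunc U X n (x \<oplus>\<^bsub>Md X n\<^esub> y) = to_trunc U X n x \<oplus>\<^bsub>Md (trunc U X) n\<^esub> to_trunc U X n y"
    if "x \<in> carrier (Md X n)" "y \<in> carrier (Md X n)" for x y
    using that linmaps_add[OF Df_lin[OF X]] by (simp add: to_trunc_def add_trunc)
  moreover have "to_trunc U X n (a \<odot>\<^bsub>Md X n\<^esub> x) = a \<odot>\<^bsub>Md (trunc U X) n\<^esub> to_trunc U X n x"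
    if "a \<in> carrier K" "x \<in> carrier (Md X n)" for a x
    using that linmaps_smult[OF Df_lin[OF X]] by (simp add: to_trunc_def smult_trunc M.smult_r_null)
  ultimately show ?thesis by (intro linmapsI)
qed

lemma to_trunc_chain_map:
  assumes X: "chain_complex K X" and U: "down_closed U"
  shows "to_trunc U X \<in> chain_maps K X (trunc U X)"
proof -
  have "to_trunc U X (n - 1) (Df X n x) = Df (trunc U X) n (to_trunc U X n x)"
    if x: "x \<in> carrier (Md X n)" for n x
    unfolding Df_trunc[OF linmaps_closed[OF to_trunc_lin[OF X] x]]
    using x down_closed_pred[OF U, of n] down_closed_pred[OF U, of "n - 1"] Df_closed[OF X x] Df_Df[OF X x]
    by (auto simp: to_trunc_def)
  then show ?thesis using to_trunc_lin[OF X] by (simp add: chain_maps_def)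
qed

lemma trunc_map_apply: "x \<in> carrier (Md (trunc U X) n) \<Longrightarrow>
    trunc_map U X f n x = (if n \<in> U then f n x else f (n - 1) x)"
  by (simp add: trunc_map_def)

lemma trunc_map_chain_map:
  assumes X: "chain_complex K X" and Y: "chain_complex K Y" and f: "f \<in> chain_maps K X Y"
    and U: "down_closed U"
  shows "trunc_map U X f \<in> chain_maps K (trunc U X) (trunc U Y)"
  unfolding chain_maps_def
proof (intro CollectI allI conjI ballI)
  fix n
  have cl: "trunc_map U X f n x \<in> carrier (Md (trunc U Y) n)" if x: "x \<in> carrier (Md (trunc U X) n)" for x
    using x chain_maps_closed[OF f] chain_maps_boundaries[OF f, of x "n - 1"] chain_maps_zero[OF f X Y]
    by (auto simp: trunc_map_def carrier_trunc split: if_splits)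
  have ext: "trunc_map U X f n \<in> extensional (carrier (Md (trunc U X) n))"
    using chain_maps_lin[OF f, of n] by (auto simp: trunc_map_def linmaps_def PiE_def)
  interpret T: module K "Md (trunc U X) n" by (rule trunc_module[OF X])
  have sub: "x \<in> carrier (Md X (n - 1))" if "n \<notin> U" "x \<in> carrier (Md (trunc U X) n)" for x
    using carrier_trunc_subset[OF X that(1)] that(2) by blast
  have "trunc_map U X f n (x \<oplus>\<^bsub>Md (trunc U X) n\<^esub> y) =
      trunc_map U X f n x \<oplus>\<^bsub>Md (trunc U Y) n\<^esub> trunc_map U X f n y"
    if x: "x \<in> carrier (Md (trunc U X) n)" and y: "y \<in> carrier (Md (trunc U X) n)" for x y
    unfolding trunc_map_apply[OF x] trunc_map_apply[OF y] trunc_map_apply[OF T.a_closed[OF x y]]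
    using x y sub[OF _ x] sub[OF _ y] linmaps_add[OF chain_maps_lin[OF f]] by (auto simp: add_trunc)
  moreover have "trunc_map U X f n (a \<odot>\<^bsub>Md (trunc U X) n\<^esub> x) =
      a \<odot>\<^bsub>Md (trunc U Y) n\<^esub> trunc_map U X f n x"
    if a: "a \<in> carrier K" and x: "x \<in> carrier (Md (trunc U X) n)" for a x
    unfolding trunc_map_apply[OF x] trunc_map_apply[OF T.smult_closed[OF a x]]
    using a x sub[OF _ x] linmaps_smult[OF chain_maps_lin[OF f]] by (auto simp: smult_trunc)
  ultimately show "trunc_map U X f n \<in> linmaps K (Md (trunc U X) n) (Md (trunc U Y) n)"
    using cl ext by (intro linmapsI)
  fix x assume x: "x \<in> carrier (Md (trunc U X) n)"
  have dx: "Df (trunc U X) n x \<in> carrier (Md (trunc U X) (n - 1))"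
    using Df_closed[OF trunc_complex[OF X U] x] .
  show "trunc_map U X f (n - 1) (Df (trunc U X) n x) = Df (trunc U Y) n (trunc_map U X f n x)"
    using trunc_map_apply[OF dx] Df_trunc[OF cl[OF x]] trunc_map_apply[OF x] Df_trunc[OF x]
      down_closed_pred[OF U, of n] chain_maps_Df[OF f, of x n] x chain_maps_zero[OF f X Y, of "n - 2"]
    by (simp split: if_splits)
qed

lemma trunc_map_natural:
  assumes X: "chain_complex K X" and Y: "chain_complex K Y" and f: "f \<in> chain_maps K X Y"
    and U: "down_closed U" and x: "x \<in> carrier (Md X n)"
  shows "trunc_map U X f n (to_trunc U X n x) = to_trunc U Y n (f n x)"
  unfolding trunc_map_apply[OF linmaps_closed[OF to_trunc_lin[OF X] x]]
  using x chain_maps_closed[OF f x] chain_maps_Df[OF f x] chain_maps_zero[OF f X Y, of "n - 1"]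
  by (simp add: to_trunc_def)

lemma trunc_map_id:
  assumes X: "chain_complex K X" and U: "down_closed U"
  shows "trunc_map U X (Idn (Ch K g) X) = Idn (Ch K g) (trunc U X)"
proof (rule chain_maps_eqI[OF trunc_map_chain_map[OF X X chain_maps_id[OF X] U] chain_maps_id[OF trunc_complex[OF X U]]])
  fix n x assume x: "x \<in> carrier (Md (trunc U X) n)"
  then show "trunc_map U X (Idn (Ch K g) X) n x = Idn (Ch K g) (trunc U X) n x"
    using subsetD[OF carrier_trunc_subset[OF X]] by (cases "n \<in> U") (simp_all add: trunc_map_apply)
qed

lemma trunc_map_comp:
  assumes X: "chain_complex K X" and Y: "chain_complex K Y" and Z: "chain_complex K Z"
    and f: "f \<in> chain_maps K X Y" and f': "f' \<in> chain_maps K Y Z" and U: "down_closed U"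
  shows "trunc_map U X (Cmp (Ch K g) X Y Z f' f) =
    Cmp (Ch K g) (trunc U X) (trunc U Y) (trunc U Z) (trunc_map U Y f') (trunc_map U X f)"
proof (rule chain_maps_eqI[OF trunc_map_chain_map[OF X Z chain_maps_comp[OF f f' X] U]
      chain_maps_comp[OF trunc_map_chain_map[OF X Y f U] trunc_map_chain_map[OF Y Z f' U] trunc_complex[OF X U]]])
  fix n x assume x: "x \<in> carrier (Md (trunc U X) n)"
  have fx: "trunc_map U X f n x \<in> carrier (Md (trunc U Y) n)"
    using chain_maps_closed[OF trunc_map_chain_map[OF X Y f U] x] .
  show "trunc_map U X (Cmp (Ch K g) X Y Z f' f) n x =
      Cmp (Ch K g) (trunc U X) (trunc U Y) (trunc U Z) (trunc_map U Y f') (trunc_map U X f) n x"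
    using x fx subsetD[OF carrier_trunc_subset[OF X] x] by (cases "n \<in> U") (simp_all add: trunc_map_apply)
qed

lemma cycles_trunc_in: "n \<in> U \<Longrightarrow> down_closed U \<Longrightarrow> cycles (trunc U X) n = cycles X n"
  using down_closed_pred[of U n] by (auto simp: cycles_def carrier_trunc Df_trunc zero_trunc)

lemma boundaries_trunc_in:
  assumes "n \<in> U" shows "boundaries (trunc U X) n = boundaries X n"
proof -
  have "Df (trunc U X) (n + 1) ` carrier (Md (trunc U X) (n + 1)) = boundaries X n"
  proof (cases "n + 1 \<in> U")
    case True
    then have "Df (trunc U X) (n + 1) = Df X (n + 1)" by (simp add: trunc_def)
    then show ?thesis using True by (simp add: boundaries_def)
  next
    case False
    then have "carrier (Md (trunc U X) (n + 1)) = boundaries X n" using assms by (simp add: carrier_trunc)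
    moreover have "Df (trunc U X) (n + 1) = (\<lambda>x \<in> boundaries X n. x)"
      using assms False by (simp add: trunc_def)
    ultimately show ?thesis by simp
  qed
  then show ?thesis by (simp add: boundaries_def)
qed

lemma cycles_trunc_out:
  "n \<notin> U \<Longrightarrow> down_closed U \<Longrightarrow> cycles (trunc U X) n \<subseteq> {\<zero>\<^bsub>Md (trunc U X) n\<^esub>}"
  by (auto simp: cycles_def carrier_trunc Df_trunc zero_trunc split: if_splits)

lemma homology_bij_trivial:
  assumes X: "chain_complex K X" and Y: "chain_complex K Y" and f: "f \<in> chain_maps K X Y"
    and cX: "cycles X n \<subseteq> boundaries X n" and cY: "cycles Y n \<subseteq> {\<zero>\<^bsub>Md Y n\<^esub>}"
  shows "homology_bij X Y f n"
  unfolding homology_bij_def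
proof (intro conjI ballI impI)
  fix y assume "y \<in> cycles Y n"
  interpret Y: module K "Md Y n" using Y by (rule chain_complex_module)
  have "y = \<zero>\<^bsub>Md Y n\<^esub> \<oplus>\<^bsub>Md Y n\<^esub> f n \<zero>\<^bsub>Md X n\<^esub>"
    using cY \<open>y \<in> cycles Y n\<close> by (auto simp: chain_maps_zero[OF f X Y])
  moreover have "\<zero>\<^bsub>Md X n\<^esub> \<in> cycles X n"
    using zero_boundary[OF X, of n] boundaries_subset_cycles[OF X, of n] by blast
  ultimately show "\<exists>x \<in> cycles X n. \<exists>b \<in> boundaries Y n. y = b \<oplus>\<^bsub>Md Y n\<^esub> f n x"
    using zero_boundary[OF Y, of n] by blast
qed (use cX in blast)

lemma trunc_map_quasi_iso:
  assumes f: "(X, Y, f) \<in> Arr (Ch K g)" and U: "down_closed U"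
    and bij: "\<And>n. n \<in> U \<Longrightarrow> homology_bij X Y f n"
  shows "(trunc U X, trunc U Y, trunc_map U X f) \<in> quasi_isos K g"
proof -
  have X: "chain_complex K X" and Y: "chain_complex K Y" and fc: "f \<in> chain_maps K X Y"
    and ob: "X \<in> Ob (Ch K g)" "Y \<in> Ob (Ch K g)"
    using f by (auto simp: Arr_def dest: Ch_ObD)
  note tf = trunc_map_chain_map[OF X Y fc U] and tX = trunc_complex[OF X U] and tY = trunc_complex[OF Y U]
  have "homology_bij (trunc U X) (trunc U Y) (trunc_map U X f) n" for n
  proof (cases "n \<in> U")
    case True
    then show ?thesis using bij[OF True]
      by (simp add: homology_bij_def cycles_trunc_in[OF True U] boundaries_trunc_in[OF True] trunc_map_def)
  next
    case False
    have "cycles (trunc U X) n \<subseteq> boundaries (trunc U X) n"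
      using cycles_trunc_out[OF False U, of X] zero_boundary[OF tX, of n] by auto
    then show ?thesis by (rule homology_bij_trivial[OF tX tY tf _ cycles_trunc_out[OF False U]])
  qed
  then show ?thesis using tf trunc_Ob[OF _ U] ob by (auto simp: quasi_isos_iff Arr_def)
qed

lemma to_trunc_quasi_iso:
  assumes ob: "X \<in> Ob (Ch K g)" and U: "down_closed U"
    and triv: "\<And>n. n \<notin> U \<Longrightarrow> cycles X n \<subseteq> boundaries X n"
  shows "(X, trunc U X, to_trunc U X) \<in> quasi_isos K g"
proof -
  have X: "chain_complex K X" using ob by (rule Ch_ObD)
  note t = to_trunc_chain_map[OF X U] and tX = trunc_complex[OF X U]
  have "homology_bij X (trunc U X) (to_trunc U X) n" for n
  proof (cases "n \<in> U")
    case True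
    interpret M: module K "Md X n" using X by (rule chain_complex_module)
    have "y = \<zero>\<^bsub>Md X n\<^esub> \<oplus>\<^bsub>Md X n\<^esub> to_trunc U X n y" if "y \<in> cycles X n" for y
      using True that by (simp add: to_trunc_def cycles_def)
    moreover have "to_trunc U X n x = x" if "x \<in> cycles X n" for x
      using True that by (simp add: to_trunc_def cycles_def)
    ultimately show ?thesis
      using zero_boundary[OF X, of n]
      unfolding homology_bij_def cycles_trunc_in[OF True U] boundaries_trunc_in[OF True] Md_trunc_in[OF True]
      by metis
  next
    case False
    then show ?thesis by (intro homology_bij_trivial[OF X tX t triv cycles_trunc_out[OF _ U]])
  qed
  then show ?thesis using t trunc_Ob[OF ob U] ob by (auto simp: quasi_isos_iff Arr_def)
qed

section \<open>Quotients of algebras\<close>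

lemma linmaps_finsum:
  assumes f: "f \<in> linmaps K M N" and M: "module K M" and N: "module K N"
    and A: "finite A" and h: "\<And>i. i \<in> A \<Longrightarrow> h i \<in> carrier M"
  shows "f (finsum M h A) = finsum N (\<lambda>i. f (h i)) A"
proof -
  interpret M: module K M by fact
  interpret N: module K N by fact
  show ?thesis using A h
  proof (induction A rule: finite_induct)
    case empty
    then show ?case using linmaps_zero[OF f M N] by simp
  next
    case (insert a A)
    then have c: "h \<in> A \<rightarrow> carrier M" "h a \<in> carrier M" by auto
    have c': "(\<lambda>i. f (h i)) \<in> A \<rightarrow> carrier N" "f (h a) \<in> carrier N"
      using insert linmaps_closed[OF f] by auto
    show ?case
      using insert c c' by (simp add: M.finsum_insert N.finsum_insert linmaps_add[OF f] M.finsum_closed)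
  qed
qed

lemma linmaps_signed:
  "f \<in> linmaps K M N \<Longrightarrow> module K M \<Longrightarrow> module K N \<Longrightarrow> x \<in> carrier M \<Longrightarrow>
     f (signed M s x) = signed N s (f x)"
  by (simp add: signed_def linmaps_uminus)

lemma signed_closed: "module K M \<Longrightarrow> x \<in> carrier M \<Longrightarrow> signed M s x \<in> carrier M"
proof -
  assume "module K M" and x: "x \<in> carrier M"
  then interpret M: module K M by simp
  show ?thesis using x by (simp add: signed_def)
qed

definition tensor_map ::
  "('i \<Rightarrow> int \<Rightarrow> 'a \<Rightarrow> 'a) \<Rightarrow> 'i list \<Rightarrow> (int \<times> 'a) list \<Rightarrow> (int \<times> 'a) list" where
  "tensor_map f cs us = map2 (\<lambda>c (n, a). (n, f c n a)) cs us"

lemma tensors_map_iff: "us \<in> tensors (map F cs) \<longleftrightarrow> length us = length cs \<and>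
    (\<forall>i < length cs. snd (us ! i) \<in> carrier (Md (F (cs ! i)) (fst (us ! i))))"
  by (auto simp: tensors_def list_all2_conv_all_nth helems_def case_prod_beta)

lemma helems_iff: "p \<in> helems X \<longleftrightarrow> snd p \<in> carrier (Md X (fst p))"
  by (auto simp: helems_def case_prod_beta)

lemma tensors_Nil [simp]: "us \<in> tensors [] \<longleftrightarrow> us = []"
  by (auto simp: tensors_def)

lemma tensors_Cons [simp]: "p # us \<in> tensors (X # Xs) \<longleftrightarrow> p \<in> helems X \<and> us \<in> tensors Xs"
  by (auto simp: tensors_def)

lemma length_tensor_map [simp]: "length (tensor_map f cs us) = min (length cs) (length us)"
  by (simp add: tensor_map_def)

lemma nth_tensor_map: "i < length cs \<Longrightarrow> i < length us \<Longrightarrow>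
    tensor_map f cs us ! i = (fst (us ! i), f (cs ! i) (fst (us ! i)) (snd (us ! i)))"
  by (simp add: tensor_map_def case_prod_beta)

lemma tensor_map_Cons [simp]:
  "tensor_map f (c # cs) (u # us) = (fst u, f c (fst u) (snd u)) # tensor_map f cs us"
  by (simp add: tensor_map_def case_prod_beta)

lemma tensor_map_Nil [simp]: "tensor_map f [] us = []" "tensor_map f cs [] = []"
  by (auto simp: tensor_map_def)

lemma tensor_map_append: "length cs = length us \<Longrightarrow>
    tensor_map f (cs @ cs') (us @ us') = tensor_map f cs us @ tensor_map f cs' us'"
  by (simp add: tensor_map_def)

lemma tensor_map_concat: "list_all2 (\<lambda>us cs. length us = length cs) uss css \<Longrightarrow>
    tensor_map f (concat css) (concat uss) = concat (map2 (tensor_map f) css uss)"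
  by (induction uss css rule: list_all2_induct) (auto simp: tensor_map_append)

lemma map_fst_tensor_map: "length us = length cs \<Longrightarrow> map fst (tensor_map f cs us) = map fst us"
  by (induction us cs rule: list_induct2) auto

lemma deg_tensor_map: "length us = length cs \<Longrightarrow> deg (tensor_map f cs us) = deg us"
  by (simp add: deg_def map_fst_tensor_map)

lemma deg_Cons [simp]: "deg (u # us) = fst u + deg us"
  by (simp add: deg_def)

lemma deg_Nil [simp]: "deg [] = 0"
  by (simp add: deg_def)

lemma deg_append: "deg (us @ vs) = deg us + deg vs"
  by (simp add: deg_def)

lemma tensor_map_update: "i < length us \<Longrightarrow> length us = length cs \<Longrightarrow>
    (tensor_map f cs us)[i := (n, f (cs ! i) n a)] = tensor_map f cs (us[i := (n, a)])"
  by (rule nth_equalityI) (auto simp: nth_tensor_map nth_list_update)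

lemma deg_update: "i < length us \<Longrightarrow> deg (us[i := (n, a)]) = deg us - fst (us ! i) + n"
proof (induction us arbitrary: i)
  case (Cons u us)
  then show ?case by (cases i) auto
qed simp

lemma tensor_map_tensors:
  assumes "us \<in> tensors (map F cs)" "\<And>c. c \<in> set cs \<Longrightarrow> f c \<in> chain_maps K (F c) (G c)"
  shows "tensor_map f cs us \<in> tensors (map G cs)"
  using assms(1) chain_maps_closed[OF assms(2)[OF nth_mem]] by (simp add: tensors_map_iff nth_tensor_map)

lemma tensor_map_surj:
  assumes vs: "vs \<in> tensors (map G cs)"
    and surj: "\<And>c n. c \<in> set cs \<Longrightarrow> f c n ` carrier (Md (F c) n) = carrier (Md (G c) n)"
  shows "\<exists>us \<in> tensors (map F cs). tensor_map f cs us = vs"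
proof -
  have "\<exists>a. a \<in> carrier (Md (F (cs ! i)) (fst (vs ! i))) \<and> f (cs ! i) (fst (vs ! i)) a = snd (vs ! i)"
    if "i < length cs" for i
  proof -
    have "snd (vs ! i) \<in> f (cs ! i) (fst (vs ! i)) ` carrier (Md (F (cs ! i)) (fst (vs ! i)))"
      using vs that surj[OF nth_mem[OF that]] by (simp add: tensors_map_iff)
    then show ?thesis by (metis imageE)
  qed
  then obtain a where a: "\<And>i. i < length cs \<Longrightarrow> a i \<in> carrier (Md (F (cs ! i)) (fst (vs ! i))) \<and>
      f (cs ! i) (fst (vs ! i)) (a i) = snd (vs ! i)" by metis
  define us where "us = map (\<lambda>i. (fst (vs ! i), a i)) [0..<length cs]"
  have "us \<in> tensors (map F cs)" using a by (simp add: tensors_map_iff us_def)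
  moreover have "tensor_map f cs us = vs"
    by (rule nth_equalityI) (use a vs in \<open>auto simp: us_def nth_tensor_map tensors_map_iff\<close>)
  ultimately show ?thesis by blast
qed

lemma multi_chain_mapD:
  assumes "multi_chain_map K Xs Y f" "us \<in> tensors Xs"
  shows multi_chain_map_closed: "f us \<in> carrier (Md Y (deg us))"
    and multi_chain_map_add: "i < length us \<Longrightarrow> y \<in> carrier (Md (Xs ! i) (fst (us ! i))) \<Longrightarrow>
      f (us[i := (fst (us ! i), snd (us ! i) \<oplus>\<^bsub>Md (Xs ! i) (fst (us ! i))\<^esub> y)]) =
      f us \<oplus>\<^bsub>Md Y (deg us)\<^esub> f (us[i := (fst (us ! i), y)])"
    and multi_chain_map_smult: "i < length us \<Longrightarrow> a \<in> carrier K \<Longrightarrow>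
      f (us[i := (fst (us ! i), a \<odot>\<^bsub>Md (Xs ! i) (fst (us ! i))\<^esub> snd (us ! i))]) =
      a \<odot>\<^bsub>Md Y (deg us)\<^esub> f us"
    and multi_chain_map_Df: "Df Y (deg us) (f us) =
       finsum (Md Y (deg us - 1))
         (\<lambda>i. signed (Md Y (deg us - 1)) (deg (take i us))
            (f (us[i := (fst (us ! i) - 1, Df (Xs ! i) (fst (us ! i)) (snd (us ! i)))])))
         {..<length us}"
  using assms by (auto simp: multi_chain_map_def)

text \<open>All conditions on a multilinear chain map are equations between its values, so they descend along
  surjections.\<close>

lemma multi_chain_map_quotient:
  assumes m: "multi_chain_map K (map F cs) Z m"
    and f: "\<And>c. c \<in> set cs \<Longrightarrow> f c \<in> chain_maps K (F c) (G c)"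
    and surj: "\<And>c n. c \<in> set cs \<Longrightarrow> f c n ` carrier (Md (F c) n) = carrier (Md (G c) n)"
    and F: "\<And>c. c \<in> set cs \<Longrightarrow> chain_complex K (F c)"
    and Z: "chain_complex K Z" and W: "chain_complex K W" and \<pi>: "\<pi> \<in> chain_maps K Z W"
    and m': "\<And>us. us \<in> tensors (map F cs) \<Longrightarrow> m' (tensor_map f cs us) = \<pi> (deg us) (m us)"
  shows "multi_chain_map K (map G cs) W m'"
  unfolding multi_chain_map_def
proof
  fix vs assume "vs \<in> tensors (map G cs)"
  from tensor_map_surj[OF this surj] obtain us where us: "us \<in> tensors (map F cs)" "vs = tensor_map f cs us"
    by blast
  have len: "length us = length cs" using us(1) by (simp add: tensors_map_iff)
  have len': "length vs = length us" using us len by simp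
  have dg: "deg vs = deg us" using deg_tensor_map[OF len] us by simp
  have nth: "fst (vs ! i) = fst (us ! i)" "snd (vs ! i) = f (cs ! i) (fst (us ! i)) (snd (us ! i))"
    "snd (us ! i) \<in> carrier (Md (F (cs ! i)) (fst (us ! i)))" "cs ! i \<in> set cs" if "i < length us" for i
    using that us len by (auto simp: nth_tensor_map tensors_map_iff)
  note \<pi>l = chain_maps_lin[OF \<pi>]
  have upd: "us[i := (n, a)] \<in> tensors (map F cs)"
    if "i < length us" "a \<in> carrier (Md (F (cs ! i)) n)" for i n a
    using that us(1) by (auto simp: tensors_map_iff nth_list_update)
  have upd': "m' (vs[i := (n, f (cs ! i) n a)]) = \<pi> (deg us - fst (us ! i) + n) (m (us[i := (n, a)]))"
    if "i < length us" "a \<in> carrier (Md (F (cs ! i)) n)" for i n a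
    using m'[OF upd[OF that]] tensor_map_update[OF that(1) len] deg_update[OF that(1)] us(2) by simp
  have closed: "m us \<in> carrier (Md Z (deg us))" using multi_chain_map_closed[OF m us(1)] .
  have m'vs: "m' vs = \<pi> (deg us) (m us)" using m'[OF us(1)] us(2) by simp
  show "m' vs \<in> carrier (Md W (deg vs)) \<and>
     (\<forall>i < length vs. \<forall>y \<in> carrier (Md (map G cs ! i) (fst (vs ! i))).
        m' (vs[i := (fst (vs ! i), snd (vs ! i) \<oplus>\<^bsub>Md (map G cs ! i) (fst (vs ! i))\<^esub> y)]) =
        m' vs \<oplus>\<^bsub>Md W (deg vs)\<^esub> m' (vs[i := (fst (vs ! i), y)])) \<and>
     (\<forall>i < length vs. \<forall>a \<in> carrier K.
        m' (vs[i := (fst (vs ! i), a \<odot>\<^bsub>Md (map G cs ! i) (fst (vs ! i))\<^esub> snd (vs ! i))]) =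
        a \<odot>\<^bsub>Md W (deg vs)\<^esub> m' vs) \<and>
     Df W (deg vs) (m' vs) =
       finsum (Md W (deg vs - 1))
         (\<lambda>i. signed (Md W (deg vs - 1)) (deg (take i vs))
            (m' (vs[i := (fst (vs ! i) - 1, Df (map G cs ! i) (fst (vs ! i)) (snd (vs ! i)))])))
         {..<length vs}"
  proof (intro conjI allI impI ballI)
    show "m' vs \<in> carrier (Md W (deg vs))" unfolding m'vs dg by (rule chain_maps_closed[OF \<pi> closed])
  next
    fix i y assume i: "i < length vs" and y: "y \<in> carrier (Md (map G cs ! i) (fst (vs ! i)))"
    have i': "i < length us" "i < length cs" using i len len' by auto
    note n = nth[OF i'(1)]
    have y': "y \<in> f (cs ! i) (fst (us ! i)) ` carrier (Md (F (cs ! i)) (fst (us ! i)))"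
      using y i' n(1) surj[OF n(4)] by simp
    then obtain x where x: "x \<in> carrier (Md (F (cs ! i)) (fst (us ! i)))" "y = f (cs ! i) (fst (us ! i)) x" by auto
    interpret M: module K "Md (F (cs ! i)) (fst (us ! i))" using F[OF n(4)] by (rule chain_complex_module)
    have e: "snd (vs ! i) \<oplus>\<^bsub>Md (map G cs ! i) (fst (vs ! i))\<^esub> y =
        f (cs ! i) (fst (us ! i)) (snd (us ! i) \<oplus>\<^bsub>Md (F (cs ! i)) (fst (us ! i))\<^esub> x)"
      using n x i' linmaps_add[OF chain_maps_lin[OF f[OF n(4)]] n(3) x(1)] by simp
    have a: "m (us[i := (fst (us ! i), snd (us ! i) \<oplus>\<^bsub>Md (F (cs ! i)) (fst (us ! i))\<^esub> x)]) =
        m us \<oplus>\<^bsub>Md Z (deg us)\<^esub> m (us[i := (fst (us ! i), x)])"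
      using multi_chain_map_add[OF m us(1) i'(1), of x] x i' by simp
    have c: "m (us[i := (fst (us ! i), x)]) \<in> carrier (Md Z (deg us))"
      using multi_chain_map_closed[OF m upd[OF i'(1) x(1)]] deg_update[OF i'(1)] by simp
    show "m' (vs[i := (fst (vs ! i), snd (vs ! i) \<oplus>\<^bsub>Md (map G cs ! i) (fst (vs ! i))\<^esub> y)]) =
        m' vs \<oplus>\<^bsub>Md W (deg vs)\<^esub> m' (vs[i := (fst (vs ! i), y)])"
      unfolding e unfolding n(1) x(2) upd'[OF i'(1) M.a_closed[OF n(3) x(1)]] upd'[OF i'(1) x(1)] m'vs dg a
      using linmaps_add[OF \<pi>l closed c] by simp
  next
    fix i a assume i: "i < length vs" and a: "a \<in> carrier K"
    have i': "i < length us" "i < length cs" using i len len' by auto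
    note n = nth[OF i'(1)]
    interpret M: module K "Md (F (cs ! i)) (fst (us ! i))" using F[OF n(4)] by (rule chain_complex_module)
    have e: "a \<odot>\<^bsub>Md (map G cs ! i) (fst (vs ! i))\<^esub> snd (vs ! i) =
        f (cs ! i) (fst (us ! i)) (a \<odot>\<^bsub>Md (F (cs ! i)) (fst (us ! i))\<^esub> snd (us ! i))"
      using n i' linmaps_smult[OF chain_maps_lin[OF f[OF n(4)]] a n(3)] by simp
    have s: "m (us[i := (fst (us ! i), a \<odot>\<^bsub>Md (F (cs ! i)) (fst (us ! i))\<^esub> snd (us ! i))]) =
        a \<odot>\<^bsub>Md Z (deg us)\<^esub> m us"
      using multi_chain_map_smult[OF m us(1) i'(1) a] i' by simp
    show "m' (vs[i := (fst (vs ! i), a \<odot>\<^bsub>Md (map G cs ! i) (fst (vs ! i))\<^esub> snd (vs ! i))]) =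
        a \<odot>\<^bsub>Md W (deg vs)\<^esub> m' vs"
      unfolding e unfolding n(1) upd'[OF i'(1) M.smult_closed[OF a n(3)]] m'vs dg s
      using linmaps_smult[OF \<pi>l a closed] by simp
  next
    let ?d = "\<lambda>i. us[i := (fst (us ! i) - 1, Df (F (cs ! i)) (fst (us ! i)) (snd (us ! i)))]"
    have dc: "m (?d i) \<in> carrier (Md Z (deg us - 1))" if "i < length us" for i
      using multi_chain_map_closed[OF m upd[OF that Df_closed[OF F[OF nth(4)[OF that]] nth(3)[OF that]]]]
        deg_update[OF that] by simp
    have summand: "\<pi> (deg us - 1) (signed (Md Z (deg us - 1)) (deg (take i us)) (m (?d i))) =
        signed (Md W (deg vs - 1)) (deg (take i vs))
          (m' (vs[i := (fst (vs ! i) - 1, Df (map G cs ! i) (fst (vs ! i)) (snd (vs ! i)))]))"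
      if i: "i < length us" for i
    proof -
      note n = nth[OF i]
      have dt: "deg (take i vs) = deg (take i us)"
        using map_fst_tensor_map[OF len, of f] us(2) by (simp add: deg_def flip: take_map)
      have e: "Df (map G cs ! i) (fst (vs ! i)) (snd (vs ! i)) =
          f (cs ! i) (fst (us ! i) - 1) (Df (F (cs ! i)) (fst (us ! i)) (snd (us ! i)))"
        using n i len chain_maps_Df[OF f[OF n(4)] n(3)] by simp
      show ?thesis
        unfolding e dt unfolding n(1) upd'[OF i Df_closed[OF F[OF n(4)] n(3)]] dg
        using linmaps_signed[OF \<pi>l chain_complex_module[OF Z] chain_complex_module[OF W] dc[OF i]] by simp
    qed
    have "Df W (deg vs) (m' vs) = \<pi> (deg us - 1) (Df Z (deg us) (m us))"
      unfolding m'vs dg using chain_maps_Df[OF \<pi> closed] .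
    also have "Df Z (deg us) (m us) = finsum (Md Z (deg us - 1))
         (\<lambda>i. signed (Md Z (deg us - 1)) (deg (take i us)) (m (us[i := (fst (us ! i) - 1,
            Df (map F cs ! i) (fst (us ! i)) (snd (us ! i)))]))) {..<length us}"
      by (rule multi_chain_map_Df[OF m us(1)])
    also have "\<dots> = finsum (Md Z (deg us - 1))
         (\<lambda>i. signed (Md Z (deg us - 1)) (deg (take i us)) (m (?d i))) {..<length us}"
    proof -
      interpret Z: module K "Md Z (deg us - 1)" using Z by (rule chain_complex_module)
      show ?thesis
        by (rule Z.finsum_cong')
           (use len dc signed_closed[OF Z.module_axioms] in auto)
    qed
    also have "\<pi> (deg us - 1) \<dots> = finsum (Md W (deg us - 1))
         (\<lambda>i. \<pi> (deg us - 1) (signed (Md Z (deg us - 1)) (deg (take i us)) (m (?d i)))) {..<length us}"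
      by (rule linmaps_finsum[OF \<pi>l chain_complex_module[OF Z] chain_complex_module[OF W]])
         (use dc signed_closed[OF chain_complex_module[OF Z]] in auto)
    also have "\<dots> = finsum (Md W (deg vs - 1))
         (\<lambda>i. signed (Md W (deg vs - 1)) (deg (take i vs))
            (m' (vs[i := (fst (vs ! i) - 1, Df (map G cs ! i) (fst (vs ! i)) (snd (vs ! i)))])))
         {..<length vs}"
    proof -
      interpret W: module K "Md W (deg us - 1)" using W by (rule chain_complex_module)
      have c: "\<pi> (deg us - 1) (signed (Md Z (deg us - 1)) (deg (take i us)) (m (?d i))) \<in> carrier (Md W (deg us - 1))"
        if "i < length us" for i
        using chain_maps_closed[OF \<pi> signed_closed[OF chain_complex_module[OF Z] dc[OF that]]] .
      show ?thesis
        unfolding dg len'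
        by (rule W.finsum_cong') (use c summand in \<open>auto simp: dg\<close>)
    qed
    finally show "Df W (deg vs) (m' vs) =
       finsum (Md W (deg vs - 1))
         (\<lambda>i. signed (Md W (deg vs - 1)) (deg (take i vs))
            (m' (vs[i := (fst (vs ! i) - 1, Df (map G cs ! i) (fst (vs ! i)) (snd (vs ! i)))])))
         {..<length vs}" .
  qed
qed

lemma multi_chain_map_zero:
  assumes m: "multi_chain_map K Xs Z m" and us: "us \<in> tensors Xs" and Z: "chain_complex K Z"
    and X: "\<And>X. X \<in> set Xs \<Longrightarrow> chain_complex K X"
    and i: "i < length us" "snd (us ! i) = \<zero>\<^bsub>Md (Xs ! i) (fst (us ! i))\<^esub>"
  shows "m us = \<zero>\<^bsub>Md Z (deg us)\<^esub>"
proof -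
  have "Xs ! i \<in> set Xs" using us i by (simp add: tensors_def list_all2_lengthD)
  then interpret M: module K "Md (Xs ! i) (fst (us ! i))" using X chain_complex_module by blast
  interpret Z: module K "Md Z (deg us)" using Z by (rule chain_complex_module)
  have "us[i := (fst (us ! i), \<zero>\<^bsub>K\<^esub> \<odot>\<^bsub>Md (Xs ! i) (fst (us ! i))\<^esub> snd (us ! i))] = us[i := us ! i]"
    using i by (metis M.smult_l_null M.zero_closed prod.collapse)
  then show ?thesis
    using multi_chain_map_smult[OF m us i(1), of "\<zero>\<^bsub>K\<^esub>"] multi_chain_map_closed[OF m us] i
    by (simp add: Z.smult_l_null)
qed

text \<open>Let \<open>n\<close> be the lowest degree outside \<open>U\<close>, so that truncation kills the cycles of degree \<open>n\<close> and everything
  above.  For non-negatively graded complexes a product has at least the degree of each factor.  If a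
  factor of degree \<open>n\<close> has a product of degree \<open>n\<close>, then all other factors have degree zero and hence
  are cycles; so the product is a cycle if that factor is.  If \<open>U\<close> is everything or empty, truncation kills
  nothing or everything.\<close>

lemma to_trunc_kills_products:
  assumes m: "multi_chain_map K Xs Z m" and us: "us \<in> tensors Xs" and Z: "chain_complex K Z"
    and X: "\<And>X. X \<in> set Xs \<Longrightarrow> X \<in> Ob (Ch K g)"
    and U: "down_closed U" "g = NonNeg \<or> U = UNIV \<or> U = {}"
    and i: "i < length us" "to_trunc U (Xs ! i) (fst (us ! i)) (snd (us ! i)) =
      \<zero>\<^bsub>Md (trunc U (Xs ! i)) (fst (us ! i))\<^esub>"
  shows "to_trunc U Z (deg us) (m us) = \<zero>\<^bsub>Md (trunc U Z) (deg us)\<^esub>"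
proof -
  note XC = Ch_ObD[OF X]
  have len: "length us = length Xs" using us by (simp add: tensors_def list_all2_lengthD)
  have c: "snd (us ! j) \<in> carrier (Md (Xs ! j) (fst (us ! j)))" if "j < length us" for j
    using us that by (auto simp: tensors_def list_all2_conv_all_nth helems_def case_prod_beta)
  have closed: "m us \<in> carrier (Md Z (deg us))" using multi_chain_map_closed[OF m us] .
  have zero: ?thesis if "m us = \<zero>\<^bsub>Md Z (deg us)\<^esub>"
    using chain_maps_zero[OF to_trunc_chain_map[OF Z U(1)] Z trunc_complex[OF Z U(1)]] that by simp
  have zero': ?thesis if "j < length us" "snd (us ! j) = \<zero>\<^bsub>Md (Xs ! j) (fst (us ! j))\<^esub>" for j
    by (rule zero, rule multi_chain_map_zero[OF m us Z XC that])
  show ?thesis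
  proof (cases "fst (us ! i) \<in> U")
    case True
    then show ?thesis using zero'[OF i(1)] i(2) c[OF i(1)] by (simp add: to_trunc_def)
  next
    case out: False
    show ?thesis
    proof (cases "deg us - 1 \<in> U \<or> deg us \<in> U")
      case False
      then show ?thesis using closed by (simp add: to_trunc_def zero_trunc)
    next
      case True
      then have du: "deg us - 1 \<in> U" using down_closed_pred[OF U(1)] by blast
      then have g: "g = NonNeg" using U(2) out by auto
      show ?thesis
      proof (cases "\<exists>j < length us. fst (us ! j) < 0")
        case True
        then obtain j where j: "j < length us" "fst (us ! j) < 0" by auto
        then have "snd (us ! j) = \<zero>\<^bsub>Md (Xs ! j) (fst (us ! j))\<^esub>"
          using Ch_Ob_neg[OF X[unfolded g, of "Xs ! j"] j(2)] c[OF j(1)] len by simp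
        then show ?thesis by (rule zero'[OF j(1)])
      next
        case False
        then have nn: "\<And>j. j < length us \<Longrightarrow> fst (us ! j) \<ge> 0" by force
        have degsum: "deg us = (\<Sum>j<length us. fst (us ! j))"
          by (simp add: deg_def sum_list_sum_nth atLeast0LessThan)
        have split: "deg us = fst (us ! i) + (\<Sum>j \<in> {..<length us} - {i}. fst (us ! j))"
          unfolding degsum using i(1) by (simp add: sum.remove)
        have rest: "(\<Sum>j \<in> {..<length us} - {i}. fst (us ! j)) \<ge> 0" using nn by (intro sum_nonneg) auto
        have "\<not> fst (us ! i) \<le> deg us - 1" using du out U(1) by (auto simp: down_closed_def)
        then have di: "deg us = fst (us ! i)" and "(\<Sum>j \<in> {..<length us} - {i}. fst (us ! j)) = 0"
          using split rest by auto
        then have others: "fst (us ! j) = 0" if "j < length us" "j \<noteq> i" for j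
          using that nn sum_nonneg_eq_0_iff[of "{..<length us} - {i}" "\<lambda>j. fst (us ! j)"] by auto
        interpret Z: module K "Md Z (deg us - 1)" using Z by (rule chain_complex_module)
        have terms: "signed (Md Z (deg us - 1)) (deg (take j us))
            (m (us[j := (fst (us ! j) - 1, Df (Xs ! j) (fst (us ! j)) (snd (us ! j)))])) =
            \<zero>\<^bsub>Md Z (deg us - 1)\<^esub>" if j: "j < length us" for j
        proof -
          let ?ws = "us[j := (fst (us ! j) - 1, Df (Xs ! j) (fst (us ! j)) (snd (us ! j)))]"
          have Xj: "Xs ! j \<in> set Xs" using j len by simp
          have "Df (Xs ! j) (fst (us ! j)) (snd (us ! j)) \<in> carrier (Md (Xs ! j) (fst (us ! j) - 1))"
            using Df_closed[OF XC[OF Xj] c[OF j]] .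
          moreover from this have "Df (Xs ! j) (fst (us ! j)) (snd (us ! j)) = \<zero>\<^bsub>Md (Xs ! j) (fst (us ! j) - 1)\<^esub>"
          proof (cases "j = i")
            case True
            then show ?thesis using i(2) out du di by (simp add: to_trunc_def zero_trunc)
          next
            case False
            then show ?thesis using calculation Ch_Ob_neg[OF X[OF Xj, unfolded g], of "fst (us ! j) - 1"] others[OF j]
              by simp
          qed
          moreover have "?ws \<in> tensors Xs"
            using us j calculation(1)
            by (auto simp: tensors_def list_all2_conv_all_nth helems_def case_prod_beta nth_list_update)
          ultimately have "m ?ws = \<zero>\<^bsub>Md Z (deg ?ws)\<^esub>"
            using multi_chain_map_zero[OF m _ Z XC, of ?ws j] j by simp
          then show ?thesis using deg_update[OF j] by (simp add: signed_def)
        qed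
        have "Df Z (deg us) (m us) = \<zero>\<^bsub>Md Z (deg us - 1)\<^esub>"
          unfolding multi_chain_map_Df[OF m us] by (rule Z.add.finprod_one_eqI) (use terms in auto)
        moreover have "deg us \<notin> U" using out di by simp
        ultimately show ?thesis using du by (simp add: to_trunc_def zero_trunc)
      qed
    qed
  qed
qed

text \<open>Replacing one factor after the other, each by one with the same image, changes the product by an element
  of the kernel.\<close>

lemma to_trunc_respects_products:
  assumes m: "multi_chain_map K Xs Z m" and us: "us \<in> tensors Xs" and vs: "vs \<in> tensors Xs"
    and Z: "chain_complex K Z" and X: "\<And>X. X \<in> set Xs \<Longrightarrow> X \<in> Ob (Ch K g)"
    and U: "down_closed U" "g = NonNeg \<or> U = UNIV \<or> U = {}"
    and eq: "tensor_map (to_trunc U) Xs us = tensor_map (to_trunc U) Xs vs"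
  shows "to_trunc U Z (deg us) (m us) = to_trunc U Z (deg us) (m vs)"
proof -
  have len: "length us = length Xs" "length vs = length Xs" using us vs by (simp_all add: tensors_def list_all2_lengthD)
  have cu: "snd (us ! j) \<in> carrier (Md (Xs ! j) (fst (us ! j)))" if "j < length Xs" for j
    using us that len by (auto simp: tensors_def list_all2_conv_all_nth helems_def case_prod_beta)
  have cv: "snd (vs ! j) \<in> carrier (Md (Xs ! j) (fst (vs ! j)))" if "j < length Xs" for j
    using vs that len by (auto simp: tensors_def list_all2_conv_all_nth helems_def case_prod_beta)
  have ej: "fst (vs ! j) = fst (us ! j)"
    "to_trunc U (Xs ! j) (fst (us ! j)) (snd (vs ! j)) = to_trunc U (Xs ! j) (fst (us ! j)) (snd (us ! j))"
    if "j < length Xs" for j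
    using arg_cong[OF eq, of "\<lambda>l. l ! j"] that len by (auto simp: nth_tensor_map)
  \<comment> \<open>The first \<open>k\<close> factors have been replaced.\<close>
  define ws where "ws k = map (\<lambda>j. if j < k then vs ! j else us ! j) [0..<length Xs]" for k
  have wsl: "length (ws k) = length Xs" for k by (simp add: ws_def)
  have wst: "ws k \<in> tensors Xs" for k
    using cu cv by (auto simp: tensors_def list_all2_conv_all_nth helems_def case_prod_beta ws_def)
  have wsf: "map fst (ws k) = map fst us" for k
    by (rule nth_equalityI) (use len ej in \<open>auto simp: ws_def\<close>)
  then have wsd: "deg (ws k) = deg us" for k by (simp add: deg_def)
  have "k \<le> length Xs \<Longrightarrow> to_trunc U Z (deg us) (m (ws k)) = to_trunc U Z (deg us) (m us)" for k
  proof (induction k)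
    case 0
    have "ws 0 = us" by (rule nth_equalityI) (use len in \<open>auto simp: ws_def\<close>)
    then show ?case by simp
  next
    case (Suc k)
    then have k: "k < length Xs" by simp
    then have Xk: "Xs ! k \<in> set Xs" by simp
    note XkC = Ch_ObD[OF X[OF Xk]]
    let ?n = "fst (us ! k)"
    interpret M: module K "Md (Xs ! k) ?n" using XkC by (rule chain_complex_module)
    interpret T: module K "Md (trunc U (Xs ! k)) ?n" using trunc_complex[OF XkC U(1)] by (rule chain_complex_module)
    interpret TZ: module K "Md (trunc U Z) (deg us)" using trunc_complex[OF Z U(1)] by (rule chain_complex_module)
    have wk: "ws k ! k = us ! k" using k by (simp add: ws_def)
    have a: "snd (us ! k) \<in> carrier (Md (Xs ! k) ?n)" using cu[OF k] .
    have b: "snd (vs ! k) \<in> carrier (Md (Xs ! k) ?n)" using cv[OF k] ej(1)[OF k] by simp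
    define y where "y = \<ominus>\<^bsub>Md (Xs ! k) ?n\<^esub> snd (us ! k) \<oplus>\<^bsub>Md (Xs ! k) ?n\<^esub> snd (vs ! k)"
    have y: "y \<in> carrier (Md (Xs ! k) ?n)" using a b by (simp add: y_def)
    have sum: "snd (us ! k) \<oplus>\<^bsub>Md (Xs ! k) ?n\<^esub> y = snd (vs ! k)"
      using a b by (simp add: y_def M.r_neg2)
    note tl = to_trunc_lin[OF XkC, of U ?n]
    have ty: "to_trunc U (Xs ! k) ?n y = \<zero>\<^bsub>Md (trunc U (Xs ! k)) ?n\<^esub>"
      using a b ej(2)[OF k] linmaps_add[OF tl] linmaps_uminus[OF tl M.module_axioms T.module_axioms a]
        linmaps_closed[OF tl a]
      by (simp add: y_def T.l_neg)
    have step: "ws (Suc k) = (ws k)[k := (?n, snd (us ! k) \<oplus>\<^bsub>Md (Xs ! k) ?n\<^esub> y)]"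
    proof (rule nth_equalityI)
      fix j assume "j < length (ws (Suc k))"
      then have "j < length Xs" by (simp add: wsl)
      then show "ws (Suc k) ! j = (ws k)[k := (?n, snd (us ! k) \<oplus>\<^bsub>Md (Xs ! k) ?n\<^esub> y)] ! j"
        unfolding sum using ej(1)[OF k] k by (auto simp: ws_def nth_list_update less_Suc_eq prod_eq_iff)
    qed (simp add: wsl)
    let ?w = "(ws k)[k := (?n, y)]"
    have wt: "?w \<in> tensors Xs"
      using wst[of k] y k
      by (auto simp: tensors_def list_all2_conv_all_nth helems_def case_prod_beta nth_list_update wsl)
    have wd: "deg ?w = deg us" using deg_update[of k "ws k" ?n y] k wsl wsd wk by simp
    have w0: "to_trunc U Z (deg us) (m ?w) = \<zero>\<^bsub>Md (trunc U Z) (deg us)\<^esub>"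
      using to_trunc_kills_products[OF m wt Z X U, of k] k wsl ty wd by simp
    have "m (ws (Suc k)) = m (ws k) \<oplus>\<^bsub>Md Z (deg us)\<^esub> m ?w"
      using multi_chain_map_add[OF m wst[of k], of k y] k wsl wk y wsd step by simp
    then have "to_trunc U Z (deg us) (m (ws (Suc k))) =
        to_trunc U Z (deg us) (m (ws k)) \<oplus>\<^bsub>Md (trunc U Z) (deg us)\<^esub> to_trunc U Z (deg us) (m ?w)"
      using linmaps_add[OF to_trunc_lin[OF Z]] multi_chain_map_closed[OF m wst[of k]] multi_chain_map_closed[OF m wt]
        wsd wd by simp
    also have "\<dots> = to_trunc U Z (deg us) (m (ws k))"
      using w0 linmaps_closed[OF to_trunc_lin[OF Z], of "m (ws k)" "deg us"] multi_chain_map_closed[OF m wst[of k]] wsd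
      by simp
    finally show ?case using Suc by simp
  qed
  moreover have "ws (length Xs) = vs" by (rule nth_equalityI) (use len in \<open>auto simp: ws_def\<close>)
  ultimately show ?thesis by fastforce
qed

definition section_of :: "('i \<Rightarrow> int \<Rightarrow> 'a \<Rightarrow> 'a) \<Rightarrow> ('i \<Rightarrow> ('k, 'a) cx) \<Rightarrow> 'i \<Rightarrow> int \<Rightarrow> 'a \<Rightarrow> 'a" where
  "section_of f A c n b = (SOME a. a \<in> carrier (Md (A c) n) \<and> f c n a = b)"

text \<open>The choice of preimages does not matter if \<open>f\<close> is compatible with the action (\<open>quotient_action\<close>).\<close>

definition quotient_algebra :: "('c \<Rightarrow> int \<Rightarrow> 'a \<Rightarrow> 'a) \<Rightarrow> ('c \<Rightarrow> ('k, 'a) cx) \<Rightarrow>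
    ('c, 'k, 'a) alg \<Rightarrow> ('c, 'k, 'a) alg" where
  "quotient_algebra f B E = (B, \<lambda>d cs us.
     f d (deg us) (snd E d cs (hd us # tensor_map (section_of f (fst E)) cs (tl us))))"

lemma fst_quotient_algebra [simp]: "fst (quotient_algebra f B E) = B"
  by (simp add: quotient_algebra_def)

lemma section_of_lift:
  assumes "f c n ` carrier (Md (A c) n) = carrier (Md (B c) n)" "b \<in> carrier (Md (B c) n)"
  shows "section_of f A c n b \<in> carrier (Md (A c) n)" and "f c n (section_of f A c n b) = b"
proof -
  have "\<exists>a. a \<in> carrier (Md (A c) n) \<and> f c n a = b" using assms by (metis imageE)
  from someI_ex[OF this]
  show "section_of f A c n b \<in> carrier (Md (A c) n)" "f c n (section_of f A c n b) = b"
    by (simp_all add: section_of_def)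
qed

text \<open>The assumption \<open>compatible\<close> says that the kernel of \<open>f\<close> is an ideal for the operad action.\<close>

locale algebra_quotient =
  fixes K :: "'k ring" and g :: grading and P :: "('c, 'k, 'a) operad" and A :: "'c \<Rightarrow> ('k, 'a) cx"
    and \<alpha> :: "'c \<Rightarrow> 'c list \<Rightarrow> (int \<times> 'a) list \<Rightarrow> 'a"
    and B :: "'c \<Rightarrow> ('k, 'a) cx" and f :: "'c \<Rightarrow> int \<Rightarrow> 'a \<Rightarrow> 'a"
  assumes P: "operad_typed K g P" and E: "operad_algebra K g P (A, \<alpha>)"
    and B: "\<And>c. B c \<in> Ob (Ch K g)" and f: "\<And>c. f c \<in> chain_maps K (A c) (B c)"
    and surj: "\<And>c n. f c n ` carrier (Md (A c) n) = carrier (Md (B c) n)"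
    and compatible: "\<And>d cs p as as'. p \<in> helems (PO P d cs) \<Longrightarrow> as \<in> tensors (map A cs) \<Longrightarrow>
      as' \<in> tensors (map A cs) \<Longrightarrow> tensor_map f cs as = tensor_map f cs as' \<Longrightarrow>
      f d (deg (p # as)) (\<alpha> d cs (p # as)) = f d (deg (p # as)) (\<alpha> d cs (p # as'))"
begin

abbreviation "\<beta> \<equiv> snd (quotient_algebra f B (A, \<alpha>))"

lemma A: "A c \<in> Ob (Ch K g)"
  and AC: "chain_complex K (A c)" and BC: "chain_complex K (B c)"
  using E B by (auto simp: operad_algebra_def dest: Ch_ObD)

lemma action: "multi_chain_map K (PO P d cs # map A cs) (A d) (\<alpha> d cs)"
  using E by (simp add: operad_algebra_def)

lemma action_closed:
  "p \<in> helems (PO P d cs) \<Longrightarrow> as \<in> tensors (map A cs) \<Longrightarrow>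
     \<alpha> d cs (p # as) \<in> carrier (Md (A d) (fst p + deg as))"
  using multi_chain_map_closed[OF action, of "p # as" d cs] by simp

text \<open>On elements in the image of \<open>f\<close> the chosen preimages are irrelevant, and every tensor lies in this
  image; the algebra axioms follow from those of the original algebra by this formula.\<close>

lemma quotient_action:
  assumes p: "p \<in> helems (PO P d cs)" and as: "as \<in> tensors (map A cs)"
  shows "\<beta> d cs (p # tensor_map f cs as) = f d (deg (p # as)) (\<alpha> d cs (p # as))"
proof -
  let ?bs = "tensor_map f cs as" and ?as' = "tensor_map (section_of f A) cs (tensor_map f cs as)"
  have len: "length as = length cs" using as by (simp add: tensors_map_iff)
  have bs: "?bs \<in> tensors (map B cs)" by (rule tensor_map_tensors[OF as f])
  have as': "?as' \<in> tensors (map A cs)"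
    using bs section_of_lift(1)[of f _ _ A B, OF surj] by (auto simp: tensors_map_iff nth_tensor_map)
  have "tensor_map f cs ?as' = ?bs"
    by (rule nth_equalityI)
       (use len bs section_of_lift(2)[of f _ _ A B, OF surj] in \<open>auto simp: nth_tensor_map tensors_map_iff\<close>)
  then have "f d (deg (p # as)) (\<alpha> d cs (p # as)) = f d (deg (p # as)) (\<alpha> d cs (p # ?as'))"
    using compatible[OF p as as'] by simp
  moreover have "\<beta> d cs (p # ?bs) = f d (deg (p # ?bs)) (\<alpha> d cs (p # ?as'))"
    by (simp add: quotient_algebra_def)
  ultimately show ?thesis by (simp add: deg_tensor_map[OF len])
qed

lemma lift_tensors:
  assumes "bs \<in> tensors (map B cs)"
  obtains as where "as \<in> tensors (map A cs)" "bs = tensor_map f cs as"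
  using tensor_map_surj[OF assms, of f A] surj by metis

lemma quotient_multi_chain_map: "multi_chain_map K (PO P d cs # map B cs) (B d) (\<beta> d cs)"
proof -
  \<comment> \<open>The operation is one more factor, on which the identity is used; it gets the color \<^const>\<open>None\<close>.\<close>
  define cs' where "cs' = None # map Some cs"
  define F where "F c = (case c of None \<Rightarrow> PO P d cs | Some c \<Rightarrow> A c)" for c
  define G where "G c = (case c of None \<Rightarrow> PO P d cs | Some c \<Rightarrow> B c)" for c
  define h where "h c = (case c of None \<Rightarrow> Idn (Ch K g) (PO P d cs) | Some c \<Rightarrow> f c)" for c
  have PC: "chain_complex K (PO P d cs)" using P by (auto simp: operad_typed_def dest: Ch_ObD)
  have Fm: "map F cs' = PO P d cs # map A cs" and Gm: "map G cs' = PO P d cs # map B cs"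
    by (simp_all add: cs'_def F_def G_def o_def)
  have hs: "tensor_map h (map Some cs) as = tensor_map f cs as" for as
    by (simp add: tensor_map_def zip_map1 o_def case_prod_beta h_def)
  have "multi_chain_map K (map G cs') (B d) (\<beta> d cs)"
  proof (rule multi_chain_map_quotient)
    show "multi_chain_map K (map F cs') (A d) (\<alpha> d cs)" unfolding Fm by (rule action)
    show "h c \<in> chain_maps K (F c) (G c)" for c
      using f chain_maps_id[OF PC] by (cases c) (auto simp: h_def F_def G_def)
    show "h c n ` carrier (Md (F c) n) = carrier (Md (G c) n)" for c n
      using surj by (cases c) (auto simp: h_def F_def G_def)
    show "chain_complex K (F c)" for c using PC AC by (cases c) (auto simp: F_def)
    fix us assume "us \<in> tensors (map F cs')"
    then obtain p as where us: "us = p # as" "p \<in> helems (PO P d cs)" "as \<in> tensors (map A cs)"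
      unfolding Fm by (cases us) (auto simp: tensors_def)
    have "tensor_map h cs' us = p # tensor_map f cs as"
      using us(2) by (simp add: us(1) cs'_def hs) (simp add: h_def helems_iff)
    then show "\<beta> d cs (tensor_map h cs' us) = f d (deg us) (\<alpha> d cs us)"
      using quotient_action[OF us(2,3)] us(1) by simp
  qed (use AC BC f in auto)
  then show ?thesis unfolding Gm .
qed

lemma deg_nested: "length qs = length ass \<Longrightarrow>
    deg (map (\<lambda>i. hval (h i) (qs ! i # ass ! i)) [0..<length qs]) = deg qs + deg (concat ass)"
proof (induction qs ass arbitrary: h rule: list_induct2)
  case (Cons q qs as ass)
  have "map (\<lambda>i. hval (h i) ((q # qs) ! i # (as # ass) ! i)) [0..<length (q # qs)] =
      hval (h 0) (q # as) # map (\<lambda>i. hval (h (Suc i)) (qs ! i # ass ! i)) [0..<length qs]"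
    by (simp add: map_upt_Suc del: upt_Suc)
  then show ?case using Cons.IH[of "\<lambda>i. h (Suc i)"] by (simp add: deg_append hval_def)
qed simp

lemma quotient_unit:
  assumes "b \<in> helems (B c)"
  shows "\<beta> c [c] [(0, PUnit P c), b] = snd b"
proof -
  have u: "(0, PUnit P c) \<in> helems (PO P c [c])"
    using P by (auto simp: operad_typed_def multi_chain_map_def helems_iff)
  from assms have "[b] \<in> tensors (map B [c])" by simp
  then obtain as where as: "as \<in> tensors (map A [c])" "[b] = tensor_map f [c] as" by (rule lift_tensors)
  then obtain a where a: "as = [a]" "a \<in> helems (A c)" by (cases as) (auto simp: tensors_def)
  have "\<alpha> c [c] [(0, PUnit P c), a] = snd a" using E a by (auto simp: operad_algebra_def)
  then show ?thesis using quotient_action[OF u as(1)] as a by simp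
qed

lemma quotient_assoc:
  assumes len: "length bss = length cs" and p: "p \<in> helems (PO P d cs)"
    and qs: "qs \<in> tensors (map2 (PO P) cs bss)"
    and bs: "list_all2 (\<lambda>as bs. as \<in> tensors (map B bs)) ass bss"
  shows "\<beta> d (concat bss) (hval (PComp P d cs bss) (p # qs) # concat ass) =
    signed (Md (B d) (deg (p # qs @ concat ass))) (shuffle_sign qs ass)
      (\<beta> d cs (p # map (\<lambda>i. hval (\<beta> (cs ! i) (bss ! i)) (qs ! i # ass ! i)) [0..<length cs]))"
proof -
  have la: "length ass = length cs" using bs len by (simp add: list_all2_lengthD)
  have lq: "length qs = length cs" using qs len by (simp add: tensors_def list_all2_lengthD)
  have "\<exists>as. as \<in> tensors (map A (bss ! i)) \<and> ass ! i = tensor_map f (bss ! i) as" if "i < length cs" for i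
    using bs that la lift_tensors[of "ass ! i" "bss ! i"] by (metis list_all2_nthD)
  then obtain h where h: "\<And>i. i < length cs \<Longrightarrow> h i \<in> tensors (map A (bss ! i)) \<and>
      ass ! i = tensor_map f (bss ! i) (h i)" by metis
  define ass' where "ass' = map h [0..<length cs]"
  have la': "length ass' = length cs" by (simp add: ass'_def)
  have at: "list_all2 (\<lambda>as bs. as \<in> tensors (map A bs)) ass' bss"
    using h len by (simp add: list_all2_conv_all_nth ass'_def)
  have atl: "list_all2 (\<lambda>us cs. length us = length cs) ass' bss"
    using at by (auto simp: list_all2_conv_all_nth tensors_map_iff)
  have ass: "ass = map2 (tensor_map f) bss ass'"
    by (rule nth_equalityI) (use h len la in \<open>auto simp: ass'_def\<close>)
  have cat: "concat ass = tensor_map f (concat bss) (concat ass')"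
    unfolding ass by (rule tensor_map_concat[OF atl, symmetric])
  have catt: "concat ass' \<in> tensors (map A (concat bss))"
    using at unfolding tensors_def map_concat
    by (auto simp: list_all2_map2 list_all2_map1 list.rel_map intro!: concat_transfer[THEN rel_funD])
  have dc: "deg (concat ass) = deg (concat ass')"
    unfolding cat by (rule deg_tensor_map) (use catt in \<open>simp add: tensors_map_iff\<close>)
  have qi: "qs ! i \<in> helems (PO P (cs ! i) (bss ! i))" if "i < length cs" for i
    using qs that len by (auto simp: tensors_def list_all2_conv_all_nth)
  have comp: "hval (PComp P d cs bss) (p # qs) \<in> helems (PO P d (concat bss))"
  proof -
    have "multi_chain_map K (PO P d cs # map2 (PO P) cs bss) (PO P d (concat bss)) (PComp P d cs bss)"
      using P len by (simp add: operad_typed_def)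
    from multi_chain_map_closed[OF this, of "p # qs"] show ?thesis
      using p qs by (simp add: helems_iff hval_def)
  qed
  have sh: "shuffle_sign qs ass = shuffle_sign qs ass'"
  proof -
    have "deg (ass ! i) = deg (ass' ! i)" if "i < length cs" for i
      using h[OF that] that deg_tensor_map[of "h i" "bss ! i" f] by (simp add: ass'_def tensors_map_iff)
    then show ?thesis unfolding shuffle_sign_def by (intro sum.cong) (auto simp: lq)
  qed
  define xs where "xs = map (\<lambda>i. hval (\<alpha> (cs ! i) (bss ! i)) (qs ! i # ass' ! i)) [0..<length cs]"
  have inner: "map (\<lambda>i. hval (\<beta> (cs ! i) (bss ! i)) (qs ! i # ass ! i)) [0..<length cs] = tensor_map f cs xs"
  proof (rule nth_equalityI)
    fix i assume "i < length (map (\<lambda>i. hval (\<beta> (cs ! i) (bss ! i)) (qs ! i # ass ! i)) [0..<length cs])"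
    then have i: "i < length cs" by simp
    have d: "deg (tensor_map f (bss ! i) (h i)) = deg (h i)"
      by (rule deg_tensor_map) (use h[OF i] in \<open>simp add: tensors_map_iff\<close>)
    show "map (\<lambda>i. hval (\<beta> (cs ! i) (bss ! i)) (qs ! i # ass ! i)) [0..<length cs] ! i = tensor_map f cs xs ! i"
      using i h[OF i] quotient_action[OF qi[OF i]] by (simp add: nth_tensor_map xs_def hval_def ass'_def d)
  qed (simp add: xs_def)
  have xst: "xs \<in> tensors (map A cs)"
    using h qi action_closed by (auto simp: tensors_map_iff xs_def hval_def ass'_def)
  have dx: "deg xs = deg qs + deg (concat ass')"
    using deg_nested[of qs ass' "\<lambda>i. \<alpha> (cs ! i) (bss ! i)"] lq la' by (simp add: xs_def)
  have assoc: "\<alpha> d (concat bss) (hval (PComp P d cs bss) (p # qs) # concat ass') =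
      signed (Md (A d) (deg (p # qs @ concat ass'))) (shuffle_sign qs ass') (\<alpha> d cs (p # xs))"
    unfolding xs_def
    by (rule E[unfolded operad_algebra_def prod.case, THEN conjunct2, THEN conjunct2, THEN conjunct2,
          THEN conjunct1, rule_format]) (intro conjI len p qs at)
  let ?D = "deg (p # qs @ concat ass')"
  have D: "fst p + deg xs = ?D" "deg (hval (PComp P d cs bss) (p # qs) # concat ass') = ?D"
    by (simp_all add: dx hval_def deg_append)
  have "\<beta> d (concat bss) (hval (PComp P d cs bss) (p # qs) # concat ass) =
      f d ?D (\<alpha> d (concat bss) (hval (PComp P d cs bss) (p # qs) # concat ass'))"
    using quotient_action[OF comp catt] D(2) by (simp add: cat)
  also have "\<dots> = signed (Md (B d) ?D) (shuffle_sign qs ass') (f d ?D (\<alpha> d cs (p # xs)))"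
    unfolding assoc using action_closed[OF p xst] D(1)
    by (intro linmaps_signed[OF chain_maps_lin[OF f] chain_complex_module[OF AC] chain_complex_module[OF BC]]) simp
  also have "f d ?D (\<alpha> d cs (p # xs)) = \<beta> d cs (p # tensor_map f cs xs)"
    using quotient_action[OF p xst] D(1) by simp
  finally show ?thesis unfolding inner sh by (simp add: deg_append dc)
qed

lemma permute_tensor_map:
  assumes "\<sigma> \<in> perms cs" "length as = length cs"
  shows "permute_list \<sigma> (tensor_map f cs as) = tensor_map f (permute_list \<sigma> cs) (permute_list \<sigma> as)"
proof -
  have s: "\<sigma> permutes {..<length cs}" using assms by (simp add: perms_def)
  have i: "\<sigma> i < length cs" if "i < length cs" for i using permutes_in_image[OF s, of i] that by simp
  show ?thesis
    by (rule nth_equalityI)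
       (use s i assms(2) in \<open>auto simp: permute_list_nth nth_tensor_map\<close>)
qed

lemma quotient_equivariant:
  assumes s: "\<sigma> \<in> perms cs" and p: "p \<in> helems (PO P d cs)" and bs: "bs \<in> tensors (map B cs)"
  shows "\<beta> d (permute_list \<sigma> cs) (hact P d cs \<sigma> p # permute_list \<sigma> bs) =
    signed (Md (B d) (deg (p # bs))) (perm_sign \<sigma> bs) (\<beta> d cs (p # bs))"
proof -
  from bs obtain as where as: "as \<in> tensors (map A cs)" "bs = tensor_map f cs as" by (rule lift_tensors)
  have len: "length as = length cs" using as by (simp add: tensors_map_iff)
  have s': "\<sigma> permutes {..<length cs}" using s by (simp add: perms_def)
  have i: "\<sigma> i < length cs" if "i < length cs" for i using permutes_in_image[OF s', of i] that by simp
  have pt: "permute_list \<sigma> as \<in> tensors (map A (permute_list \<sigma> cs))"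
    using as s' i len by (auto simp: tensors_map_iff permute_list_nth)
  have h: "hact P d cs \<sigma> p \<in> helems (PO P d (permute_list \<sigma> cs))"
    using P s p chain_maps_closed by (fastforce simp: operad_typed_def helems_iff)
  have ps: "perm_sign \<sigma> bs = perm_sign \<sigma> as"
    unfolding perm_sign_def as(2) by (intro sum.cong) (use len i in \<open>auto simp: nth_tensor_map\<close>)
  have db: "deg bs = deg as" using deg_tensor_map[OF len] as by simp
  have "mset (permute_list \<sigma> as) = mset as" using s' len by simp
  then have "mset (map fst (permute_list \<sigma> as)) = mset (map fst as)" by simp
  then have dp: "deg (permute_list \<sigma> as) = deg as" unfolding deg_def by (metis sum_mset_sum_list)
  have eq: "\<alpha> d (permute_list \<sigma> cs) (hact P d cs \<sigma> p # permute_list \<sigma> as) =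
      signed (Md (A d) (deg (p # as))) (perm_sign \<sigma> as) (\<alpha> d cs (p # as))"
    using E s p as(1) unfolding operad_algebra_def by auto
  have "\<beta> d (permute_list \<sigma> cs) (hact P d cs \<sigma> p # permute_list \<sigma> bs) =
      f d (deg (p # as)) (\<alpha> d (permute_list \<sigma> cs) (hact P d cs \<sigma> p # permute_list \<sigma> as))"
    using quotient_action[OF h pt] permute_tensor_map[OF s len] as(2) dp by simp
  also have "\<dots> = signed (Md (B d) (deg (p # as))) (perm_sign \<sigma> as) (f d (deg (p # as)) (\<alpha> d cs (p # as)))"
    unfolding eq using action_closed[OF p as(1)]
    by (intro linmaps_signed[OF chain_maps_lin[OF f] chain_complex_module[OF AC] chain_complex_module[OF BC]]) simp
  finally show ?thesis using quotient_action[OF p as(1)] as(2) ps db by simp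
qed

lemma quotient_is_algebra: "operad_algebra K g P (quotient_algebra f B (A, \<alpha>))"
proof -
  have "operad_algebra K g P (B, \<beta>)"
    unfolding operad_algebra_def prod.case
  proof (intro conjI allI ballI impI)
    fix d cs bss p qs ass
    assume "length bss = length cs \<and> p \<in> helems (PO P d cs) \<and> qs \<in> tensors (map2 (PO P) cs bss) \<and>
      list_all2 (\<lambda>as bs. as \<in> tensors (map B bs)) ass bss"
    then show "\<beta> d (concat bss) (hval (PComp P d cs bss) (p # qs) # concat ass) =
      signed (Md (B d) (deg (p # qs @ concat ass))) (shuffle_sign qs ass)
        (\<beta> d cs (p # map (\<lambda>i. hval (\<beta> (cs ! i) (bss ! i)) (qs ! i # ass ! i)) [0..<length cs]))"
      by (elim conjE) (rule quotient_assoc)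
  next
    fix d cs p as \<sigma>
    assume "\<sigma> \<in> perms cs" "p \<in> helems (PO P d cs) \<and> as \<in> tensors (map B cs)"
    then show "\<beta> d (permute_list \<sigma> cs) (hact P d cs \<sigma> p # permute_list \<sigma> as) =
      signed (Md (B d) (deg (p # as))) (perm_sign \<sigma> as) (\<beta> d cs (p # as))"
      by (elim conjE) (rule quotient_equivariant)
  qed (fact B quotient_multi_chain_map quotient_unit)+
  moreover have "quotient_algebra f B (A, \<alpha>) = (B, \<beta>)" by (simp add: quotient_algebra_def)
  ultimately show ?thesis by metis
qed

lemma quotient_map_is_hom: "f \<in> algebra_homs K g P (A, \<alpha>) (quotient_algebra f B (A, \<alpha>))"
  using f quotient_action by (auto simp: algebra_homs_def power_cat_def tensor_map_def)

end

lemma tensor_map_map: "tensor_map h (map F cs) as = tensor_map (\<lambda>c. h (F c)) cs as"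
  by (rule nth_equalityI) (auto simp: nth_tensor_map)

lemma algebra_homs_iff: "h \<in> algebra_homs K g P E F \<longleftrightarrow> (\<forall>c. h c \<in> chain_maps K (fst E c) (fst F c)) \<and>
    (\<forall>d cs. \<forall>p \<in> helems (PO P d cs). \<forall>as \<in> tensors (map (fst E) cs).
       h d (deg (p # as)) (snd E d cs (p # as)) = snd F d cs (p # tensor_map h cs as))"
  by (simp add: algebra_homs_def power_cat_def tensor_map_def)

text \<open>Homomorphisms descend to quotients because the quotient maps are surjective.\<close>

lemma quotient_hom:
  assumes E: "algebra_quotient K g P A \<alpha> B f" and F: "algebra_quotient K g P A' \<alpha>' B' f'"
    and h: "h \<in> algebra_homs K g P (A, \<alpha>) (A', \<alpha>')"
    and h': "\<And>c. h' c \<in> chain_maps K (B c) (B' c)"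
    and nat: "\<And>c n x. x \<in> carrier (Md (A c) n) \<Longrightarrow> h' c n (f c n x) = f' c n (h c n x)"
  shows "h' \<in> algebra_homs K g P (quotient_algebra f B (A, \<alpha>)) (quotient_algebra f' B' (A', \<alpha>'))"
  unfolding algebra_homs_iff
proof (intro conjI allI ballI)
  interpret E: algebra_quotient K g P A \<alpha> B f by fact
  interpret F: algebra_quotient K g P A' \<alpha>' B' f' by fact
  fix d cs p bs assume p: "p \<in> helems (PO P d cs)"
    and "bs \<in> tensors (map (fst (quotient_algebra f B (A, \<alpha>))) cs)"
  then have "bs \<in> tensors (map B cs)" by simp
  then obtain as where as: "as \<in> tensors (map A cs)" "bs = tensor_map f cs as" by (rule E.lift_tensors)
  have len: "length as = length cs" using as by (simp add: tensors_map_iff)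
  have hc: "\<And>c. h c \<in> chain_maps K (A c) (A' c)" using h by (simp add: algebra_homs_iff)
  have has: "tensor_map h cs as \<in> tensors (map A' cs)" by (rule tensor_map_tensors[OF as(1) hc])
  have sq: "tensor_map h' cs bs = tensor_map f' cs (tensor_map h cs as)"
    by (rule nth_equalityI) (use as len nat in \<open>auto simp: nth_tensor_map tensors_map_iff\<close>)
  have db: "deg (p # bs) = deg (p # as)" "deg (tensor_map h cs as) = deg as"
    using deg_tensor_map[OF len] as by auto
  have "h' d (deg (p # bs)) (E.\<beta> d cs (p # bs)) = h' d (deg (p # as)) (f d (deg (p # as)) (\<alpha> d cs (p # as)))"
    using E.quotient_action[OF p as(1)] as(2) db by simp
  also have "\<dots> = f' d (deg (p # as)) (h d (deg (p # as)) (\<alpha> d cs (p # as)))"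
    using nat E.action_closed[OF p as(1)] by simp
  also have "h d (deg (p # as)) (\<alpha> d cs (p # as)) = \<alpha>' d cs (p # tensor_map h cs as)"
    using h p as(1) by (auto simp: algebra_homs_iff)
  also have "f' d (deg (p # as)) \<dots> = F.\<beta> d cs (p # tensor_map h' cs bs)"
    using F.quotient_action[OF p has] sq db by simp
  finally show "h' d (deg (p # bs)) (E.\<beta> d cs (p # bs)) = F.\<beta> d cs (p # tensor_map h' cs bs)" .
qed (use h' in simp)

definition trunc_alg :: "int set \<Rightarrow> ('c, 'k, 'a) alg \<Rightarrow> ('c, 'k, 'a) alg" where
  "trunc_alg U E = quotient_algebra (\<lambda>c. to_trunc U (fst E c)) (\<lambda>c. trunc U (fst E c)) E"

lemma trunc_algebra_quotient:
  assumes P: "operad_typed K g P" and E: "operad_algebra K g P (A, \<alpha>)"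
    and U: "down_closed U" "g = NonNeg \<or> U = UNIV \<or> U = {}"
  shows "algebra_quotient K g P A \<alpha> (\<lambda>c. trunc U (A c)) (\<lambda>c. to_trunc U (A c))"
proof
  have A: "A c \<in> Ob (Ch K g)" for c using E by (simp add: operad_algebra_def)
  note AC = Ch_ObD[OF A]
  show "trunc U (A c) \<in> Ob (Ch K g)" for c by (rule trunc_Ob[OF A U(1)])
  show "to_trunc U (A c) \<in> chain_maps K (A c) (trunc U (A c))" for c by (rule to_trunc_chain_map[OF AC U(1)])
  show "to_trunc U (A c) n ` carrier (Md (A c) n) = carrier (Md (trunc U (A c)) n)" for c n
    by (rule to_trunc_surj[OF AC])
  fix d cs p as as'
  assume p: "p \<in> helems (PO P d cs)" and as: "as \<in> tensors (map A cs)" "as' \<in> tensors (map A cs)"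
    and eq: "tensor_map (\<lambda>c. to_trunc U (A c)) cs as = tensor_map (\<lambda>c. to_trunc U (A c)) cs as'"
  have "multi_chain_map K (PO P d cs # map A cs) (A d) (\<alpha> d cs)" using E by (simp add: operad_algebra_def)
  moreover have "X \<in> Ob (Ch K g)" if "X \<in> set (PO P d cs # map A cs)" for X
    using that A P by (auto simp: operad_typed_def)
  moreover have "tensor_map (to_trunc U) (PO P d cs # map A cs) (p # as) =
      tensor_map (to_trunc U) (PO P d cs # map A cs) (p # as')"
    using eq by (simp add: tensor_map_map)
  ultimately show "to_trunc U (A d) (deg (p # as)) (\<alpha> d cs (p # as)) =
      to_trunc U (A d) (deg (p # as)) (\<alpha> d cs (p # as'))"
    using p as by (intro to_trunc_respects_products[OF _ _ _ AC _ U]) auto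
qed (fact P, fact E)

section \<open>Localizations preserve algebras\<close>

lemma unchanged_degrees_down_closed: "down_closed (unchanged_degrees C R r)"
  by (auto simp: unchanged_degrees_def down_closed_def)

lemma homology_bij_transfer_trivial:
  assumes X: "chain_complex K X" and Y: "chain_complex K Y" and f: "f \<in> chain_maps K X Y"
    and b: "homology_bij X Y f n"
  shows "cycles X n \<subseteq> boundaries X n \<longleftrightarrow> cycles Y n \<subseteq> boundaries Y n"
proof
  assume X0: "cycles X n \<subseteq> boundaries X n"
  show "cycles Y n \<subseteq> boundaries Y n"
  proof
    fix y assume "y \<in> cycles Y n"
    then obtain x c where "x \<in> cycles X n" "c \<in> boundaries Y n" "y = c \<oplus>\<^bsub>Md Y n\<^esub> f n x"
      using b by (auto simp: homology_bij_def)
    then show "y \<in> boundaries Y n"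
      using X0 chain_maps_boundaries[OF f] boundaries_add[OF Y] by blast
  qed
next
  assume "cycles Y n \<subseteq> boundaries Y n"
  then show "cycles X n \<subseteq> boundaries X n"
    using b chain_maps_cycles[OF f X Y] by (auto simp: homology_bij_def)
qed

lemma suspension_complex:
  assumes Y: "chain_complex K Y"
  shows "chain_complex K (FOb suspension Y)"
  unfolding chain_complex_def
proof (intro allI conjI ballI)
  fix n
  interpret M1: module K "Md Y (n - 1)" using Y by (rule chain_complex_module)
  interpret M2: module K "Md Y (n - 2)" using Y by (rule chain_complex_module)
  interpret M3: module K "Md Y (n - 3)" using Y by (rule chain_complex_module)
  have deg: "n - 1 - 1 = n - 2" "n - 2 - 1 = n - 3" "n - 1 - 2 = n - 3" by simp_all
  have S: "Md (FOb suspension Y) m = Md Y (m - 1)"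
    "Df (FOb suspension Y) m = (\<lambda>x \<in> carrier (Md Y (m - 1)). \<ominus>\<^bsub>Md Y (m - 2)\<^esub> Df Y (m - 1) x)" for m
    by (simp_all add: suspension_def)
  show "module K (Md (FOb suspension Y) n)" unfolding S by (rule M1.module_axioms)
  have D: "Df Y (n - 1) \<in> linmaps K (Md Y (n - 1)) (Md Y (n - 2))" using Df_lin[OF Y, of "n - 1"] unfolding deg .
  have D2: "Df Y (n - 2) \<in> linmaps K (Md Y (n - 2)) (Md Y (n - 3))" using Df_lin[OF Y, of "n - 2"] unfolding deg .
  note c = linmaps_closed[OF D]
  show "Df (FOb suspension Y) n \<in> linmaps K (Md (FOb suspension Y) n) (Md (FOb suspension Y) (n - 1))"
    unfolding S deg
    by (rule linmapsI)
       (auto simp: c linmaps_add[OF D] linmaps_smult[OF D] M2.minus_add M2.smult_r_minus)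
  fix x assume "x \<in> carrier (Md (FOb suspension Y) n)"
  then have x: "x \<in> carrier (Md Y (n - 1))" unfolding S .
  have "Df Y (n - 2) (Df Y (n - 1) x) = \<zero>\<^bsub>Md Y (n - 3)\<^esub>" using Df_Df[OF Y x] unfolding deg .
  then show "Df (FOb suspension Y) (n - 1) (Df (FOb suspension Y) n x) = \<zero>\<^bsub>Md (FOb suspension Y) (n - 2)\<^esub>"
    unfolding S deg
    using x c[OF x] linmaps_uminus[OF D2 M2.module_axioms M3.module_axioms c[OF x]] by simp
qed

lemma suspension_homology_trivial:
  assumes Y: "chain_complex K Y"
    and triv: "cycles (FOb suspension Y) (n + 1) \<subseteq> boundaries (FOb suspension Y) (n + 1)"
  shows "cycles Y n \<subseteq> boundaries Y n"
proof
  interpret M1: module K "Md Y (n - 1)" using Y by (rule chain_complex_module)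
  fix x assume x: "x \<in> cycles Y n"
  have d: "n + 1 - 1 = n" "n + 1 - 2 = n - 1" "n + 1 + 1 - 1 = n + 1" "n + 1 + 1 - 2 = n" by simp_all
  from x have "x \<in> cycles (FOb suspension Y) (n + 1)"
    by (simp add: cycles_def suspension_def)
  then have "x \<in> boundaries (FOb suspension Y) (n + 1)" using triv by blast
  then obtain y where y: "y \<in> carrier (Md Y (n + 1))" "x = \<ominus>\<^bsub>Md Y n\<^esub> Df Y (n + 1) y"
    unfolding boundaries_iff suspension_def func.simps cx.simps d by auto
  then show "x \<in> boundaries Y n"
    using boundaries_uminus[OF Y, of "Df Y (n + 1) y" n] by (auto simp: boundaries_iff)
qed

text \<open>If \<open>n\<close> is the highest unchanged degree, then the localization of \<open>S\<^sup>n\<close> has homology in degree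
  \<open>n\<close>, whereas the localization of its suspension is acyclic in degree \<open>n + 1\<close>.  So localization does not
  commute with suspension.\<close>

lemma stable_unchanged_degrees:
  fixes K :: "'k ring" and S :: "(('k, 'a) cx, int \<Rightarrow> 'a \<Rightarrow> 'a) arr set"
  assumes K: "field K" and L: "left_bousfield_localization K Unbounded S Q q R r"
    and st: "stable_localization K Q R"
  shows "unchanged_degrees (Ch K Unbounded) R r = UNIV \<or> unchanged_degrees (Ch K Unbounded) R r = {}"
proof (rule ccontr)
  define U where "U = unchanged_degrees (Ch K Unbounded) R r"
  let ?C = "Ch K Unbounded"
  assume "\<not> ?thesis"
  then obtain a b where ab: "a \<in> U" "b \<notin> U" by (auto simp: U_def)
  have dc: "down_closed U" unfolding U_def by (rule unchanged_degrees_down_closed)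
  have "\<exists>n. n \<in> U \<and> n + 1 \<notin> U"
  proof (rule ccontr)
    assume none: "\<not> ?thesis"
    have "m \<in> U" if "a \<le> m" for m using that by (induction rule: int_ge_induct) (use ab none in auto)
    then have "\<not> a \<le> b" using ab by blast
    then show False using ab dc by (auto simp: down_closed_def)
  qed
  then obtain n where n: "n \<in> U" "n + 1 \<notin> U" by blast
  have Q: "\<And>X. X \<in> Ob ?C \<Longrightarrow> FOb Q X \<in> Ob ?C \<and> (FOb Q X, X, q X) \<in> quasi_isos K Unbounded"
    using L by (auto simp: left_bousfield_localization_def cofibrant_replacement_def cofibrant_def Ch_model_def)
  have R: "\<And>X. X \<in> Ob ?C \<Longrightarrow> FOb R X \<in> Ob ?C \<and> r X \<in> chain_maps K X (FOb R X)"
    using L by (auto simp: left_bousfield_localization_def fibrant_replacement_def is_functor_def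
        is_nat_trans_def id_func_def)
  from n(2) obtain j Z where j: "Z \<in> Ob ?C" "\<not> homology_bij Z (FOb R Z) (r Z) j"
    by (auto simp: U_def unchanged_degrees_def)
  from vector_line_exists[OF K Ch_ObD[OF j(1)] Ch_ObD _ j(2)] R[OF j(1)]
  obtain V e where "vector_line K (V :: ('k, 'a) module) e" by blast
  then interpret vector_line K V e .
  let ?X = "strand {n}"
  have X: "?X \<in> Ob ?C" by (rule strand_Ob) auto
  have susp: "FOb suspension Y \<in> Ob ?C" if "Y \<in> Ob ?C" for Y :: "('k, 'a) cx"
    using suspension_complex[OF Ch_ObD[OF that]] by (simp add: Ch_def)
  have nX: "\<not> cycles ?X n \<subseteq> boundaries ?X n"
  proof
    assume "cycles ?X n \<subseteq> boundaries ?X n"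
    then have "e \<in> boundaries ?X n" using e_cycle by blast
    then show False using e by (auto simp: boundaries_iff Df_strand carrier_strand)
  qed
  have LX: "\<not> cycles (FOb R (FOb Q ?X)) n \<subseteq> boundaries (FOb R (FOb Q ?X)) n"
  proof -
    have "homology_bij (FOb Q ?X) ?X (q ?X) n" "q ?X \<in> chain_maps K (FOb Q ?X) ?X"
      using Q[OF X] by (auto simp: quasi_isos_iff Arr_def)
    then have "\<not> cycles (FOb Q ?X) n \<subseteq> boundaries (FOb Q ?X) n"
      using homology_bij_transfer_trivial[of K "FOb Q ?X" ?X "q ?X" n] nX Q[OF X] X by (auto dest: Ch_ObD)
    moreover have "homology_bij (FOb Q ?X) (FOb R (FOb Q ?X)) (r (FOb Q ?X)) n"
      using localization_homology(1)[OF K L, of "FOb Q ?X" n] n(1) Q[OF X] by (simp add: U_def)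
    ultimately show ?thesis
      using homology_bij_transfer_trivial[of K "FOb Q ?X" "FOb R (FOb Q ?X)" "r (FOb Q ?X)" n]
        Q[OF X] R[of "FOb Q ?X"] by (auto dest: Ch_ObD)
  qed
  have LS: "cycles (FOb R (FOb Q (FOb suspension ?X))) (n + 1) \<subseteq>
      boundaries (FOb R (FOb Q (FOb suspension ?X))) (n + 1)"
    using localization_homology(2)[OF K L, of "FOb Q (FOb suspension ?X)" "n + 1"] n(2) Q[OF susp[OF X]]
    by (simp add: U_def)
  have ob: "FOb R (FOb Q (FOb suspension ?X)) \<in> Ob ?C" "FOb R (FOb Q ?X) \<in> Ob ?C"
    using Q[OF susp[OF X]] Q[OF X] R by blast+
  obtain p where "ho_iso ?C (quasi_isos K Unbounded) (FOb R (FOb Q (FOb suspension ?X)))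
      (FOb suspension (FOb R (FOb Q ?X))) p"
    using st X by (auto simp: stable_localization_def Let_def comp_func_def)
  from ho_iso_homology_trivial[OF this Ch_ObD[OF ob(1)] LS Ch_ObD[OF susp[OF ob(2)]]]
  have "cycles (FOb suspension (FOb R (FOb Q ?X))) (n + 1) \<subseteq>
      boundaries (FOb suspension (FOb R (FOb Q ?X))) (n + 1)" .
  then have "cycles (FOb R (FOb Q ?X)) n \<subseteq> boundaries (FOb R (FOb Q ?X)) n"
    by (rule suspension_homology_trivial[OF Ch_ObD[OF ob(2)]])
  then show False using LX by simp
qed

text \<open>The natural choice is the truncation at the unchanged degrees and the lift is the projection to it.\<close>

lemma localization_preserves_algebras:
  fixes K :: "'k ring" and S :: "(('k, 'a) cx, int \<Rightarrow> 'a \<Rightarrow> 'a) arr set" and P :: "('c, 'k, 'a) operad"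
  assumes K: "field K" and L: "left_bousfield_localization K g S Q q R r" and P: "colored_operad K g P"
    and gU: "g = NonNeg \<or> unchanged_degrees (Ch K g) R r = UNIV \<or> unchanged_degrees (Ch K g) R r = {}"
  shows "preserves_algebras K g Q q R r P"
proof -
  let ?C = "Ch K g"
  let ?M = "power_cat ?C :: ('c \<Rightarrow> ('k, 'a) cx, 'c \<Rightarrow> int \<Rightarrow> 'a \<Rightarrow> 'a) cat"
  let ?W = "power_arr (quasi_isos K g) :: ('c \<Rightarrow> ('k, 'a) cx, 'c \<Rightarrow> int \<Rightarrow> 'a \<Rightarrow> 'a) arr set"
  let ?A = "Alg K g P"
  let ?Ac = "full_subcat ?A (cofibrant_algebras K g P)"
  define U where "U = unchanged_degrees ?C R r"
  have U: "down_closed U" unfolding U_def by (rule unchanged_degrees_down_closed)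
  have P': "operad_typed K g P" using P by (simp add: colored_operad_def)
  have Q: "FOb Q X \<in> Ob ?C" "(FOb Q X, X, q X) \<in> quasi_isos K g" if "X \<in> Ob ?C" for X
    using L that
    by (auto simp: left_bousfield_localization_def cofibrant_replacement_def cofibrant_def Ch_model_def)
  have R: "FOb R X \<in> Ob ?C" "r X \<in> chain_maps K X (FOb R X)" if "X \<in> Ob ?C" for X
    using L that by (auto simp: left_bousfield_localization_def fibrant_replacement_def is_functor_def
        is_nat_trans_def id_func_def)
  have AOb: "fst E c \<in> Ob ?C" if "E \<in> Ob ?A" for E c
    using that by (cases E) (auto simp: Alg_def operad_algebra_def)
  have AC: "chain_complex K (fst E c)" if "E \<in> Ob ?A" for E c using Ch_ObD[OF AOb[OF that]] .
  have quot: "algebra_quotient K g P (fst E) (snd E) (\<lambda>c. trunc U (fst E c)) (\<lambda>c. to_trunc U (fst E c))"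
    if "E \<in> Ob ?A" for E
    using that gU unfolding U_def[symmetric] by (intro trunc_algebra_quotient[OF P' _ U]) (auto simp: Alg_def)
  have TOb: "trunc_alg U E \<in> Ob ?A" if "E \<in> Ob ?A" for E
    using algebra_quotient.quotient_is_algebra[OF quot[OF that]] by (simp add: trunc_alg_def Alg_def)
  have fT: "fst (trunc_alg U E) = (\<lambda>c. trunc U (fst E c))" for E :: "('c, 'k, 'a) alg"
    by (simp add: trunc_alg_def)

  \<comment> \<open>Truncation inverts \<open>q\<close> and \<open>r\<close>, and local objects are already truncated up to weak equivalence.\<close>
  have Wq: "(trunc U (FOb Q X), trunc U X, trunc_map U (FOb Q X) (q X)) \<in> quasi_isos K g"
    and Wr: "(trunc U (FOb Q X), trunc U (FOb R (FOb Q X)), trunc_map U (FOb Q X) (r (FOb Q X))) \<in> quasi_isos K g"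
    and Wp: "(FOb R (FOb Q X), trunc U (FOb R (FOb Q X)), to_trunc U (FOb R (FOb Q X))) \<in> quasi_isos K g"
    if X: "X \<in> Ob ?C" for X
  proof -
    show "(trunc U (FOb Q X), trunc U X, trunc_map U (FOb Q X) (q X)) \<in> quasi_isos K g"
      using Q(2)[OF X] by (intro trunc_map_quasi_iso[OF _ U]) (auto simp: quasi_isos_iff)
    show "(trunc U (FOb Q X), trunc U (FOb R (FOb Q X)), trunc_map U (FOb Q X) (r (FOb Q X))) \<in> quasi_isos K g"
      using localization_homology(1)[OF K L Q(1)[OF X]] R[OF Q(1)[OF X]] Q(1)[OF X]
      by (intro trunc_map_quasi_iso[OF _ U]) (auto simp: Arr_def U_def)
    show "(FOb R (FOb Q X), trunc U (FOb R (FOb Q X)), to_trunc U (FOb R (FOb Q X))) \<in> quasi_isos K g"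
      using localization_homology(2)[OF K L Q(1)[OF X]] R(1)[OF Q(1)[OF X]]
      by (intro to_trunc_quasi_iso[OF _ U]) (auto simp: U_def)
  qed
  have pa: "(X, Y, f) \<in> ?W \<inter> Arr ?M" if "\<And>c. (X c, Y c, f c) \<in> quasi_isos K g" for X Y f
    using that by (auto simp: power_arr_def power_cat_def Arr_def quasi_isos_iff)
  have local: "\<exists>\<beta>. ho_iso ?M ?W (fst (trunc_alg U E)) (Loc_obj Q R (fst E)) \<beta> \<and>
      ho_eq ?M ?W (fst E) (Loc_obj Q R (fst E))
        (Fwd (fst E) (fst (trunc_alg U E)) (\<lambda>c. to_trunc U (fst E c)) # \<beta>) (Loc_unit Q q R r (fst E))"
    if E: "E \<in> Ob ?A" for E
  proof -
    let ?X = "fst E" and ?Q = "\<lambda>c. FOb Q (fst E c)" and ?L = "\<lambda>c. FOb R (FOb Q (fst E c))"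
    let ?TX = "\<lambda>c. trunc U (?X c)" and ?TQ = "\<lambda>c. trunc U (?Q c)" and ?TL = "\<lambda>c. trunc U (?L c)"
    let ?q = "\<lambda>c. q (?X c)" and ?r = "\<lambda>c. r (?Q c)"
    let ?pX = "\<lambda>c. to_trunc U (?X c)" and ?pQ = "\<lambda>c. to_trunc U (?Q c)" and ?pL = "\<lambda>c. to_trunc U (?L c)"
    let ?tq = "\<lambda>c. trunc_map U (?Q c) (?q c)" and ?tr = "\<lambda>c. trunc_map U (?Q c) (?r c)"
    note X = AOb[OF E]
    note XC = Ch_ObD[OF X]
    note QC = Ch_ObD[OF Q(1)[OF X]]
    note RC = Ch_ObD[OF R(1)[OF Q(1)[OF X]]]
    have qc: "?q c \<in> chain_maps K (?Q c) (?X c)" for c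
      using Q(2)[OF X] by (simp add: quasi_isos_iff Arr_def)
    note rc = R(2)[OF Q(1)[OF X]]
    have arr: "(Y, Z, h) \<in> Arr ?M"
      if "\<And>c. Y c \<in> Ob ?C" "\<And>c. Z c \<in> Ob ?C" "\<And>c. h c \<in> chain_maps K (Y c) (Z c)"
      for Y Z h using that by (simp add: Arr_def power_cat_def)
    have 1: "(?Q, ?X, ?q) \<in> ?W \<inter> Arr ?M" by (rule pa, rule Q(2)[OF X])
    have 2: "(?Q, ?L, ?r) \<in> Arr ?M" by (rule arr) (simp_all add: Q(1)[OF X] R[OF Q(1)[OF X]])
    have 3: "(?X, ?TX, ?pX) \<in> Arr ?M"
      by (rule arr) (simp_all add: X trunc_Ob[OF X U] to_trunc_chain_map[OF XC U])
    have 4: "(?Q, ?TQ, ?pQ) \<in> Arr ?M"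
      by (rule arr) (simp_all add: Q(1)[OF X] trunc_Ob[OF Q(1)[OF X] U] to_trunc_chain_map[OF QC U])
    have 5: "(?L, ?TL, ?pL) \<in> ?W \<inter> Arr ?M" by (rule pa, rule Wp[OF X])
    have 6: "(?TQ, ?TX, ?tq) \<in> ?W \<inter> Arr ?M" by (rule pa, rule Wq[OF X])
    have 7: "(?TQ, ?TL, ?tr) \<in> ?W \<inter> Arr ?M" by (rule pa, rule Wr[OF X])
    have 8: "Cmp ?M ?Q ?X ?TX ?pX ?q = Cmp ?M ?Q ?TQ ?TX ?tq ?pQ"
      by (auto simp: power_cat_def Ch_Cmp trunc_map_natural[OF QC XC qc U] intro!: ext restrict_ext)
    have 9: "Cmp ?M ?Q ?L ?TL ?pL ?r = Cmp ?M ?Q ?TQ ?TL ?tr ?pQ"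
      by (auto simp: power_cat_def Ch_Cmp trunc_map_natural[OF QC RC rc U] intro!: ext restrict_ext)
    show ?thesis
      using zigzag_through_natural_transformation[OF category_power_cat[OF category_Ch] 1 2 3 4 5 6 7 8 9]
      unfolding fT Loc_unit_def Loc_obj_def by blast
  qed
  have weq: "weakly_equivalent ?M ?W (fst (trunc_alg U E)) (Loc_obj Q R (fst E))" if E: "E \<in> Ob ?A" for E
  proof -
    note X = AOb[OF E]
    let ?TQ = "\<lambda>c. trunc U (FOb Q (fst E c))" and ?TL = "\<lambda>c. trunc U (FOb R (FOb Q (fst E c)))"
    define step where "step = (\<lambda>X Y. \<exists>w. (X, Y, w) \<in> ?W \<inter> Arr ?M)"
    have "step ?TQ (fst (trunc_alg U E))" unfolding fT step_def by (intro exI, rule pa, rule Wq[OF X])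
    then have 1: "equivclp step (fst (trunc_alg U E)) ?TQ" by (intro equivclp_sym[OF r_into_equivclp])
    have "step ?TQ ?TL" unfolding step_def by (intro exI, rule pa, rule Wr[OF X])
    then have 2: "equivclp step ?TQ ?TL" by (intro r_into_equivclp)
    have "step (Loc_obj Q R (fst E)) ?TL"
      unfolding Loc_obj_def step_def by (intro exI, rule pa, rule Wp[OF X])
    then have 3: "equivclp step ?TL (Loc_obj Q R (fst E))" by (intro equivclp_sym[OF r_into_equivclp])
    show ?thesis
      unfolding weakly_equivalent_def step_def[symmetric] by (rule equivclp_trans[OF 1 equivclp_trans[OF 2 3]])
  qed
  define T :: "(('c, 'k, 'a) alg, 'c \<Rightarrow> int \<Rightarrow> 'a \<Rightarrow> 'a, ('c, 'k, 'a) alg, 'c \<Rightarrow> int \<Rightarrow> 'a \<Rightarrow> 'a) func"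
    where "T = \<lparr>FOb = trunc_alg U, FMap = \<lambda>E F f c. trunc_map U (fst E c) (f c)\<rparr>"
  define l where "l E c = to_trunc U (fst E c)" for E :: "('c, 'k, 'a) alg" and c
  have AcOb: "E \<in> Ob ?A" if "E \<in> Ob ?Ac" for E
    using that by (simp add: full_subcat_def cofibrant_algebras_def)
  have Ac: "Hom ?Ac = algebra_homs K g P" "Hom ?A = algebra_homs K g P"
    "Idn ?Ac E = (\<lambda>c. Idn ?C (fst E c))" "Idn ?A E = (\<lambda>c. Idn ?C (fst E c))"
    "Cmp ?Ac E F G h' h = (\<lambda>c. Cmp ?C (fst E c) (fst F c) (fst G c) (h' c) (h c))"
    "Cmp ?A E F G h' h = (\<lambda>c. Cmp ?C (fst E c) (fst F c) (fst G c) (h' c) (h c))" for E F G h h'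
    by (simp_all add: full_subcat_def Alg_def power_cat_def)
  have hc: "f c \<in> chain_maps K (fst E c) (fst F c)" if "f \<in> algebra_homs K g P E F" for E F f c
    using that by (simp add: algebra_homs_iff)
  have hom: "(\<lambda>c. trunc_map U (fst E c) (f c)) \<in> algebra_homs K g P (trunc_alg U E) (trunc_alg U F)"
    if E: "E \<in> Ob ?A" and F: "F \<in> Ob ?A" and f: "f \<in> algebra_homs K g P E F" for E F f
    using quotient_hom[OF quot[OF E] quot[OF F], of f "\<lambda>c. trunc_map U (fst E c) (f c)"]
      f trunc_map_chain_map[OF AC[OF E] AC[OF F] hc[OF f] U] trunc_map_natural[OF AC[OF E] AC[OF F] hc[OF f] U]
    by (simp add: trunc_alg_def)
  have "is_functor ?Ac ?A T"
    unfolding is_functor_def Ac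
  proof (intro conjI ballI)
    fix E assume E: "E \<in> Ob ?Ac"
    show "FOb T E \<in> Ob ?A" using TOb[OF AcOb[OF E]] by (simp add: T_def)
    show "FMap T E E (\<lambda>c. Idn ?C (fst E c)) = (\<lambda>c. Idn ?C (fst (FOb T E) c))"
      using trunc_map_id[OF AC[OF AcOb[OF E]] U] by (simp add: T_def fT)
  next
    fix E F f assume "E \<in> Ob ?Ac" "F \<in> Ob ?Ac" "f \<in> algebra_homs K g P E F"
    then show "FMap T E F f \<in> algebra_homs K g P (FOb T E) (FOb T F)"
      using hom[OF AcOb AcOb] by (simp add: T_def)
  next
    fix E F G f f' assume E: "E \<in> Ob ?Ac" "F \<in> Ob ?Ac" "G \<in> Ob ?Ac"
      and f: "f \<in> algebra_homs K g P E F" "f' \<in> algebra_homs K g P F G"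
    show "FMap T E G (\<lambda>c. Cmp ?C (fst E c) (fst F c) (fst G c) (f' c) (f c)) =
        (\<lambda>c. Cmp ?C (fst (FOb T E) c) (fst (FOb T F) c) (fst (FOb T G) c) (FMap T F G f' c) (FMap T E F f c))"
      using trunc_map_comp[OF AC[OF AcOb[OF E(1)]] AC[OF AcOb[OF E(2)]] AC[OF AcOb[OF E(3)]] hc[OF f(1)] hc[OF f(2)] U]
      by (simp add: T_def fT)
  qed
  moreover have "is_nat_trans ?Ac ?A id_func T l"
    unfolding is_nat_trans_def Ac
  proof (intro conjI ballI)
    fix E assume "E \<in> Ob ?Ac"
    then show "l E \<in> algebra_homs K g P (FOb id_func E) (FOb T E)"
      using algebra_quotient.quotient_map_is_hom[OF quot[OF AcOb]]
      by (simp add: T_def id_func_def trunc_alg_def l_def[abs_def])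
  next
    fix E F f assume E: "E \<in> Ob ?Ac" and F: "F \<in> Ob ?Ac" and f: "f \<in> algebra_homs K g P E F"
    note nat = trunc_map_natural[OF AC[OF AcOb[OF E]] AC[OF AcOb[OF F]] hc[OF f] U]
    show "(\<lambda>c. Cmp ?C (fst (FOb id_func E) c) (fst (FOb id_func F) c) (fst (FOb T F) c) (l F c) (FMap id_func E F f c)) =
       (\<lambda>c. Cmp ?C (fst (FOb id_func E) c) (fst (FOb T E) c) (fst (FOb T F) c) (FMap T E F f c) (l E c))"
      by (intro ext) (auto simp: Ch_Cmp nat T_def id_func_def l_def intro!: restrict_ext)
  qed
  moreover have "\<exists>\<beta>. ho_iso ?M ?W (fst (FOb T E)) (Loc_obj Q R (fst E)) \<beta> \<and>
      ho_eq ?M ?W (fst E) (Loc_obj Q R (fst E))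
        (Fwd (fst E) (fst (FOb T E)) (l E) # \<beta>) (Loc_unit Q q R r (fst E))" if "E \<in> Ob ?Ac" for E
    using local[OF AcOb[OF that]] unfolding T_def func.simps l_def[abs_def] .
  ultimately show ?thesis
    unfolding preserves_algebras_def Let_def using TOb weq by blast
qed

theorem corollary8p1p3:
  fixes K :: "'k ring"
  assumes "field K"
    and "\<forall>n :: nat. n > 0 \<longrightarrow> [n] \<cdot>\<^bsub>K\<^esub> \<one>\<^bsub>K\<^esub> \<noteq> \<zero>\<^bsub>K\<^esub>"
  shows "(\<forall>(S :: (('k, 'a) cx, int \<Rightarrow> 'a \<Rightarrow> 'a) arr set) Q q R r (P :: ('c, 'k, 'a) operad).
            left_bousfield_localization K NonNeg S Q q R r \<and> colored_operad K NonNeg P \<longrightarrow>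
            preserves_algebras K NonNeg Q q R r P) \<and>
         (\<forall>(S :: (('k, 'a) cx, int \<Rightarrow> 'a \<Rightarrow> 'a) arr set) Q q R r (P :: ('c, 'k, 'a) operad).
            left_bousfield_localization K Unbounded S Q q R r \<and> stable_localization K Q R \<and>
            colored_operad K Unbounded P \<longrightarrow>
            preserves_algebras K Unbounded Q q R r P)"
  using localization_preserves_algebras[OF assms(1)] stable_unchanged_degrees[OF assms(1)] by blast

end
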